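(* Assume $n$ is odd. Let $\phi:H_{\bar0}\to W_{\bar1}$ be a $\mathbb Z$-homogeneous derivation (i.e. $\phi([x,y])=[\phi(x),y]+[x,\phi(y)]$ for $x,y\in H_{\bar0}$) with $\phi((H_{\bar0})_{-1}\oplus(H_{\bar0})_0)=0$. Then there exist $\mu,\lambda\in\mathbb F$ and $\lambda_j^{(q)},\mu_j^{(q)}\in\mathbb F$ ($j\in I_0$, $1\le q\le t_j-1$) such that $$\phi=\Gamma_\mu+\lambda\,\mathrm{ad}\,\mathfrak D+\sum_{j\in I_0}\sum_{q=1}^{t_j-1}\big(\lambda_j^{(q)}\Phi_j^{(q)}+\mu_j^{(q)}\Theta_j^{(q)}\big).$$
   Context: Let $\mathbb F$ be an algebraically closed field of characteristic $p>3$. Fix positive integers $m=2r$ and $n$; write $n=2s$ if $n$ is even and $n=2s+1$ if $n$ is odd. Put $I_0=\{1,\dots,m\}$, $I_1=\{m+1,\dots,m+n\}$, $I=I_0\cup I_1$. Fix positive integers $t_1,\dots,t_m$, put $\pi=(\pi_1,\dots,\pi_m)$ with $\pi_i=p^{t_i}-1$, and $\mathbb A=\{\alpha\in\mathbb N_0^m:\alpha_i\le\pi_i\ \forall i\}$; $\varepsilon_i$ is the $i$-th unit vector and $|\alpha|=\sum\alpha_i$. Let $\mathbb B$ be the set of strictly increasing sequences $u=\langle i_1<\dots<i_k\rangle$ of elements of $I_1$ (including $\emptyset$), $|u|=k$, $\mathbb B^0=\{u\in\mathbb B:|u|\text{ even}\}$, $\omega=\langle m+1,\dots,m+n\rangle$.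 Let $\mathcal O=\mathcal O(m,n;\underline t)$ be the supercommutative associative superalgebra with basis $x^{(\alpha)}x^u$ ($\alpha\in\mathbb A,u\in\mathbb B$), where $x^{(\alpha)}x^{(\beta)}=\binom{\alpha+\beta}{\alpha}x^{(\alpha+\beta)}$, $x^{(\alpha)}$ even, $x_{m+1},\dots,x_{m+n}$ odd and pairwise anticommuting, $x^u=x_{i_1}\cdots x_{i_k}$, $x^\emptyset=1$, $x_i:=x^{(\varepsilon_i)}$ for $i\in I_0$, $\mathbb Z$-graded by $\mathrm{zd}(x^{(\alpha)}x^u)=|\alpha|+|u|$. For $i\in I$ let $\partial_i$ be the superderivation of $\mathcal O$ with $\partial_i(x^{(\alpha)})=x^{(\alpha-\varepsilon_i)}$ for $i\in I_0$ and $\partial_i(x_k)=\delta_{ik}$ for $i\in I_1$; parity $\mu(i)=\bar0$ for $i\in I_0$, $\mu(i)=\bar1$ for $i\in I_1$. $W=\{\sum_{i\in I}f_i\partial_i: f_i\in\mathcal O\}$ is the Lie superalgebra with bracket $[f\partial_i,g\partial_j]=f\partial_i(g)\partial_j-(-1)^{p(f\partial_i)p(g\partial_j)}g\partial_j(f)\partial_i$, $\mathbb Z$-graded by $\mathrm{zd}(f\partial_j)=\mathrm{zd}(f)-1$, with even and odd parts $W_{\bar 0},W_{\bar1}$. Define $i'=i+r$ ($1\le i\le r$), $i'=i-r$ ($r<i\le m$), $i'=i+s$ ($m<i\le m+s$), $i'=i-s$ ($m+s<i\le m+2s$), $i'=i$ otherwise; $\tau(i)=1$ for $1\le i\le r$,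 $\tau(i)=-1$ for $r<i\le m$, $\tau(i)=1$ for $i\in I_1$. For $f\in\mathcal O$ put $D_H(f)=\sum_{i\in I}\tau(i)(-1)^{\mu(i)p(f)}\partial_i(f)\partial_{i'}$. Let $H_{\bar0}=\mathrm{span}_{\mathbb F}\{D_H(x^{(\alpha)}x^u):\alpha\in\mathbb A,u\in\mathbb B^0,(\alpha,u)\ne(\pi,\omega)\}$, $\mathbb Z$-graded with $\mathrm{zd}(D_H(f))=\mathrm{zd}(f)-2$ and homogeneous components $(H_{\bar0})_k$, and $\mathcal J=\mathrm{span}_{\mathbb F}\{D_H(x^{(\alpha)}x^u):\alpha\in\mathbb A,u\in\mathbb B^0,(\alpha,u)\ne(\pi,\omega),(\alpha,u)\ne(\pi,\emptyset)\}$, so $H_{\bar0}=\mathcal J\oplus\mathbb FD_H(x^{(\pi)})$. A linear map between $\mathbb Z$-graded spaces is $\mathbb Z$-homogeneous of degree $d$ if it maps degree $k$ into degree $k+d$. For $\mu\in\mathbb F$, $\Gamma_\mu:H_{\bar0}\to W_{\bar1}$ is the linear map with $\Gamma_\mu(\mathcal J)=0$ and $\Gamma_\mu(D_H(x^{(\pi)}))=\mu D_H(x^\omega)$. Let $\mathfrak D=\sum_{t\in I_1}x_tx_{m+n}\partial_t\in W_{\bar1}$ and $\mathrm{ad}\,\mathfrak D(E)=[\mathfrak D,E]$. For $j\in I_0$ and a positive integer $q$, $\Phi_j^{(q)},\Theta_j^{(q)}:H_{\bar0}\to W_{\bar1}$ are the linear maps $\Phi_j^{(q)}(D_H(f))=\partial_j^{p^q}(f)D_H(x^\omega)$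 and $\Theta_j^{(q)}(D_H(f))=x^\omega(\mathrm{ad}\,\partial_j)^{p^q}(D_H(f))$, with $\mathrm{ad}\,\partial_j(E)=[\partial_j,E]$. *)

theory Defs
  imports Main "HOL-Computational_Algebra.Polynomial"
begin

definition alg_closed :: "'a::field itself \<Rightarrow> bool" where
  "alg_closed _ \<longleftrightarrow> (\<forall>P::'a poly. degree P > 0 \<longrightarrow> (\<exists>x. poly P x = 0))"

text \<open>Basis index of O: pairs (alpha, u); alpha :: nat => nat is the multi-index
 (entries 1..m), u is a finite set of odd indices, identified with the strictly increasing
 sequence of its elements.\<close>
type_synonym idx = "(nat \<Rightarrow> nat) \<times> nat set"
text \<open>Elements of O: coefficient functions on basis indices.\<close>
type_synonym 'a Oel = "idx \<Rightarrow> 'a"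
text \<open>Elements of W: sum_i f_i d_i is represented by i |-> f_i.\<close>
type_synonym 'a Wel = "nat \<Rightarrow> 'a Oel"

definition I0 :: "nat \<Rightarrow> nat set" where "I0 m = {1..m}"
definition I1 :: "nat \<Rightarrow> nat \<Rightarrow> nat set" where "I1 m n = {m+1..m+n}"
definition Iall :: "nat \<Rightarrow> nat \<Rightarrow> nat set" where "Iall m n = I0 m \<union> I1 m n"

definition validA :: "nat \<Rightarrow> nat \<Rightarrow> (nat \<Rightarrow> nat) \<Rightarrow> (nat \<Rightarrow> nat) \<Rightarrow> bool" where
  "validA m p t \<alpha> \<longleftrightarrow> (\<forall>i. if i \<in> I0 m then \<alpha> i \<le> p ^ t i - 1 else \<alpha> i = 0)"

definition piA :: "nat \<Rightarrow> nat \<Rightarrow> (nat \<Rightarrow> nat) \<Rightarrow> nat \<Rightarrow> nat" where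
  "piA m p t = (\<lambda>i. if i \<in> I0 m then p ^ t i - 1 else 0)"

definition epsA :: "nat \<Rightarrow> nat \<Rightarrow> nat" where "epsA j = (\<lambda>i. if i = j then 1 else 0)"

definition zeroA :: "nat \<Rightarrow> nat" where "zeroA = (\<lambda>i. 0)"

definition Bas :: "nat \<Rightarrow> nat \<Rightarrow> nat \<Rightarrow> (nat \<Rightarrow> nat) \<Rightarrow> idx set" where
  "Bas m n p t = {(\<alpha>, u). validA m p t \<alpha> \<and> u \<subseteq> I1 m n}"

definition absA :: "nat \<Rightarrow> (nat \<Rightarrow> nat) \<Rightarrow> nat" where
  "absA m \<alpha> = (\<Sum>i\<in>I0 m. \<alpha> i)"

definition zdO :: "nat \<Rightarrow> idx \<Rightarrow> int" where
  "zdO m b = int (absA m (fst b)) + int (card (snd b))"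

definition parO :: "idx \<Rightarrow> nat" where "parO b = card (snd b) mod 2"

definition muI :: "nat \<Rightarrow> nat \<Rightarrow> nat" where "muI m i = (if i \<in> I0 m then 0 else 1)"

definition tauI :: "nat \<Rightarrow> nat \<Rightarrow> int" where
  "tauI m i = (if 1 \<le> i \<and> i \<le> m div 2 then 1 else if m div 2 < i \<and> i \<le> m then -1 else 1)"

definition primeI :: "nat \<Rightarrow> nat \<Rightarrow> nat \<Rightarrow> nat" where
  "primeI m n i =
     (if 1 \<le> i \<and> i \<le> m div 2 then i + m div 2
      else if m div 2 < i \<and> i \<le> m then i - m div 2
      else if m < i \<and> i \<le> m + n div 2 then i + n div 2
      else if m + n div 2 < i \<and> i \<le> m + 2 * (n div 2) then i - n div 2
      else i)"

definition bas :: "idx \<Rightarrow> 'a::field Oel" where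
  "bas b = (\<lambda>c. if c = b then 1 else 0)"

definition osmul :: "'a::field \<Rightarrow> 'a Oel \<Rightarrow> 'a Oel" where
  "osmul c f = (\<lambda>b. c * f b)"

text \<open>sign with x^u x^v = sgn u v * x^(u Un v) for disjoint u, v\<close>
definition sgnUV :: "nat set \<Rightarrow> nat set \<Rightarrow> 'a::field" where
  "sgnUV u v = (-1) ^ card {(i, j). i \<in> u \<and> j \<in> v \<and> j < i}"

definition binomA :: "nat \<Rightarrow> (nat \<Rightarrow> nat) \<Rightarrow> (nat \<Rightarrow> nat) \<Rightarrow> nat" where
  "binomA m \<alpha> \<beta> = (\<Prod>i\<in>I0 m. (\<alpha> i + \<beta> i) choose \<alpha> i)"

definition multcoef :: "nat \<Rightarrow> nat \<Rightarrow> nat \<Rightarrow> (nat \<Rightarrow> nat) \<Rightarrow> idx \<Rightarrow> idx \<Rightarrow> idx \<Rightarrow> 'a::field" where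
  "multcoef m n p t b c d =
     (if d \<in> Bas m n p t \<and> fst d = (\<lambda>i. fst b i + fst c i) \<and> snd d = snd b \<union> snd c
         \<and> snd b \<inter> snd c = {}
      then of_nat (binomA m (fst b) (fst c)) * sgnUV (snd b) (snd c) else 0)"

definition omult :: "nat \<Rightarrow> nat \<Rightarrow> nat \<Rightarrow> (nat \<Rightarrow> nat) \<Rightarrow> 'a::field Oel \<Rightarrow> 'a Oel \<Rightarrow> 'a Oel" where
  "omult m n p t f g = (\<lambda>d. \<Sum>b\<in>Bas m n p t. \<Sum>c\<in>Bas m n p t. f b * g c * multcoef m n p t b c d)"

text \<open>the superderivation d_i of O (coefficient description: for i in I0,
 d_i x^(alpha) x^u = x^(alpha - eps_i) x^u; for i in I1, d_i x^u = (-1)^(number of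
 elements of u below i) x^(u - {i}) if i in u, and 0 otherwise)\<close>
definition pd :: "nat \<Rightarrow> nat \<Rightarrow> nat \<Rightarrow> (nat \<Rightarrow> nat) \<Rightarrow> nat \<Rightarrow> 'a::field Oel \<Rightarrow> 'a Oel" where
  "pd m n p t i f = (\<lambda>(\<gamma>, w).
     if (\<gamma>, w) \<in> Bas m n p t then
       (if i \<in> I0 m then
          (if ((\<lambda>k. \<gamma> k + epsA i k), w) \<in> Bas m n p t then f ((\<lambda>k. \<gamma> k + epsA i k), w) else 0)
        else if i \<in> I1 m n then
          (if i \<notin> w then (-1) ^ card {k\<in>w. k < i} * f (\<gamma>, insert i w) else 0)
        else 0)
     else 0)"

definition wsingle :: "'a::field Oel \<Rightarrow> nat \<Rightarrow> 'a Wel" where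
  "wsingle f j = (\<lambda>k. if k = j then f else (\<lambda>_. 0))"

definition wzero :: "'a::field Wel" where "wzero = (\<lambda>k b. 0)"

definition wadd :: "'a::field Wel \<Rightarrow> 'a Wel \<Rightarrow> 'a Wel" where
  "wadd E F = (\<lambda>k b. E k b + F k b)"

definition wsmul :: "'a::field \<Rightarrow> 'a Wel \<Rightarrow> 'a Wel" where
  "wsmul c E = (\<lambda>k b. c * E k b)"

definition wsum :: "('x \<Rightarrow> 'a::field Wel) \<Rightarrow> 'x set \<Rightarrow> 'a Wel" where
  "wsum F A = (\<lambda>k b. \<Sum>x\<in>A. F x k b)"

definition omw :: "nat \<Rightarrow> nat \<Rightarrow> nat \<Rightarrow> (nat \<Rightarrow> nat) \<Rightarrow> 'a::field Oel \<Rightarrow> 'a Wel \<Rightarrow> 'a Wel" where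
  "omw m n p t g E = (\<lambda>k. omult m n p t g (E k))"

text \<open>bracket of basis elements x^b d_i and x^c d_j:
  [f d_i, g d_j] = f d_i(g) d_j - (-1)^(p(f d_i) p(g d_j)) g d_j(f) d_i\<close>
definition brbas :: "nat \<Rightarrow> nat \<Rightarrow> nat \<Rightarrow> (nat \<Rightarrow> nat) \<Rightarrow> idx \<Rightarrow> nat \<Rightarrow> idx \<Rightarrow> nat \<Rightarrow> 'a::field Wel" where
  "brbas m n p t b i c j =
     wadd (wsingle (omult m n p t (bas b) (pd m n p t i (bas c))) j)
          (wsmul (- ((-1) ^ (((parO b + muI m i) mod 2) * ((parO c + muI m j) mod 2))))
                 (wsingle (omult m n p t (bas c) (pd m n p t j (bas b))) i))"

definition wbr :: "nat \<Rightarrow> nat \<Rightarrow> nat \<Rightarrow> (nat \<Rightarrow> nat) \<Rightarrow> 'a::field Wel \<Rightarrow> 'a Wel \<Rightarrow> 'a Wel" where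
  "wbr m n p t E F =
     wsum (\<lambda>((b, i), (c, j)). wsmul (E i b * F j c) (brbas m n p t b i c j))
          ((Bas m n p t \<times> Iall m n) \<times> (Bas m n p t \<times> Iall m n))"

definition Wset :: "nat \<Rightarrow> nat \<Rightarrow> nat \<Rightarrow> (nat \<Rightarrow> nat) \<Rightarrow> 'a::field Wel set" where
  "Wset m n p t = {E. \<forall>i b. E i b \<noteq> 0 \<longrightarrow> i \<in> Iall m n \<and> b \<in> Bas m n p t}"

definition W1 :: "nat \<Rightarrow> nat \<Rightarrow> nat \<Rightarrow> (nat \<Rightarrow> nat) \<Rightarrow> 'a::field Wel set" where
  "W1 m n p t = {E \<in> Wset m n p t. \<forall>i b. E i b \<noteq> 0 \<longrightarrow> odd (parO b + muI m i)}"

text \<open>homogeneous component W_k, zd(f d_j) = zd(f) - 1\<close>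
definition Wdeg :: "nat \<Rightarrow> nat \<Rightarrow> nat \<Rightarrow> (nat \<Rightarrow> nat) \<Rightarrow> int \<Rightarrow> 'a::field Wel set" where
  "Wdeg m n p t k = {E \<in> Wset m n p t. \<forall>i b. E i b \<noteq> 0 \<longrightarrow> zdO m b - 1 = k}"

definition wspan :: "'a::field Wel set \<Rightarrow> 'a Wel set" where
  "wspan S = {wsum (\<lambda>v. wsmul (c v) v) A | A c. finite A \<and> A \<subseteq> S}"

text \<open>D_H(f) for f homogeneous of parity pf\<close>
definition DH :: "nat \<Rightarrow> nat \<Rightarrow> nat \<Rightarrow> (nat \<Rightarrow> nat) \<Rightarrow> nat \<Rightarrow> 'a::field Oel \<Rightarrow> 'a Wel" where
  "DH m n p t pf f = wsum (\<lambda>i. wsingle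
        (osmul (of_int (tauI m i) * (-1) ^ (muI m i * pf)) (pd m n p t i f)) (primeI m n i))
     (Iall m n)"

definition DHb :: "nat \<Rightarrow> nat \<Rightarrow> nat \<Rightarrow> (nat \<Rightarrow> nat) \<Rightarrow> idx \<Rightarrow> 'a::field Wel" where
  "DHb m n p t b = DH m n p t (parO b) (bas b)"

definition omegaI :: "nat \<Rightarrow> nat \<Rightarrow> idx" where "omegaI m n = (zeroA, I1 m n)"

definition Hidx :: "nat \<Rightarrow> nat \<Rightarrow> nat \<Rightarrow> (nat \<Rightarrow> nat) \<Rightarrow> idx set" where
  "Hidx m n p t = {b \<in> Bas m n p t. even (card (snd b)) \<and> b \<noteq> (piA m p t, I1 m n)}"

definition H0 :: "nat \<Rightarrow> nat \<Rightarrow> nat \<Rightarrow> (nat \<Rightarrow> nat) \<Rightarrow> 'a::field Wel set" where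
  "H0 m n p t = wspan (DHb m n p t ` Hidx m n p t)"

text \<open>homogeneous component (H_0)_k, with zd(D_H f) = zd f - 2\<close>
definition H0deg :: "nat \<Rightarrow> nat \<Rightarrow> nat \<Rightarrow> (nat \<Rightarrow> nat) \<Rightarrow> int \<Rightarrow> 'a::field Wel set" where
  "H0deg m n p t k = wspan (DHb m n p t ` {b \<in> Hidx m n p t. zdO m b - 2 = k})"

text \<open>Gamma_mu on the spanning set: zero on the spanning set of J,
  D_H(x^(pi)) |-> mu D_H(x^omega)\<close>
definition Gam :: "nat \<Rightarrow> nat \<Rightarrow> nat \<Rightarrow> (nat \<Rightarrow> nat) \<Rightarrow> 'a::field \<Rightarrow> idx \<Rightarrow> 'a Wel" where
  "Gam m n p t \<mu> b = (if b = (piA m p t, {}) then wsmul \<mu> (DHb m n p t (omegaI m n)) else wzero)"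

definition frakD :: "nat \<Rightarrow> nat \<Rightarrow> nat \<Rightarrow> (nat \<Rightarrow> nat) \<Rightarrow> 'a::field Wel" where
  "frakD m n p t = wsum (\<lambda>s. wsingle (omult m n p t (bas (zeroA, {s})) (bas (zeroA, {m + n}))) s)
                        (I1 m n)"

definition dW :: "nat \<Rightarrow> 'a::field Wel" where "dW j = wsingle (bas (zeroA, {})) j"

text \<open>Phi_j^(q) (D_H f) = d_j^(p^q)(f) D_H(x^omega), on the spanning set\<close>
definition PhiM :: "nat \<Rightarrow> nat \<Rightarrow> nat \<Rightarrow> (nat \<Rightarrow> nat) \<Rightarrow> nat \<Rightarrow> nat \<Rightarrow> idx \<Rightarrow> 'a::field Wel" where
  "PhiM m n p t j q b = omw m n p t ((pd m n p t j ^^ (p ^ q)) (bas b)) (DHb m n p t (omegaI m n))"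

definition ThetaM :: "nat \<Rightarrow> nat \<Rightarrow> nat \<Rightarrow> (nat \<Rightarrow> nat) \<Rightarrow> nat \<Rightarrow> nat \<Rightarrow> 'a::field Wel \<Rightarrow> 'a Wel" where
  "ThetaM m n p t j q E = omw m n p t (bas (omegaI m n)) ((wbr m n p t (dW j) ^^ (p ^ q)) E)"

end

(* Write psi(f) for the value of the derivation at D_H(f). Since psi kills the elements of degree -1, it
   commutes with the partial derivatives in the even variables and is therefore determined by the
   constant terms (even degree 0) of its values; the cocycle identity becomes a family of relations
   between these constant terms. Since psi kills degree 0, the constant terms are equivariant for
   sp(m) and so(n). Torus weights together with one isotropic bracket show psi(x^(a) x^u) = 0 for
   nonempty u, and so(n)-invariance confines psi(x^(a)) to multiples of D_H(x^omega) and to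
   x^omega W(m). The remaining coefficients are functionals on the divided power algebra which vanish
   on brackets of monomials of degree at least 2, respectively 3; besides x^(pi) only p-power monomials
   escape such brackets, because a binomial coefficient N choose M prime to p
   with 0 < M < N exists unless N is a power of p. The coefficient of ad frakD can always be taken 0. *)

theory Submission
  imports Defs "HOL-Algebra.Exponent"
begin

section \<open>Signs and monomials\<close>

text \<open>Divided powers differentiate without factors, so the coefficient of
  \<open>psi(x^\<alpha>)\<close> at \<open>\<gamma>\<close> is the constant term of
  \<open>psi(x^(\<alpha> - \<gamma>))\<close>; a function \<open>C\<close> of a monomial, a
  component and a set of odd indices therefore carries everything. The constant term of the bracket
  of \<open>D_H(b)\<close> with \<open>psi(c)\<close> involves at most two derivatives of
  \<open>b\<close>. This is the origin of the degree bounds 2 and 3; the smaller one holds for the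
  component \<open>m + n\<close>, in which \<open>D_H\<close> of an even monomial has no entry. One
  obstacle is the last odd index, its own partner because \<open>n\<close> is odd. The torus of
  so(n) does not detect it, so its position is read off from the parity of the values, and rotations
  mixing it with other indices do the rest. Another is the top monomial, whose exponents cannot be
  raised: with odd factors attached it is reached by a bracket with coefficient
  \<open>p^t - 1\<close>, which is -1. Symplectic weights hold only modulo \<open>p\<close>: away
  from the component index they merely make exponents divisible by \<open>p\<close> or maximal, and
  explicit brackets of monomials must finish.\<close>

lemma sgnUV_singleton_left:
  "sgnUV {i} v = ((-1) ^ card {j\<in>v. j < i} :: 'a::field)"
proof -
  have "{(a, j). a \<in> {i} \<and> j \<in> v \<and> j < a} = Pair i ` {j\<in>v. j < i}" by auto
  then have "card {(a, j). a \<in> {i} \<and> j \<in> v \<and> j < a} = card {j\<in>v. j < i}"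
    by (simp add: card_image inj_on_def)
  then show ?thesis by (simp add: sgnUV_def)
qed

lemma sgnUV_singleton_right:
  "sgnUV v {i} = ((-1) ^ card {j\<in>v. i < j} :: 'a::field)"
proof -
  have "{(a, j). a \<in> v \<and> j \<in> {i} \<and> j < a} = (\<lambda>a. (a, i)) ` {j\<in>v. i < j}" by auto
  then have "card {(a, j). a \<in> v \<and> j \<in> {i} \<and> j < a} = card {j\<in>v. i < j}"
    by (simp add: card_image inj_on_def)
  then show ?thesis by (simp add: sgnUV_def)
qed

lemma finite_inversions:
  fixes u v :: "nat set"
  assumes "finite u" "finite v"
  shows "finite {(i, j). i \<in> u \<and> j \<in> v \<and> j < i}"
  by (rule finite_subset[of _ "u \<times> v"]) (use assms in auto)

lemma sgnUV_Un_left: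
  assumes "finite u" "finite u'" "finite v" "u \<inter> u' = {}"
  shows "sgnUV (u \<union> u') v = (sgnUV u v * sgnUV u' v :: 'a::field)"
proof -
  let ?S = "\<lambda>u. {(i, j). i \<in> u \<and> j \<in> v \<and> j < i}"
  have "?S (u \<union> u') = ?S u \<union> ?S u'" by auto
  moreover have "card (?S u \<union> ?S u') = card (?S u) + card (?S u')"
    by (rule card_Un_disjoint) (use assms in \<open>auto intro!: finite_inversions\<close>)
  ultimately show ?thesis by (simp add: sgnUV_def power_add)
qed

lemma sgnUV_Un_right:
  assumes "finite u" "finite v" "finite v'" "v \<inter> v' = {}"
  shows "sgnUV u (v \<union> v') = (sgnUV u v * sgnUV u v' :: 'a::field)"
proof -
  let ?S = "\<lambda>v. {(i, j). i \<in> u \<and> j \<in> v \<and> j < i}"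
  have "?S (v \<union> v') = ?S v \<union> ?S v'" by auto
  moreover have "card (?S v \<union> ?S v') = card (?S v) + card (?S v')"
    by (rule card_Un_disjoint) (use assms in \<open>auto intro!: finite_inversions\<close>)
  ultimately show ?thesis by (simp add: sgnUV_def power_add)
qed

lemma sgnUV_square [simp]: "sgnUV u v * sgnUV u v = (1 :: 'a::field)"
  by (simp add: sgnUV_def flip: power_add mult_2)

lemma sgnUV_square_left [simp]: "sgnUV u v * (sgnUV u v * x) = (x :: 'a::field)"
  by (simp flip: mult.assoc)

lemma sgnUV_nonzero [simp]: "sgnUV u v \<noteq> (0 :: 'a::field)"
  by (simp add: sgnUV_def)

lemma sgnUV_empty [simp]: "sgnUV {} v = (1 :: 'a::field)" "sgnUV v {} = (1 :: 'a::field)"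
  by (simp_all add: sgnUV_def)

text \<open>The inversions of \<open>(u, v)\<close> and the transposed inversions of
  \<open>(v, u)\<close> partition \<open>u \<times> v\<close>, so the two signs differ by the parity
  of \<open>card u * card v\<close>.\<close>

lemma sgnUV_swap:
  assumes "finite u" "finite v" "u \<inter> v = {}"
  shows "sgnUV u v = ((-1) ^ (card u * card v) * sgnUV v u :: 'a::field)"
proof -
  let ?A = "{(i, j). i \<in> u \<and> j \<in> v \<and> j < i}" and ?B = "{(i, j). i \<in> v \<and> j \<in> u \<and> j < i}"
  have "card ?B = card (prod.swap ` ?B)" by (simp add: card_image)
  moreover have "?A \<union> prod.swap ` ?B = u \<times> v"
    using assms(3) by (force simp: image_iff)
  moreover have "card (?A \<union> prod.swap ` ?B) = card ?A + card (prod.swap ` ?B)"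
    by (rule card_Un_disjoint) (use assms in \<open>auto intro!: finite_inversions finite_imageI\<close>)
  ultimately have "card u * card v = card ?A + card ?B"
    by (simp flip: card_cartesian_product)
  moreover have "(-1) ^ card ?B * (-1) ^ card ?B = (1 :: 'a)"
    by (simp flip: power_add mult_2)
  ultimately show ?thesis
    by (simp add: sgnUV_def power_add mult.assoc)
qed

text \<open>An index never lies below itself. This reconciles \<open>pd\<close>, which counts in the
  set without \<open>i\<close>, with \<open>pdcoef\<close>, which counts in the set containing
  it.\<close>

lemma sgnUV_insert_self:
  "sgnUV {i} (insert i v) = (sgnUV {i} v :: 'a::field)"
proof -
  have "{j \<in> insert i v. j < i} = {j\<in>v. j < i}" by auto
  then show ?thesis by (simp add: sgnUV_singleton_left)
qed

text \<open>Absorption gives \<open>a * (p ^ k choose a) = p ^ k * (p ^ k - 1 choose a - 1)\<close>: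
  were the binomial prime to \<open>p\<close>, all of \<open>p ^ k\<close> would divide the smaller
  positive number \<open>a\<close>.\<close>

lemma prime_dvd_choose_prime_power:
  fixes p :: nat
  assumes "prime p" "0 < a" "a < p ^ k"
  shows "p dvd p ^ k choose a"
proof (rule ccontr)
  assume "\<not> p dvd p ^ k choose a"
  then have "coprime (p ^ k) (p ^ k choose a)"
    using assms(1) by (simp add: prime_imp_coprime coprime_commute)
  moreover have "a * (p ^ k choose a) = p ^ k * ((p ^ k - 1) choose (a - 1))"
    using times_binomial_minus1_eq[OF assms(2), of "p ^ k"] by simp
  then have "p ^ k dvd a * (p ^ k choose a)" by simp
  ultimately have "p ^ k dvd a" by (simp add: coprime_dvd_mult_left_iff)
  then show False using assms(2,3) by (simp add: dvd_imp_le leD)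
qed

section \<open>Monomial calculus: products, derivatives, Leibniz rule\<close>

definition badd :: "idx \<Rightarrow> idx \<Rightarrow> idx" where
  "badd b c = ((\<lambda>i. fst b i + fst c i), snd b \<union> snd c)"

text \<open>Truncation is not recorded here: \<open>badd b c\<close> may leave \<open>Bas\<close>,
  where the product is zero. Users of this coefficient test membership separately or evaluate
  something that vanishes outside \<open>Bas\<close>.\<close>

definition moncoef :: "nat \<Rightarrow> idx \<Rightarrow> idx \<Rightarrow> 'a::field" where
  "moncoef m b c =
     (if snd b \<inter> snd c = {} then of_nat (binomA m (fst b) (fst c)) * sgnUV (snd b) (snd c) else 0)"

text \<open>Divided powers differentiate without an exponent factor, so only 0 and 1 occur for even
  indices.\<close>

definition pdcoef :: "nat \<Rightarrow> nat \<Rightarrow> nat \<Rightarrow> idx \<Rightarrow> 'a::field" where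
  "pdcoef m n i b =
     (if i \<in> I0 m then (if fst b i > 0 then 1 else 0)
      else if i \<in> I1 m n \<and> i \<in> snd b then sgnUV {i} (snd b) else 0)"

text \<open>Where the derivative vanishes, truncated subtraction leaves the exponent at 0. The
  result thus always remains in \<open>Bas\<close>, and \<open>pdcoef\<close> alone decides about
  vanishing.\<close>

definition pdmon :: "nat \<Rightarrow> nat \<Rightarrow> idx \<Rightarrow> idx" where
  "pdmon m i b =
     (if i \<in> I0 m then ((fst b)(i := fst b i - 1), snd b) else (fst b, snd b - {i}))"

locale superalg =
  fixes m n p :: nat and t :: "nat \<Rightarrow> nat"
  assumes prime_p: "prime p" and p_gt: "p > 3"
    and m_pos: "m > 0" and m_even: "even m" and n_odd: "odd n"
    and t_pos: "\<And>i. i \<in> I0 m \<Longrightarrow> t i > 0"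
begin

abbreviation "BB \<equiv> Bas m n p t"
abbreviation "II \<equiv> Iall m n"
abbreviation "mul \<equiv> omult m n p t"
abbreviation "del \<equiv> pd m n p t"
abbreviation "pr \<equiv> primeI m n"
abbreviation "mu \<equiv> muI m"
abbreviation "tau i \<equiv> of_int (tauI m i)"

lemma finite_I0 [simp]: "finite (I0 m)" and finite_I1 [simp]: "finite (I1 m n)"
  and finite_II [simp]: "finite II"
  by (auto simp: I0_def I1_def Iall_def)

lemma finite_sub_I1: "u \<subseteq> I1 m n \<Longrightarrow> finite u"
  using finite_subset finite_I1 by blast

lemma I0_I1_disjoint: "i \<in> I0 m \<Longrightarrow> i \<notin> I1 m n" and I1_not_I0: "i \<in> I1 m n \<Longrightarrow> i \<notin> I0 m"
  by (auto simp: I0_def I1_def)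

lemma II_iff: "i \<in> II \<longleftrightarrow> i \<in> I0 m \<or> i \<in> I1 m n"
  by (simp add: Iall_def)

lemma finite_BB [simp]: "finite BB"
proof -
  let ?N = "Max (insert 0 ((\<lambda>i. p ^ t i - 1) ` I0 m))"
  have "finite {f. \<forall>i. (i \<in> I0 m \<longrightarrow> f i \<in> {..?N}) \<and> (i \<notin> I0 m \<longrightarrow> f i = 0)}"
    by (rule finite_set_of_finite_funs) auto
  moreover have "BB \<subseteq> {f. \<forall>i. (i \<in> I0 m \<longrightarrow> f i \<in> {..?N}) \<and> (i \<notin> I0 m \<longrightarrow> f i = 0)} \<times> Pow (I1 m n)"
    unfolding Bas_def validA_def
    by (auto simp: Max_ge_iff split: if_splits)
  ultimately show ?thesis by (meson finite_I1 finite_Pow_iff finite_SigmaI finite_subset)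
qed

lemma p_power_pos [simp]: "p ^ k > 0"
  using prime_p prime_gt_0_nat by simp

lemma in_BB_iff:
  "(\<alpha>, u) \<in> BB \<longleftrightarrow> (\<forall>i\<in>I0 m. \<alpha> i < p ^ t i) \<and> (\<forall>i. i \<notin> I0 m \<longrightarrow> \<alpha> i = 0) \<and> u \<subseteq> I1 m n"
proof -
  have "x \<le> p ^ k - 1 \<longleftrightarrow> x < p ^ k" for x k
    using p_power_pos[of k] by linarith
  then show ?thesis unfolding Bas_def validA_def by (auto split: if_splits)
qed

lemma BB_finite_snd: "b \<in> BB \<Longrightarrow> finite (snd b)"
  by (cases b) (auto simp: in_BB_iff finite_sub_I1)

lemma pdmon_in_BB: "b \<in> BB \<Longrightarrow> pdmon m i b \<in> BB"
  by (cases b) (auto simp: pdmon_def in_BB_iff less_imp_diff_less)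

lemma del_I0:
  assumes "i \<in> I0 m"
  shows "del i f (\<gamma>, w) =
    (if (\<gamma>, w) \<in> BB \<and> (\<gamma>(i := \<gamma> i + 1), w) \<in> BB then f (\<gamma>(i := \<gamma> i + 1), w) else 0)"
proof -
  have "(\<lambda>k. \<gamma> k + epsA i k) = \<gamma>(i := \<gamma> i + 1)" by (auto simp: epsA_def)
  then show ?thesis using assms by (simp add: pd_def)
qed

lemma del_I1:
  assumes "i \<in> I1 m n"
  shows "del i f (\<gamma>, w) =
    (if (\<gamma>, w) \<in> BB \<and> i \<notin> w then sgnUV {i} w * f (\<gamma>, insert i w) else 0)"
  using assms I1_not_I0[OF assms] by (simp add: pd_def sgnUV_singleton_left)

lemma del_outside: "i \<notin> II \<Longrightarrow> del i f = (\<lambda>_. 0)"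
  by (auto simp: pd_def II_iff)

lemma del_bas:
  assumes "b \<in> BB"
  shows "del i (bas b) = osmul (pdcoef m n i b) (bas (pdmon m i b) :: 'a::field Oel)"
proof (rule ext)
  fix d :: idx
  obtain \<alpha> u where b: "b = (\<alpha>, u)" by fastforce
  obtain \<gamma> w where d: "d = (\<gamma>, w)" by fastforce
  have BB: "pdmon m i b \<in> BB" using assms by (rule pdmon_in_BB)
  consider "i \<in> I0 m" | "i \<in> I1 m n" | "i \<notin> II" by (auto simp: II_iff)
  then show "del i (bas b) d = osmul (pdcoef m n i b) (bas (pdmon m i b) :: 'a Oel) d"
  proof cases
    case 1
    have *: "\<gamma>(i := \<gamma> i + 1) = \<alpha> \<longleftrightarrow> 0 < \<alpha> i \<and> \<gamma> = \<alpha>(i := \<alpha> i - 1)"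
      by (auto simp: fun_eq_iff)
    show ?thesis
      using 1 BB assms * unfolding b d
      by (auto simp: del_I0 osmul_def bas_def pdcoef_def pdmon_def simp del: fun_upd_apply)
  next
    case 2
    have *: "i \<notin> w \<and> insert i w = u \<longleftrightarrow> i \<in> u \<and> w = u - {i}" by auto
    have "sgnUV {i} u = (sgnUV {i} (u - {i}) :: 'a)" if "i \<in> u"
      using that sgnUV_insert_self[of i "u - {i}"] by (simp add: insert_absorb)
    then show ?thesis
      using 2 BB assms * I1_not_I0[OF 2] unfolding b d
      by (auto simp: del_I1 osmul_def bas_def pdcoef_def pdmon_def)
  next
    case 3
    then show ?thesis by (simp add: del_outside pdcoef_def osmul_def II_iff)
  qed
qed

text \<open>\<open>pd\<close> reads its argument only at indices in \<open>Bas\<close>. This later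
  makes \<open>dh\<close> and \<open>psi\<close> vanish at indices whose exponents overflow.\<close>

lemma del_bas_notin:
  assumes "b \<notin> BB"
  shows "del i (bas b) = (\<lambda>_. 0 :: 'a::field)"
  using assms I1_not_I0
  by (auto simp: pd_def bas_def fun_eq_iff in_BB_iff)

lemma mul_bas:
  assumes "b \<in> BB" "c \<in> BB"
  shows "mul (bas b) (bas c) d =
    (if d \<in> BB \<and> d = badd b c then moncoef m b c else (0 :: 'a::field))"
proof -
  have "(mul (bas b) (bas c) d :: 'a) =
      (\<Sum>b'\<in>BB. \<Sum>c'\<in>BB. if b' = b \<and> c' = c then multcoef m n p t b c d else 0)"
    unfolding omult_def bas_def by (intro sum.cong refl) auto
  also have "\<dots> = (\<Sum>b'\<in>BB. if b' = b then multcoef m n p t b c d else 0)"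
    using assms(2) by (intro sum.cong refl) (auto simp: sum.delta)
  also have "\<dots> = multcoef m n p t b c d"
    using assms(1) by (simp add: sum.delta)
  finally have "(mul (bas b) (bas c) d :: 'a) = multcoef m n p t b c d" .
  then show ?thesis
    by (cases "snd b \<inter> snd c = {}") (simp_all add: multcoef_def badd_def moncoef_def prod_eq_iff)
qed

lemma mul_add_left: "mul (\<lambda>d. f d + f' d) g d = mul f g d + mul f' g d"
  and mul_add_right: "mul f (\<lambda>d. g d + g' d) d = mul f g d + mul f g' d"
  by (simp_all add: omult_def algebra_simps sum.distrib)

lemma mul_scale_left: "mul (\<lambda>d. s * f d) g d = s * mul f g d"
  and mul_scale_right: "mul f (\<lambda>d. s * g d) d = s * mul f g d"
  by (simp_all add: omult_def sum_distrib_left mult_ac)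

lemma mul_zero [simp]: "mul (\<lambda>_. 0) g = (\<lambda>_. 0)" "mul f (\<lambda>_. 0) = (\<lambda>_. 0)"
  by (simp_all add: omult_def)

lemma del_add: "del i (\<lambda>d. f d + g d) d = del i f d + del i g d"
  by (cases d) (simp add: pd_def algebra_simps)

lemma del_scale: "del i (\<lambda>d. s * f d) d = s * del i f d"
  by (cases d) (simp add: pd_def algebra_simps)

lemma del_zero [simp]: "del i (\<lambda>_. 0) = (\<lambda>_. 0)"
  by (auto simp: pd_def)

lemma del_sum: "finite A \<Longrightarrow> del i (\<lambda>d. \<Sum>x\<in>A. f x d) d = (\<Sum>x\<in>A. del i (f x) d)"
  by (induction A rule: finite_induct) (simp_all add: del_add)

lemma mul_sum_left: "finite A \<Longrightarrow> mul (\<lambda>d. \<Sum>x\<in>A. f x d) g d = (\<Sum>x\<in>A. mul (f x) g d)"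
  by (induction A rule: finite_induct) (simp_all add: mul_add_left)

lemma mul_sum_right: "finite A \<Longrightarrow> mul g (\<lambda>d. \<Sum>x\<in>A. f x d) d = (\<Sum>x\<in>A. mul g (f x) d)"
  by (induction A rule: finite_induct) (simp_all add: mul_add_right)

lemma Oel_expand:
  assumes "\<And>b. f b \<noteq> 0 \<Longrightarrow> b \<in> BB"
  shows "f = (\<lambda>d. \<Sum>b\<in>BB. f b * bas b d)"
proof
  fix d
  show "f d = (\<Sum>b\<in>BB. f b * bas b d)"
    using assms[of d] by (auto simp: bas_def if_distrib sum.delta cong: if_cong)
qed

lemma mul_del_expand:
  assumes f: "\<And>b. f b \<noteq> 0 \<Longrightarrow> b \<in> BB" and g: "\<And>b. g b \<noteq> 0 \<Longrightarrow> b \<in> BB"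
  shows "mul f (del i g) d = (\<Sum>b\<in>BB. \<Sum>c\<in>BB. f b * g c * mul (bas b) (del i (bas c)) d)"
proof -
  have dg: "del i g = (\<lambda>d. \<Sum>c\<in>BB. g c * del i (bas c) d)"
    by (subst Oel_expand[OF g]) (simp_all add: del_sum del_scale fun_eq_iff)
  have "mul f (del i g) d = mul (\<lambda>d. \<Sum>b\<in>BB. f b * bas b d) (\<lambda>d. \<Sum>c\<in>BB. g c * del i (bas c) d) d"
    by (subst Oel_expand[OF f]) (simp_all add: dg)
  also have "\<dots> = (\<Sum>b\<in>BB. \<Sum>c\<in>BB. f b * g c * mul (bas b) (del i (bas c)) d)"
    by (simp add: mul_sum_left mul_sum_right mul_scale_left mul_scale_right sum_distrib_left mult_ac)
  finally show ?thesis .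
qed


lemma mul_osmul_bas:
  assumes "b \<in> BB" "c \<in> BB"
  shows "mul (osmul x (bas b)) (osmul y (bas c)) d =
    (if d \<in> BB \<and> d = badd b c then x * y * moncoef m b c else (0 :: 'a::field))"
  using mul_bas[OF assms, of d, where ?'a = 'a]
  by (auto simp: osmul_def mul_scale_left mul_scale_right)

lemma binomA_swap: "binomA m \<alpha> \<beta> = binomA m \<beta> \<alpha>"
  unfolding binomA_def
  by (intro prod.cong refl) (metis add.commute add_diff_cancel_left' binomial_symmetric le_add1)

lemma badd_swap: "badd b c = badd c b"
  by (simp add: badd_def add.commute Un_commute)

lemma moncoef_swap:
  assumes "b \<in> BB" "c \<in> BB"
  shows "moncoef m b c = ((-1) ^ (card (snd b) * card (snd c)) * moncoef m c b :: 'a::field)"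
  using assms sgnUV_swap[of "snd b" "snd c"]
  by (auto simp: moncoef_def BB_finite_snd binomA_swap[of "fst b"] Int_commute)

lemma binomA_split:
  assumes "i \<in> I0 m"
  shows "binomA m \<alpha> \<beta> = (\<alpha> i + \<beta> i choose \<alpha> i) * (\<Prod>j\<in>I0 m - {i}. \<alpha> j + \<beta> j choose \<alpha> j)"
  unfolding binomA_def using assms by (simp add: prod.remove)

text \<open>In the boundary case \<open>\<alpha> i + \<beta> i = p ^ t i\<close> the product of monomials vanishes although
  its derivative has formally nonzero monomials; their coefficient is \<open>p ^ t i choose \<alpha> i\<close>.\<close>
lemma pascal_mod:
  assumes "CHAR('a::field) = p" "i \<in> I0 m" "a < p ^ t i" "b < p ^ t i" "a + b > 0"
  shows "((if a > 0 then of_nat (a - 1 + b choose (a - 1)) else 0)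
      + (if b > 0 then of_nat (a + (b - 1) choose a) else 0) :: 'a) = of_nat (a + b choose a)"
    and "a + b = p ^ t i \<Longrightarrow> of_nat (a + b choose a) = (0 :: 'a)"
proof -
  show "((if a > 0 then of_nat (a - 1 + b choose (a - 1)) else 0)
      + (if b > 0 then of_nat (a + (b - 1) choose a) else 0) :: 'a) = of_nat (a + b choose a)"
    using assms(5) by (cases a; cases b) (auto simp: add.commute)
  assume *: "a + b = p ^ t i"
  then have "0 < a" using assms(4) by linarith
  then have "p dvd a + b choose a"
    using prime_dvd_choose_prime_power[OF prime_p, of a "t i"] assms(3) * by simp
  then show "of_nat (a + b choose a) = (0 :: 'a)"
    using assms(1) by (simp add: of_nat_eq_0_iff_char_dvd)
qed

text \<open>Pascal's rule in the \<open>i\<close>-th exponent; the remaining binomials and the sign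
  form a common factor \<open>?R\<close>.\<close>

lemma leibniz_even:
  assumes "CHAR('a::field) = p" "i \<in> I0 m" "b \<in> BB" "c \<in> BB"
  shows "del i (mul (bas b) (bas c)) d = mul (del i (bas b)) (bas c) d + (mul (bas b) (del i (bas c)) d :: 'a)"
proof -
  obtain \<alpha> u where b: "b = (\<alpha>, u)" by fastforce
  obtain \<beta> v where c: "c = (\<beta>, v)" by fastforce
  obtain \<gamma> w where d: "d = (\<gamma>, w)" by fastforce
  have lhs: "del i (mul (bas b) (bas c)) d =
     (if d \<in> BB \<and> (\<gamma>(i := \<gamma> i + 1), w) \<in> BB \<and> (\<gamma>(i := \<gamma> i + 1), w) = badd b c
      then moncoef m b c else (0 :: 'a))"
    unfolding d by (auto simp: del_I0 assms mul_bas)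
  have rhs1: "mul (del i (bas b)) (bas c) d =
     (if d \<in> BB \<and> d = badd (pdmon m i b) c then pdcoef m n i b * moncoef m (pdmon m i b) c else (0 :: 'a))"
    unfolding del_bas[OF assms(3)] using mul_osmul_bas[OF pdmon_in_BB[OF assms(3)] assms(4), where y = "1::'a"]
    by (auto simp: osmul_def)
  have rhs2: "mul (bas b) (del i (bas c)) d =
     (if d \<in> BB \<and> d = badd b (pdmon m i c) then pdcoef m n i c * moncoef m b (pdmon m i c) else (0 :: 'a))"
    unfolding del_bas[OF assms(4)] using mul_osmul_bas[OF assms(3) pdmon_in_BB[OF assms(4)], where x = "1::'a"]
    by (auto simp: osmul_def)
  have bounds: "\<alpha> i < p ^ t i" "\<beta> i < p ^ t i"
    using assms b c by (auto simp: in_BB_iff)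
  show ?thesis
  proof (cases "d \<in> BB \<and> (\<gamma>(i := \<gamma> i + 1), w) = badd b c \<and> u \<inter> v = {}")
    case True
    then have \<gamma>: "\<gamma> i + 1 = \<alpha> i + \<beta> i" and w: "w = u \<union> v"
      and \<gamma>': "\<And>j. j \<noteq> i \<Longrightarrow> \<gamma> j = \<alpha> j + \<beta> j"
      unfolding b c badd_def by (auto simp: fun_eq_iff split: if_splits)
    have e1: "d = badd (pdmon m i b) c" if "\<alpha> i > 0"
      using that \<gamma> \<gamma>' w assms(2) by (auto simp: b c d badd_def pdmon_def fun_eq_iff)
    have e2: "d = badd b (pdmon m i c)" if "\<beta> i > 0"
      using that \<gamma> \<gamma>' w assms(2) by (auto simp: b c d badd_def pdmon_def fun_eq_iff)
    let ?R = "of_nat (\<Prod>j\<in>I0 m - {i}. \<alpha> j + \<beta> j choose \<alpha> j) * sgnUV u v :: 'a"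
    have m0: "moncoef m b c = of_nat (\<alpha> i + \<beta> i choose \<alpha> i) * ?R"
      using True by (simp add: moncoef_def b c binomA_split[OF assms(2)])
    have m1: "moncoef m (pdmon m i b) c = of_nat (\<alpha> i - 1 + \<beta> i choose (\<alpha> i - 1)) * ?R"
      using True assms(2) by (simp add: moncoef_def b c pdmon_def binomA_split[OF assms(2)])
    have m2: "moncoef m b (pdmon m i c) = of_nat (\<alpha> i + (\<beta> i - 1) choose (\<alpha> i)) * ?R"
      using True assms(2) by (simp add: moncoef_def b c pdmon_def binomA_split[OF assms(2)])
    have "mul (del i (bas b)) (bas c) d + (mul (bas b) (del i (bas c)) d :: 'a) =
      ((if \<alpha> i > 0 then of_nat (\<alpha> i - 1 + \<beta> i choose (\<alpha> i - 1)) else 0)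
      + (if \<beta> i > 0 then of_nat (\<alpha> i + (\<beta> i - 1) choose \<alpha> i) else 0)) * ?R"
      unfolding rhs1 rhs2 m1 m2 using True e1 e2 assms(2)
      by (auto simp: pdcoef_def b c algebra_simps)
    also have "\<dots> = of_nat (\<alpha> i + \<beta> i choose \<alpha> i) * ?R"
    proof -
      have "\<alpha> i + \<beta> i > 0" using \<gamma> by linarith
      then show ?thesis by (simp only: pascal_mod(1)[OF assms(1,2) bounds])
    qed
    finally have sum: "mul (del i (bas b)) (bas c) d + (mul (bas b) (del i (bas c)) d :: 'a) = \<dots>" .
    show ?thesis
    proof (cases "(\<gamma>(i := \<gamma> i + 1), w) \<in> BB")
      case in_BB: True
      then show ?thesis using True unfolding lhs sum m0 by simp
    next
      case False
      \<comment> \<open>The derivative is in range but the product is not, so the exponent sits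
        exactly on the boundary, where the binomial is 0 in characteristic \<open>p\<close>.\<close>
      have "\<gamma> i + 1 = p ^ t i"
      proof (rule ccontr)
        assume "\<gamma> i + 1 \<noteq> p ^ t i"
        moreover have "\<gamma> i < p ^ t i" using True assms(2) d by (simp add: in_BB_iff)
        ultimately have "\<gamma> i + 1 < p ^ t i" by linarith
        moreover have "(\<gamma>, w) \<in> BB" using True d by simp
        ultimately have "(\<gamma>(i := \<gamma> i + 1), w) \<in> BB"
          using assms(2) by (simp add: in_BB_iff)
        then show False using False by blast
      qed
      then have "of_nat (\<alpha> i + \<beta> i choose \<alpha> i) = (0 :: 'a)"
        using \<gamma> by (intro pascal_mod(2)[OF assms(1,2) bounds]) linarith+
      then show ?thesis using False unfolding lhs sum by simp
    qed
  next
    case False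
    have *: "(\<gamma>(i := \<gamma> i + 1), w) = badd b c"
      if "d = badd (pdmon m i b) c" "\<alpha> i > 0"
      using that assms(2) by (auto simp: b c d badd_def pdmon_def fun_eq_iff split: if_splits)
    have **: "(\<gamma>(i := \<gamma> i + 1), w) = badd b c"
      if "d = badd b (pdmon m i c)" "\<beta> i > 0"
      using that assms(2) by (auto simp: b c d badd_def pdmon_def fun_eq_iff split: if_splits)
    have "mul (del i (bas b)) (bas c) d = (0 :: 'a)"
      unfolding rhs1 using False * assms(2) by (auto simp: pdcoef_def b moncoef_def c pdmon_def)
    moreover have "mul (bas b) (del i (bas c)) d = (0 :: 'a)"
      unfolding rhs2 using False ** assms(2) by (auto simp: pdcoef_def b moncoef_def c pdmon_def)
    moreover have "del i (mul (bas b) (bas c)) d = (0 :: 'a)"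
      unfolding lhs using False by (auto simp: moncoef_def b c)
    ultimately show ?thesis by simp
  qed
qed

text \<open>Signs are multiplicative when \<open>u\<close> or \<open>v\<close> is split at
  \<open>i\<close>; passing \<open>i\<close> through all of \<open>u\<close> costs
  \<open>(-1) ^ card u\<close>.\<close>

lemma sgn_leibniz:
  assumes "finite u" "finite v" "u \<inter> v = {}"
  shows "i \<in> u \<Longrightarrow> sgnUV {i} (u \<union> v) * sgnUV u v = (sgnUV {i} u * sgnUV (u - {i}) v :: 'a::field)"
    and "i \<in> v \<Longrightarrow> sgnUV {i} (u \<union> v) * sgnUV u v = ((-1) ^ card u * (sgnUV {i} v * sgnUV u (v - {i})) :: 'a)"
proof -
  have un: "sgnUV {i} (u \<union> v) = (sgnUV {i} u * sgnUV {i} v :: 'a)"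
    by (rule sgnUV_Un_right) (use assms in auto)
  {
    assume i: "i \<in> u"
    have "sgnUV ({i} \<union> (u - {i})) v = (sgnUV {i} v * sgnUV (u - {i}) v :: 'a)"
      by (rule sgnUV_Un_left) (use assms in auto)
    then have "sgnUV u v = (sgnUV {i} v * sgnUV (u - {i}) v :: 'a)"
      using i by (simp add: insert_absorb)
    then show "sgnUV {i} (u \<union> v) * sgnUV u v = (sgnUV {i} u * sgnUV (u - {i}) v :: 'a)"
      unfolding un by (simp add: mult_ac)
  }
  assume i: "i \<in> v"
  have "sgnUV u ({i} \<union> (v - {i})) = (sgnUV u {i} * sgnUV u (v - {i}) :: 'a)"
    by (rule sgnUV_Un_right) (use assms in auto)
  then have "sgnUV u v = (sgnUV u {i} * sgnUV u (v - {i}) :: 'a)"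
    using i by (simp add: insert_absorb)
  moreover have "sgnUV u {i} = ((-1) ^ card u * sgnUV {i} u :: 'a)"
    using sgnUV_swap[of u "{i}"] assms i by auto
  ultimately show "sgnUV {i} (u \<union> v) * sgnUV u v = ((-1) ^ card u * (sgnUV {i} v * sgnUV u (v - {i})) :: 'a)"
    unfolding un by (simp add: mult_ac)
qed

text \<open>Here \<open>x^u x^v = 0\<close>, yet with \<open>i\<close> as the only common index both
  terms of the Leibniz rule are nonzero; they have to cancel.\<close>

lemma sgn_leibniz_both:
  assumes "finite u" "finite v" "i \<in> u" "i \<in> v" "(u - {i}) \<inter> v = {}"
  shows "sgnUV {i} u * sgnUV (u - {i}) v + (-1) ^ card u * (sgnUV {i} v * sgnUV u (v - {i})) = (0 :: 'a::field)"
proof -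
  define u' v' where "u' = u - {i}" and "v' = v - {i}"
  have u: "u = insert i u'" "i \<notin> u'" "finite u'" and v: "v = insert i v'" "i \<notin> v'" "finite v'"
    using assms by (auto simp: u'_def v'_def)
  have "sgnUV u' ({i} \<union> v') = (sgnUV u' {i} * sgnUV u' v' :: 'a)"
    by (rule sgnUV_Un_right) (use u v in auto)
  moreover have "sgnUV ({i} \<union> u') v' = (sgnUV {i} v' * sgnUV u' v' :: 'a)"
    by (rule sgnUV_Un_left) (use u v in auto)
  moreover have "sgnUV u' {i} = ((-1) ^ card u' * sgnUV {i} u' :: 'a)"
    using sgnUV_swap[of u' "{i}"] u by auto
  ultimately show ?thesis
    unfolding u(1) v(1) using u(2,3) v(2,3)
    by (simp add: sgnUV_insert_self mult_ac)
qed

lemma leibniz_odd: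
  assumes "i \<in> I1 m n" "b \<in> BB" "c \<in> BB"
  shows "del i (mul (bas b) (bas c)) d = mul (del i (bas b)) (bas c) d
    + (-1) ^ card (snd b) * (mul (bas b) (del i (bas c)) d :: 'a::field)"
proof -
  obtain \<alpha> u where b: "b = (\<alpha>, u)" by fastforce
  obtain \<beta> v where c: "c = (\<beta>, v)" by fastforce
  obtain \<gamma> w where d: "d = (\<gamma>, w)" by fastforce
  note i0 = I1_not_I0[OF assms(1)]
  have fin: "finite u" "finite v" using assms b c by (auto dest: BB_finite_snd)
  have lhs: "del i (mul (bas b) (bas c)) d =
     (if d \<in> BB \<and> i \<notin> w \<and> (\<gamma>, insert i w) = badd b c
      then sgnUV {i} w * moncoef m b c else (0 :: 'a))"
  proof -
    have "(\<gamma>, insert i w) \<in> BB" if "(\<gamma>, w) \<in> BB" using that assms(1) by (simp add: in_BB_iff)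
    then show ?thesis unfolding d by (auto simp: del_I1 assms mul_bas)
  qed
  have rhs1: "mul (del i (bas b)) (bas c) d =
     (if d \<in> BB \<and> d = badd (pdmon m i b) c then pdcoef m n i b * moncoef m (pdmon m i b) c else (0 :: 'a))"
    unfolding del_bas[OF assms(2)]
    using mul_osmul_bas[OF pdmon_in_BB[OF assms(2)] assms(3), where y = "1::'a"]
    by (auto simp: osmul_def)
  have rhs2: "mul (bas b) (del i (bas c)) d =
     (if d \<in> BB \<and> d = badd b (pdmon m i c) then pdcoef m n i c * moncoef m b (pdmon m i c) else (0 :: 'a))"
    unfolding del_bas[OF assms(3)]
    using mul_osmul_bas[OF assms(2) pdmon_in_BB[OF assms(3)], where x = "1::'a"]
    by (auto simp: osmul_def)
  show ?thesis
  proof (cases "u \<inter> v = {}")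
    case disj: True
    note sg = sgn_leibniz[OF fin disj, of i, where ?'a = 'a]
    consider "i \<in> u" | "i \<in> v" | "i \<notin> u" "i \<notin> v" by blast
    then show ?thesis
    proof cases
      case 1
      then have "i \<notin> v" "(u - {i}) \<inter> v = {}" using disj by auto
      moreover have "i \<notin> w \<and> (\<gamma>, insert i w) = badd b c \<longleftrightarrow> d = badd (pdmon m i b) c"
        using 1 \<open>i \<notin> v\<close> i0 by (auto simp: badd_def b c d pdmon_def)
      moreover have "insert i (u - {i} \<union> v) = u \<union> v" using 1 by auto
      then have "sgnUV {i} (u - {i} \<union> v) = (sgnUV {i} (u \<union> v) :: 'a)"
        by (metis sgnUV_insert_self)
      then have "d = badd (pdmon m i b) c \<Longrightarrow> sgnUV {i} w = (sgnUV {i} (u \<union> v) :: 'a)"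
        using i0 by (auto simp: badd_def b c d pdmon_def)
      ultimately show ?thesis
        unfolding lhs rhs1 rhs2 using 1 i0 disj assms(1) sg(1)
        by (auto simp: moncoef_def b c pdcoef_def pdmon_def mult_ac)
    next
      case 2
      then have "i \<notin> u" "u \<inter> (v - {i}) = {}" using disj by auto
      moreover have "i \<notin> w \<and> (\<gamma>, insert i w) = badd b c \<longleftrightarrow> d = badd b (pdmon m i c)"
        using 2 \<open>i \<notin> u\<close> i0 by (auto simp: badd_def b c d pdmon_def)
      moreover have "insert i (u \<union> (v - {i})) = u \<union> v" using 2 by auto
      then have "sgnUV {i} (u \<union> (v - {i})) = (sgnUV {i} (u \<union> v) :: 'a)"
        by (metis sgnUV_insert_self)
      then have "d = badd b (pdmon m i c) \<Longrightarrow> sgnUV {i} w = (sgnUV {i} (u \<union> v) :: 'a)"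
        using i0 by (auto simp: badd_def b c d pdmon_def)
      ultimately show ?thesis
        unfolding lhs rhs1 rhs2 using 2 i0 disj assms(1) sg(2)
        by (auto simp: moncoef_def b c pdcoef_def pdmon_def mult_ac)
    next
      case 3
      then show ?thesis
        unfolding lhs rhs1 rhs2 using i0 by (auto simp: moncoef_def b c pdcoef_def badd_def)
    qed
  next
    case False
    show ?thesis
    proof (cases "i \<in> u \<and> i \<in> v \<and> (u - {i}) \<inter> v = {}")
      case True
      have "u \<inter> (v - {i}) = {}" "(u - {i}) \<union> v = u \<union> (v - {i})" using True by auto
      then have E: "badd (pdmon m i b) c = badd b (pdmon m i c)"
        using i0 by (simp add: badd_def pdmon_def b c)
      have m1: "pdcoef m n i b * moncoef m (pdmon m i b) c
          = of_nat (binomA m \<alpha> \<beta>) * (sgnUV {i} u * sgnUV (u - {i}) v :: 'a)"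
        using True i0 assms(1) by (simp add: pdcoef_def moncoef_def pdmon_def b c)
      have m2: "pdcoef m n i c * moncoef m b (pdmon m i c)
          = of_nat (binomA m \<alpha> \<beta>) * (sgnUV {i} v * sgnUV u (v - {i}) :: 'a)"
        using True i0 assms(1) \<open>u \<inter> (v - {i}) = {}\<close> by (simp add: pdcoef_def moncoef_def pdmon_def b c)
      have "of_nat (binomA m \<alpha> \<beta>) * (sgnUV {i} u * sgnUV (u - {i}) v)
          + (-1) ^ card u * (of_nat (binomA m \<alpha> \<beta>) * (sgnUV {i} v * sgnUV u (v - {i})))
          = of_nat (binomA m \<alpha> \<beta>) * (sgnUV {i} u * sgnUV (u - {i}) v
            + (-1) ^ card u * (sgnUV {i} v * sgnUV u (v - {i})) :: 'a)"
        by (simp only: distrib_left mult.left_commute)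
      also have "\<dots> = 0"
        using True by (simp only: sgn_leibniz_both[OF fin] mult_zero_right)
      finally have "of_nat (binomA m \<alpha> \<beta>) * (sgnUV {i} u * sgnUV (u - {i}) v)
          + (-1) ^ card u * (of_nat (binomA m \<alpha> \<beta>) * (sgnUV {i} v * sgnUV u (v - {i}))) = (0 :: 'a)" .
      then have "mul (del i (bas b)) (bas c) d + (-1) ^ card u * (mul (bas b) (del i (bas c)) d :: 'a) = 0"
      proof -
        assume S: "of_nat (binomA m \<alpha> \<beta>) * (sgnUV {i} u * sgnUV (u - {i}) v)
          + (-1) ^ card u * (of_nat (binomA m \<alpha> \<beta>) * (sgnUV {i} v * sgnUV u (v - {i}))) = (0 :: 'a)"
        have gen: "(if P then x else 0) + z * (if P then y else 0) = (if P then x + z * y else 0)"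
          for P and x y z :: 'a by simp
        show ?thesis unfolding rhs1 rhs2 E m1 m2 gen S by (rule if_cancel)
      qed
      moreover have "moncoef m b c = (0 :: 'a)" using False by (simp add: moncoef_def b c)
      ultimately show ?thesis unfolding lhs by (simp add: b)
    next
      case no: False
      then have ne: "i \<in> u \<Longrightarrow> (u - {i}) \<inter> v \<noteq> {}" "i \<in> v \<Longrightarrow> u \<inter> (v - {i}) \<noteq> {}"
        using False by auto
      have z0: "moncoef m b c = (0 :: 'a)"
        using False by (simp add: moncoef_def b c)
      have z1: "pdcoef m n i b * moncoef m (pdmon m i b) c = (0 :: 'a)"
        using ne(1) i0 by (cases "i \<in> u") (simp_all add: pdcoef_def moncoef_def pdmon_def b c)
      have z2: "pdcoef m n i c * moncoef m b (pdmon m i c) = (0 :: 'a)"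
        using ne(2) i0 by (cases "i \<in> v") (simp_all add: pdcoef_def moncoef_def pdmon_def b c)
      show ?thesis unfolding lhs rhs1 rhs2 z0 z1 z2 by simp
    qed
  qed
qed

text \<open>Scalar multiples of a single monomial, of parity \<open>q\<close>. Zero is given every
  parity, so that derivatives stay in the class without a case distinction.\<close>

definition smon :: "nat \<Rightarrow> 'a::field Oel \<Rightarrow> bool" where
  "smon q f \<longleftrightarrow> (\<exists>s b. f = osmul s (bas b) \<and> b \<in> BB \<and> (s \<noteq> 0 \<longrightarrow> (even (card (snd b)) \<longleftrightarrow> even q)))"

lemma neg_one_power_cong:
  "(even a \<longleftrightarrow> even b) \<Longrightarrow> (-1) ^ a = ((-1) ^ b :: 'a::ring_1)"
  by (cases "even a") auto

lemma smon_bas: "b \<in> BB \<Longrightarrow> even (card (snd b)) \<longleftrightarrow> even q \<Longrightarrow> smon q (bas b)"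
  unfolding smon_def by (intro exI[of _ 1] exI[of _ b]) (simp add: osmul_def)

lemma smon_del: "smon q f \<Longrightarrow> smon (q + mu i) (del i f)"
proof -
  assume "smon q f"
  then obtain s b where f: "f = osmul s (bas b)" and b: "b \<in> BB"
    and q: "s \<noteq> 0 \<Longrightarrow> (even (card (snd b)) \<longleftrightarrow> even q)"
    unfolding smon_def by blast
  have "del i f = osmul s (del i (bas b))" unfolding f osmul_def by (simp add: del_scale fun_eq_iff)
  also have "\<dots> = osmul (s * pdcoef m n i b) (bas (pdmon m i b))"
    by (simp add: del_bas[OF b]) (simp add: osmul_def mult.assoc)
  finally have *: "del i f = \<dots>" .
  have "card (snd b) = Suc (card (snd b - {i}))" if "i \<in> snd b"
    using that BB_finite_snd[OF b] by (metis card.remove)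
  then have "even (card (snd (pdmon m i b))) \<longleftrightarrow> even (q + mu i)" if "s * pdcoef m n i b \<noteq> 0"
    using that q by (auto simp: pdcoef_def pdmon_def muI_def split: if_splits)
  with * pdmon_in_BB[OF b] show ?thesis unfolding smon_def by blast
qed

lemma leibniz:
  assumes "CHAR('a::field) = p" "smon q f" "smon r g"
  shows "del i (mul f g) d = mul (del i f) g d + (-1) ^ (mu i * q) * (mul f (del i g) d :: 'a)"
proof -
  from assms(2,3) obtain s b s' c where f: "f = osmul s (bas b)" and b: "b \<in> BB"
    and q: "s \<noteq> 0 \<Longrightarrow> (even (card (snd b)) \<longleftrightarrow> even q)"
    and g: "g = osmul s' (bas c)" and c: "c \<in> BB"
    unfolding smon_def by metis
  have *: "del i (mul (bas b) (bas c)) d = mul (del i (bas b)) (bas c) d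
    + (-1) ^ (mu i * card (snd b)) * (mul (bas b) (del i (bas c)) d :: 'a)"
    using leibniz_even[OF assms(1) _ b c, of i d] leibniz_odd[OF _ b c, of i d, where ?'a = 'a]
    by (cases "i \<in> II") (auto simp: II_iff muI_def I1_not_I0 del_outside)
  have sc: "mul (osmul s x) (osmul s' y) = osmul (s * s') (mul x y)" for x y :: "'a Oel"
    by (simp add: osmul_def mul_scale_left mul_scale_right fun_eq_iff mult_ac)
  have dsc: "del i (osmul z x) = osmul z (del i x)" for z and x :: "'a Oel"
    by (simp add: osmul_def del_scale fun_eq_iff)
  have "s * ((-1) ^ (mu i * card (snd b))) = s * (-1) ^ (mu i * q)"
    using q by (cases "s = 0") (auto intro!: neg_one_power_cong)
  note E = this
  have **: "s * s' * ((-1) ^ (mu i * card (snd b)) * x) = (-1) ^ (mu i * q) * (s * s' * x)" for x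
  proof -
    have "s * s' * ((-1) ^ (mu i * card (snd b)) * x) = s * ((-1) ^ (mu i * card (snd b))) * (s' * x)"
      by (simp only: mult_ac)
    then show ?thesis unfolding E by (simp only: mult_ac)
  qed
  show ?thesis
    unfolding f g sc dsc by (simp only: osmul_def * distrib_left **)
qed

lemma mul_swap:
  assumes "smon q f" "smon r g"
  shows "mul f g d = (-1) ^ (q * r) * (mul g f d :: 'a::field)"
proof -
  from assms obtain s b s' c where f: "f = osmul s (bas b)" and b: "b \<in> BB"
    and q: "s \<noteq> 0 \<Longrightarrow> (even (card (snd b)) \<longleftrightarrow> even q)"
    and g: "g = osmul s' (bas c)" and c: "c \<in> BB"
    and r: "s' \<noteq> 0 \<Longrightarrow> (even (card (snd c)) \<longleftrightarrow> even r)"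
    unfolding smon_def by metis
  have "s * s' * (-1) ^ (card (snd b) * card (snd c)) = s * s' * (-1) ^ (q * r)"
    using q r by (cases "s * s' = 0") (auto intro!: neg_one_power_cong)
  then show ?thesis
    unfolding f g mul_osmul_bas[OF b c] mul_osmul_bas[OF c b] badd_swap[of c b]
    using moncoef_swap[OF b c, where ?'a = 'a]
    by (auto simp: mult_ac)
qed

text \<open>Both orders read \<open>f\<close> at the same shifted index. Only two odd derivatives
  differ in sign, through the transposition of \<open>i\<close> and \<open>j\<close>; for equal odd
  indices both sides vanish.\<close>

lemma del_swap: "del i (del j f) d = (-1) ^ (mu i * mu j) * (del j (del i f) d :: 'a::field)"
proof -
  obtain \<gamma> w where d: "d = (\<gamma>, w)" by fastforce
  consider "i \<notin> II \<or> j \<notin> II" | "i \<in> I0 m" "j \<in> I0 m" | "i \<in> I0 m" "j \<in> I1 m n"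
    | "i \<in> I1 m n" "j \<in> I0 m" | "i \<in> I1 m n" "j \<in> I1 m n"
    by (auto simp: II_iff)
  then show ?thesis
  proof cases
    case 1
    then show ?thesis by (auto simp: del_outside)
  next
    case 2
    then have "mu i = 0" by (simp add: muI_def)
    show ?thesis
    proof (cases "i = j")
      case False
      define \<gamma>i \<gamma>j \<delta> where "\<gamma>i = \<gamma>(i := \<gamma> i + 1)" and "\<gamma>j = \<gamma>(j := \<gamma> j + 1)"
        and "\<delta> = \<gamma>(i := \<gamma> i + 1, j := \<gamma> j + 1)"
      note defs = this
      have up: "\<gamma>i(j := \<gamma>i j + 1) = \<delta>" "\<gamma>j(i := \<gamma>j i + 1) = \<delta>"
        using False by (auto simp: defs fun_eq_iff)
      have "(\<alpha>, w) \<in> BB" if "(\<delta>, w) \<in> BB" "\<And>k. \<alpha> k \<le> \<delta> k" for \<alpha>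
        using that unfolding in_BB_iff by (metis le_zero_eq order_le_less_trans)
      then have sub: "(\<delta>, w) \<in> BB \<Longrightarrow> (\<gamma>i, w) \<in> BB \<and> (\<gamma>j, w) \<in> BB \<and> (\<gamma>, w) \<in> BB"
        by (simp add: defs)
      have "del i (del j f) d = (if (\<delta>, w) \<in> BB then f (\<delta>, w) else 0)"
        unfolding d del_I0[OF 2(1)] \<gamma>i_def[symmetric] del_I0[OF 2(2)] up using sub by auto
      moreover have "del j (del i f) d = (if (\<delta>, w) \<in> BB then f (\<delta>, w) else 0)"
        unfolding d del_I0[OF 2(2)] \<gamma>j_def[symmetric] del_I0[OF 2(1)] up using sub by auto
      ultimately show ?thesis using \<open>mu i = 0\<close> by simp
    qed (use \<open>mu i = 0\<close> in simp)
  next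
    case 3
    then have "mu i = 0" by (simp add: muI_def)
    with 3 show ?thesis
      unfolding d by (auto simp: del_I0 del_I1 in_BB_iff)
  next
    case 4
    then have "mu j = 0" by (simp add: muI_def)
    with 4 show ?thesis
      unfolding d by (auto simp: del_I0 del_I1 in_BB_iff)
  next
    case 5
    have fw: "finite w" if "w \<subseteq> I1 m n" using that finite_sub_I1 by blast
    have sg: "sgnUV {a} (insert b w) = (sgnUV {a} {b} * sgnUV {a} w :: 'a)" if "w \<subseteq> I1 m n" "b \<notin> w" for a b
      using sgnUV_Un_right[of "{a}" "{b}" w, where ?'a = 'a] that fw by simp
    have "sgnUV {i} {j} = (- sgnUV {j} {i} :: 'a)" if "i \<noteq> j"
      using sgnUV_swap[of "{i}" "{j}", where ?'a = 'a] that by simp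
    moreover have "mu i = 1" "mu j = 1" using 5 I1_not_I0 by (auto simp: muI_def)
    moreover have ins: "(\<gamma>, insert k w) \<in> BB \<longleftrightarrow> (\<gamma>, w) \<in> BB" if "k \<in> I1 m n" for k
      using that by (simp add: in_BB_iff)
    moreover have "w \<subseteq> I1 m n" if "(\<gamma>, w) \<in> BB" using that by (simp add: in_BB_iff)
    ultimately show ?thesis
      using 5 unfolding d
      by (cases "i = j"; cases "i \<in> w"; cases "j \<in> w"; cases "(\<gamma>, w) \<in> BB")
        (simp_all add: del_I1 sg insert_commute[of j i])
  qed
qed

section \<open>The brackets of vector fields and of Hamiltonians\<close>

lemma Wset_D: "E \<in> Wset m n p t \<Longrightarrow> E i b \<noteq> 0 \<Longrightarrow> b \<in> BB \<and> i \<in> II"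
  unfolding Wset_def by blast

abbreviation "wb \<equiv> wbr m n p t"

text \<open>The sign in \<open>brbas\<close> depends on the basis elements. If one argument is an
  even vector field, the exponent of -1 is always even and the coordinate formula of ordinary vector
  fields remains.\<close>

lemma wb_expand:
  fixes E F :: "'a::field Wel"
  assumes E: "E \<in> Wset m n p t" and F: "F \<in> Wset m n p t"
    and ev: "(\<forall>i b. E i b \<noteq> 0 \<longrightarrow> even (parO b + mu i)) \<or> (\<forall>i b. F i b \<noteq> 0 \<longrightarrow> even (parO b + mu i))"
  shows "wb E F k d = (\<Sum>i\<in>II. mul (E i) (del i (F k)) d) - (\<Sum>i\<in>II. mul (F i) (del i (E k)) d)"
proof -
  let ?X = "\<lambda>b i c. mul (bas b) (del i (bas c)) d :: 'a"
  have summand: "E i b * F j c * brbas m n p t b i c j k d =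
      (if k = j then E i b * F j c * ?X b i c else 0) - (if k = i then F j c * E i b * ?X c j b else 0)"
    for b i c j
  proof (cases "E i b * F j c = 0")
    case False
    then have "E i b \<noteq> 0" "F j c \<noteq> 0" by simp_all
    then have "even (parO b + mu i) \<or> even (parO c + mu j)" using ev by blast
    then have "(-1) ^ ((parO b + mu i) mod 2 * ((parO c + mu j) mod 2)) = (1 :: 'a)" by (elim disjE) auto
    then show ?thesis
      by (simp add: brbas_def wadd_def wsmul_def wsingle_def algebra_simps)
  qed auto
  have "wb E F k d = (\<Sum>b\<in>BB. \<Sum>i\<in>II. \<Sum>c\<in>BB. \<Sum>j\<in>II. E i b * F j c * brbas m n p t b i c j k d)"
  proof -
    let ?G = "\<lambda>b i c j. E i b * F j c * brbas m n p t b i c j k d"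
    have "wb E F k d = (\<Sum>(x, y)\<in>(BB \<times> II) \<times> (BB \<times> II). ?G (fst x) (snd x) (fst y) (snd y))"
      by (simp add: wbr_def wsum_def wsmul_def case_prod_unfold)
    also have "\<dots> = (\<Sum>x\<in>BB \<times> II. \<Sum>y\<in>BB \<times> II. ?G (fst x) (snd x) (fst y) (snd y))"
      by (rule sum.cartesian_product[symmetric])
    also have "\<dots> = (\<Sum>(b, i)\<in>BB \<times> II. \<Sum>(c, j)\<in>BB \<times> II. ?G b i c j)"
      by (simp add: case_prod_unfold)
    finally show ?thesis by (simp only: sum.cartesian_product[symmetric])
  qed
  also have "\<dots> = (\<Sum>b\<in>BB. \<Sum>i\<in>II. \<Sum>c\<in>BB. \<Sum>j\<in>II. if k = j then E i b * F j c * ?X b i c else 0)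
      - (\<Sum>b\<in>BB. \<Sum>i\<in>II. \<Sum>c\<in>BB. \<Sum>j\<in>II. if k = i then F j c * E i b * ?X c j b else 0)"
    by (simp only: summand sum_subtractf)
  also have "(\<Sum>b\<in>BB. \<Sum>i\<in>II. \<Sum>c\<in>BB. \<Sum>j\<in>II. if k = j then E i b * F j c * ?X b i c else 0)
      = (\<Sum>b\<in>BB. \<Sum>i\<in>II. \<Sum>c\<in>BB. E i b * F k c * ?X b i c)"
    using Wset_D[OF F] by (intro sum.cong refl) (auto simp: sum.delta)
  also have "\<dots> = (\<Sum>i\<in>II. \<Sum>b\<in>BB. \<Sum>c\<in>BB. E i b * F k c * ?X b i c)"
    by (rule sum.swap)
  also have "\<dots> = (\<Sum>i\<in>II. mul (E i) (del i (F k)) d)"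
    using Wset_D[OF E] Wset_D[OF F] by (intro sum.cong refl mul_del_expand[symmetric]) blast+
  also have "(\<Sum>b\<in>BB. \<Sum>i\<in>II. \<Sum>c\<in>BB. \<Sum>j\<in>II. if k = i then F j c * E i b * ?X c j b else 0)
      = (\<Sum>b\<in>BB. \<Sum>c\<in>BB. \<Sum>j\<in>II. F j c * E k b * ?X c j b)"
  proof (intro sum.cong refl)
    fix b
    have "(\<Sum>i\<in>II. \<Sum>c\<in>BB. \<Sum>j\<in>II. if k = i then F j c * E i b * ?X c j b else 0)
       = (\<Sum>i\<in>II. if k = i then (\<Sum>c\<in>BB. \<Sum>j\<in>II. F j c * E k b * ?X c j b) else 0)"
      by (intro sum.cong refl) auto
    also have "\<dots> = (\<Sum>c\<in>BB. \<Sum>j\<in>II. F j c * E k b * ?X c j b)"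
      using Wset_D[OF E, of k b] by (cases "E k b = 0") simp_all
    finally show "(\<Sum>i\<in>II. \<Sum>c\<in>BB. \<Sum>j\<in>II. if k = i then F j c * E i b * ?X c j b else 0) = \<dots>" .
  qed
  also have "\<dots> = (\<Sum>b\<in>BB. \<Sum>j\<in>II. \<Sum>c\<in>BB. F j c * E k b * ?X c j b)"
    by (intro sum.cong refl sum.swap)
  also have "\<dots> = (\<Sum>j\<in>II. \<Sum>b\<in>BB. \<Sum>c\<in>BB. F j c * E k b * ?X c j b)"
    by (rule sum.swap)
  also have "\<dots> = (\<Sum>j\<in>II. \<Sum>c\<in>BB. \<Sum>b\<in>BB. F j c * E k b * ?X c j b)"
    by (intro sum.cong refl sum.swap)
  also have "\<dots> = (\<Sum>i\<in>II. mul (F i) (del i (E k)) d)"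
    using Wset_D[OF E] Wset_D[OF F] by (intro sum.cong refl mul_del_expand[symmetric]) blast+
  finally show ?thesis .
qed

section \<open>The involution \<open>pr\<close> on the indices and the signs
  \<open>tau\<close>\<close>

lemma half_m: "2 * (m div 2) = m" and half_n: "2 * (n div 2) + 1 = n"
  using m_even n_odd by auto

lemma pr_cases [consumes 1]:
  assumes "i \<in> II"
  obtains "1 \<le> i" "i \<le> m div 2" "pr i = i + m div 2"
  | "m div 2 < i" "i \<le> m" "pr i = i - m div 2"
  | "m < i" "i \<le> m + n div 2" "pr i = i + n div 2"
  | "m + n div 2 < i" "i < m + n" "pr i = i - n div 2"
  | "i = m + n" "pr i = i"
proof -
  have "1 \<le> i" "i \<le> m + n" using assms by (auto simp: Iall_def I0_def I1_def)
  then consider "1 \<le> i \<and> i \<le> m div 2" | "m div 2 < i \<and> i \<le> m" | "m < i \<and> i \<le> m + n div 2"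
    | "m + n div 2 < i \<and> i < m + n" | "i = m + n"
    by linarith
  then show thesis
  proof cases
    case 1
    then show ?thesis using that(1) by (simp add: primeI_def)
  next
    case 2
    then show ?thesis using that(2) by (simp add: primeI_def)
  next
    case 3
    moreover from this have "m div 2 < i" by linarith
    ultimately show ?thesis using that(3) by (simp add: primeI_def)
  next
    case 4
    moreover from this have "m div 2 < i" "i \<le> m + 2 * (n div 2)" "\<not> i \<le> m" "\<not> i \<le> m + n div 2"
      using half_n by linarith+
    ultimately show ?thesis using that(4) by (simp add: primeI_def)
  next
    case 5
    have "n > 0" using n_odd by (cases n) auto
    then have "m div 2 < m + n" "\<not> m + n \<le> m + 2 * (n div 2)" "\<not> m + n \<le> m" "\<not> m + n \<le> m + n div 2"
      using half_n by linarith+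
    then have "pr i = i" by (simp add: primeI_def 5)
    then show ?thesis using that(5) 5 by blast
  qed
qed

lemma pr_II [simp]: "i \<in> II \<Longrightarrow> pr i \<in> II"
  and pr_involution [simp]: "i \<in> II \<Longrightarrow> pr (pr i) = i"
  and pr_I0 [simp]: "i \<in> II \<Longrightarrow> pr i \<in> I0 m \<longleftrightarrow> i \<in> I0 m"
  and tau_pr_int: "i \<in> II \<Longrightarrow> tauI m (pr i) = (if i \<in> I0 m then - tauI m i else tauI m i)"
proof -
  have II: "x \<in> II \<longleftrightarrow> 1 \<le> x \<and> x \<le> m + n" and I0: "x \<in> I0 m \<longleftrightarrow> 1 \<le> x \<and> x \<le> m" for x
    by (auto simp: Iall_def I0_def I1_def)
  assume i: "i \<in> II"
  then have "pr i \<in> II \<and> pr (pr i) = i \<and> (pr i \<in> I0 m \<longleftrightarrow> i \<in> I0 m) \<and>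
    tauI m (pr i) = (if i \<in> I0 m then - tauI m i else tauI m i)"
  proof (cases rule: pr_cases)
    case 1
    then have "m div 2 < pr i" "pr i \<le> m" using half_m by linarith+
    moreover from this have "pr (pr i) = pr i - m div 2" by (simp add: primeI_def[of m n "pr i"])
    ultimately show ?thesis using 1 half_m by (simp add: II I0 tauI_def)
  next
    case 2
    then have "1 \<le> pr i" "pr i \<le> m div 2" using half_m by linarith+
    moreover from this have "pr (pr i) = pr i + m div 2" by (simp add: primeI_def[of m n "pr i"])
    ultimately show ?thesis using 2 half_m by (simp add: II I0 tauI_def)
  next
    case 3
    then have "m < pr i" "m + n div 2 < pr i" "m div 2 < pr i" "pr i \<le> m + 2 * (n div 2)" "pr i \<le> m + n"
      using half_n by linarith+
    moreover from this have "pr (pr i) = pr i - n div 2" by (simp add: primeI_def[of m n "pr i"])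
    ultimately show ?thesis using 3 by (simp add: II I0 tauI_def)
  next
    case 4
    then have "m < pr i" "m div 2 < pr i" "pr i \<le> m + n div 2" "pr i \<le> m + n"
      using half_n by linarith+
    moreover from this have "pr (pr i) = pr i + n div 2" by (simp add: primeI_def[of m n "pr i"])
    ultimately show ?thesis using 4 by (simp add: II I0 tauI_def)
  next
    case 5
    have "m < i" using 5 n_odd by (cases n) auto
    then show ?thesis using 5 i by (simp add: II I0 tauI_def)
  qed
  then show "pr i \<in> II" "pr (pr i) = i" "pr i \<in> I0 m \<longleftrightarrow> i \<in> I0 m"
    "tauI m (pr i) = (if i \<in> I0 m then - tauI m i else tauI m i)"
    by blast+
qed

lemma pr_I1 [simp]: "i \<in> II \<Longrightarrow> pr i \<in> I1 m n \<longleftrightarrow> i \<in> I1 m n"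
  using pr_I0 pr_II I0_I1_disjoint by (metis II_iff)

lemma mu_pr [simp]: "i \<in> II \<Longrightarrow> mu (pr i) = mu i"
  by (simp add: muI_def)

lemma tau_pr: "i \<in> II \<Longrightarrow> tauI m (pr i) = (-1) ^ (mu i + 1) * tauI m i"
  by (simp add: tau_pr_int muI_def)

lemma tau_square [simp]: "tauI m i * tauI m i = 1"
  by (auto simp: tauI_def)

lemma bij_pr: "bij_betw pr II II"
  by (rule bij_betw_byWitness[of _ pr]) auto

lemma sum_pr: "(\<Sum>i\<in>II. f (pr i)) = (\<Sum>i\<in>II. f i)"
  by (rule sum.reindex_bij_betw[OF bij_pr])

text \<open>The sum in \<open>DH\<close>, reindexed by the target: component \<open>k\<close>
  receives the derivative along \<open>pr k\<close>. The parity sign may use \<open>mu k\<close>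
  because \<open>pr\<close> preserves parity.\<close>

definition gradcoef :: "nat \<Rightarrow> nat \<Rightarrow> 'a::field" where
  "gradcoef q k = tau (pr k) * (-1) ^ (mu k * q)"

lemma DH_apply:
  assumes "k \<in> II"
  shows "DH m n p t q f k = osmul (gradcoef q k) (del (pr k) f)"
proof
  fix d
  have "DH m n p t q f k d = (\<Sum>i\<in>II. if k = pr i then osmul (tau i * (-1) ^ (mu i * q)) (del i f) d else 0)"
    by (simp add: DH_def wsum_def wsingle_def if_distribR)
  also have "\<dots> = (\<Sum>i\<in>II. if i = pr k then osmul (tau i * (-1) ^ (mu i * q)) (del i f) d else 0)"
    using assms by (intro sum.cong refl) auto
  also have "\<dots> = osmul (gradcoef q k) (del (pr k) f) d"
    using assms by (simp add: sum.delta gradcoef_def)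
  finally show "DH m n p t q f k d = \<dots>" .
qed

lemma DH_outside: "k \<notin> II \<Longrightarrow> DH m n p t q f k = (\<lambda>_. 0)"
  by (auto simp: DH_def wsum_def wsingle_def fun_eq_iff intro!: sum.neutral)

section \<open>Hamiltonian vector fields and the Poisson bracket\<close>

abbreviation "dh \<equiv> DHb m n p t"

lemma dh_apply: "k \<in> II \<Longrightarrow> dh b k = osmul (gradcoef (parO b) k) (del (pr k) (bas b))"
  by (simp add: DHb_def DH_apply)

lemma dh_outside: "k \<notin> II \<Longrightarrow> dh b k = (\<lambda>_. 0)"
  by (simp add: DHb_def DH_outside)

lemma gradcoef_even [simp]: "gradcoef 0 k = tau (pr k)"
  by (simp add: gradcoef_def)

lemma parO_even: "even (card (snd b)) \<Longrightarrow> parO b = 0"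
  by (simp add: parO_def)

lemma del_osmul: "del i (osmul s f) = osmul s (del i f)"
  by (simp add: osmul_def del_scale fun_eq_iff)

lemma mul_osmul_left: "mul (osmul s f) g = osmul s (mul f g)"
  and mul_osmul_right: "mul f (osmul s g) = osmul s (mul f g)"
  by (simp_all add: osmul_def mul_scale_left mul_scale_right fun_eq_iff)

lemma osmul_apply: "osmul s f d = s * f d"
  by (simp add: osmul_def)

text \<open>The Poisson bracket, applied to even monomials only, hence the absence of a parity
  sign.\<close>

definition poi :: "idx \<Rightarrow> idx \<Rightarrow> 'a::field Oel" where
  "poi b c = (\<lambda>d. \<Sum>i\<in>II. tau i * mul (del i (bas b)) (del (pr i) (bas c)) d)"

lemma del_nonzero_BB: "del i f d \<noteq> 0 \<Longrightarrow> d \<in> BB"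
  by (cases d) (auto simp: pd_def split: if_splits)

lemma dh_Wset: "dh b \<in> Wset m n p t"
proof -
  have "i \<in> II \<and> c \<in> BB" if "dh b i c \<noteq> 0" for i c
  proof -
    have "i \<in> II" using that dh_outside by metis
    moreover from this have "c \<in> BB" using that by (auto simp: dh_apply osmul_def dest: del_nonzero_BB)
    ultimately show ?thesis by blast
  qed
  then show ?thesis by (auto simp: Wset_def)
qed

lemma dh_even:
  assumes "b \<in> BB" "even (card (snd b))" "dh b i d \<noteq> (0 :: 'a::field)"
  shows "even (parO d + mu i)"
proof -
  have i: "i \<in> II" using assms(3) dh_outside by metis
  then have nz: "del (pr i) (bas b) d \<noteq> (0 :: 'a)"
    using assms(3) by (auto simp: dh_apply osmul_def)
  have "smon (0 + mu (pr i)) (del (pr i) (bas b :: 'a Oel))"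
    by (intro smon_del smon_bas) (use assms in auto)
  then obtain s c where *: "del (pr i) (bas b) = osmul s (bas c :: 'a Oel)"
    and "s \<noteq> 0 \<longrightarrow> even (card (snd c)) = even (mu i)"
    unfolding smon_def using i by auto
  moreover have "s \<noteq> 0" "d = c" using nz unfolding * by (auto simp: osmul_def bas_def split: if_splits)
  ultimately show ?thesis by (auto simp: parO_def)
qed

text \<open>Differentiate the Poisson bracket along \<open>l = pr k\<close> by the Leibniz rule. The
  terms that differentiate the second factor give \<open>dh b\<close> applied to component
  \<open>k\<close> of \<open>dh c\<close>; the others, after exchanging the factors and reindexing
  by \<open>pr\<close>, give the opposite term of the commutator.\<close>

lemma bracket_dh:
  assumes ch: "CHAR('a::field) = p"
    and b: "b \<in> BB" "even (card (snd b))" and c: "c \<in> BB" "even (card (snd c))"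
  shows "wb (dh b) (dh c) = DH m n p t 0 (poi b c :: 'a Oel)"
proof (intro ext)
  fix k d
  have W: "dh b \<in> Wset m n p t" "dh c \<in> Wset m n p t" by (rule dh_Wset)+
  note eq = wb_expand[OF W disjI1, of k d, where ?'a = 'a]
  have sb: "smon 0 (bas b :: 'a Oel)" and sc: "smon 0 (bas c :: 'a Oel)"
    using b c by (auto intro: smon_bas)
  show "wb (dh b) (dh c) k d = DH m n p t 0 (poi b c :: 'a Oel) k d"
  proof (cases "k \<in> II")
    case False
    have "wb (dh b) (dh c) k d = (0 :: 'a)"
      by (subst eq) (use dh_even[OF b] False in \<open>auto simp: dh_outside\<close>)
    then show ?thesis using False by (simp add: DH_outside)
  next
    case k: True
    define l where "l = pr k"
    have l: "l \<in> II" using k by (simp add: l_def)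
    have sc1: "mul (osmul x f) (del i (osmul y g)) d = x * y * mul f (del i g) d" for x y f i and g :: "'a Oel"
      by (simp add: del_osmul mul_osmul_left mul_osmul_right osmul_apply mult_ac)
    have part: "(\<Sum>i\<in>II. mul (dh b' i) (del i (dh c' k)) d)
        = tau l * (\<Sum>i\<in>II. tau i * mul (del i (bas b')) (del (pr i) (del l (bas c'))) d :: 'a)"
      if "even (card (snd b'))" "even (card (snd c'))" for b' c'
    proof -
      have "(\<Sum>i\<in>II. mul (dh b' i) (del i (dh c' k)) d)
         = (\<Sum>i\<in>II. tau l * (tau (pr i) * mul (del (pr i) (bas b')) (del (pr (pr i)) (del l (bas c'))) d) :: 'a)"
        using that k by (intro sum.cong refl) (simp add: dh_apply sc1 parO_even l_def mult_ac)
      also have "\<dots> = (\<Sum>i\<in>II. tau l * (tau i * mul (del i (bas b')) (del (pr i) (del l (bas c'))) d) :: 'a)"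
        by (rule sum_pr)
      finally show ?thesis by (simp add: sum_distrib_left)
    qed
    have T: "tau i * del l (mul (del i (bas b)) (del (pr i) (bas c))) d
        = tau i * mul (del i (bas b)) (del (pr i) (del l (bas c))) d
        - tau (pr i) * (mul (del (pr i) (bas c)) (del i (del l (bas b))) d :: 'a)" if i: "i \<in> II" for i
    proof -
      have s1: "smon (mu i) (del i (bas b) :: 'a Oel)" using smon_del[OF sb, of i] by simp
      have s2: "smon (mu i) (del (pr i) (bas c) :: 'a Oel)" using smon_del[OF sc, of "pr i"] i by simp
      have s3: "smon (mu i + mu l) (del l (del i (bas b)) :: 'a Oel)" using smon_del[OF s1] .
      have sgn1: "del l (del (pr i) f) = osmul ((-1) ^ (mu l * mu i)) (del (pr i) (del l f))" for f :: "'a Oel"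
        using i by (simp add: fun_eq_iff osmul_def del_swap[of l "pr i"])
      have sgn2: "del l (del i f) = osmul ((-1) ^ (mu l * mu i)) (del i (del l f))" for f :: "'a Oel"
        by (simp add: fun_eq_iff osmul_def del_swap[of l i])
      have ms: "mul f (osmul x g) d = x * mul f g d" for f g and x :: 'a
        by (simp add: osmul_def mul_scale_right)
      \<comment> \<open>Exchanging the two factors and exchanging the two derivatives leave
        \<open>(-1) ^ mu i\<close> in total. Together with \<open>tau i\<close> this is
        \<open>- tau (pr i)\<close>, which yields the minus sign of the commutator.\<close>
      have signs: "(-1) ^ ((mu i + mu l) * mu i) * ((-1) ^ (mu l * mu i) * x) = (-1) ^ mu i * x"
        "(-1) ^ (mu l * mu i) * ((-1) ^ (mu l * mu i) * x) = x" for x :: 'a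
        by (cases "even (mu i)"; cases "even (mu l)"; simp)+
      have "del l (mul (del i (bas b)) (del (pr i) (bas c))) d
          = mul (del l (del i (bas b))) (del (pr i) (bas c)) d
            + (-1) ^ (mu l * mu i) * (mul (del i (bas b)) (del l (del (pr i) (bas c))) d :: 'a)"
        using leibniz[OF ch s1 s2, of l d] by simp
      also have "mul (del l (del i (bas b))) (del (pr i) (bas c)) d
          = (-1) ^ ((mu i + mu l) * mu i) * (mul (del (pr i) (bas c)) (del l (del i (bas b))) d :: 'a)"
        by (rule mul_swap[OF s3 s2])
      also have "\<dots> = (-1) ^ mu i * mul (del (pr i) (bas c)) (del i (del l (bas b))) d"
        unfolding sgn2 ms signs(1) ..
      finally have "del l (mul (del i (bas b)) (del (pr i) (bas c))) d
          = (-1) ^ mu i * mul (del (pr i) (bas c)) (del i (del l (bas b))) d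
            + (mul (del i (bas b)) (del (pr i) (del l (bas c))) d :: 'a)"
        unfolding sgn1 ms signs(2) by (simp only: add.commute)
      moreover have "tau (pr i) = (- ((-1) ^ mu i) * tau i :: 'a)"
        using tau_pr[OF i] by simp
      ultimately show ?thesis by (simp add: algebra_simps)
    qed
    have "DH m n p t 0 (poi b c :: 'a Oel) k d = tau l * (\<Sum>i\<in>II. tau i * del l (mul (del i (bas b)) (del (pr i) (bas c))) d)"
      using k by (simp add: DH_apply l_def poi_def osmul_def del_sum del_scale)
    also have "\<dots> = tau l * (\<Sum>i\<in>II. tau i * mul (del i (bas b)) (del (pr i) (del l (bas c))) d)
        - tau l * (\<Sum>i\<in>II. tau (pr i) * mul (del (pr i) (bas c)) (del i (del l (bas b))) d)"
      by (simp only: T sum_subtractf right_diff_distrib cong: sum.cong)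
    also have "(\<Sum>i\<in>II. tau (pr i) * mul (del (pr i) (bas c)) (del i (del l (bas b))) d)
        = (\<Sum>i\<in>II. tau i * mul (del i (bas c)) (del (pr i) (del l (bas b))) d :: 'a)"
      using sum_pr[of "\<lambda>i. tau i * mul (del i (bas c)) (del (pr i) (del l (bas b))) d :: 'a"]
      by (simp cong: sum.cong)
    finally show ?thesis
      by (subst eq) (use dh_even[OF b] part[of b c] part[of c b] b c in auto)
  qed
qed

end

section \<open>Derivations vanishing in low degrees\<close>

lemma sum_supp:
  assumes "finite B" "A \<subseteq> B" "\<And>i. i \<in> B \<Longrightarrow> i \<notin> A \<Longrightarrow> f i = 0"
  shows "sum f B = sum f A"
  using assms by (intro sum.mono_neutral_right) auto

lemma sum_single:
  assumes "finite B" "a \<in> B" "\<And>i. i \<in> B \<Longrightarrow> i \<noteq> a \<Longrightarrow> f i = 0"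
  shows "sum f B = f a"
  using sum_supp[of B "{a}" f] assms by auto

lemma wspanI: "finite A \<Longrightarrow> A \<subseteq> S \<Longrightarrow> wsum (\<lambda>v. wsmul (c v) v) A \<in> wspan S"
  unfolding wspan_def mem_Collect_eq by (rule exI[of _ A], rule exI[of _ c]) simp

lemma wspan_wadd:
  assumes "x \<in> wspan S" "y \<in> wspan S"
  shows "wadd x y \<in> wspan S"
proof -
  from assms obtain A c A' c' where A: "finite A" "A \<subseteq> S" "x = wsum (\<lambda>v. wsmul (c v) v) A"
    and A': "finite A'" "A' \<subseteq> S" "y = wsum (\<lambda>v. wsmul (c' v) v) A'"
    unfolding wspan_def by blast
  let ?c = "\<lambda>v. (if v \<in> A then c v else 0) + (if v \<in> A' then c' v else 0)"
  have "wadd x y = wsum (\<lambda>v. wsmul (?c v) v) (A \<union> A')"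
  proof (intro ext)
    fix k b
    have "(\<Sum>v\<in>A \<union> A'. (if v \<in> A then c v else 0) * v k b) = (\<Sum>v\<in>A. c v * v k b)"
      using A(1) A'(1) by (subst sum_supp[of _ A]) auto
    moreover have "(\<Sum>v\<in>A \<union> A'. (if v \<in> A' then c' v else 0) * v k b) = (\<Sum>v\<in>A'. c' v * v k b)"
      using A(1) A'(1) by (subst sum_supp[of _ A']) auto
    ultimately show "wadd x y k b = wsum (\<lambda>v. wsmul (?c v) v) (A \<union> A') k b"
      unfolding A(3) A'(3) by (simp add: wadd_def wsum_def wsmul_def distrib_right sum.distrib)
  qed
  then show ?thesis using A(1,2) A'(1,2) by (simp only:) (rule wspanI; simp)
qed

lemma wspan_wsmul:
  assumes "x \<in> wspan S"
  shows "wsmul a x \<in> wspan S"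
proof -
  from assms obtain A c where A: "finite A" "A \<subseteq> S" "x = wsum (\<lambda>v. wsmul (c v) v) A"
    unfolding wspan_def by blast
  have "wsmul a x = wsum (\<lambda>v. wsmul (a * c v) v) A"
    unfolding A(3) by (simp add: wsum_def wsmul_def sum_distrib_left mult.assoc fun_eq_iff)
  then show ?thesis using A(1,2) by (simp only:) (rule wspanI; simp)
qed

lemma wspan_base: "x \<in> S \<Longrightarrow> x \<in> wspan S"
  using wspanI[of "{x}" S "\<lambda>_. 1"] by (simp add: wsum_def wsmul_def)

lemma wspan_wzero: "wzero \<in> wspan S"
  using wspanI[of "{}" S] by (simp add: wsum_def wzero_def)

locale hderiv = superalg m n p t
  for m n p :: nat and t :: "nat \<Rightarrow> nat" +
  fixes \<phi> :: "'a::field Wel \<Rightarrow> 'a Wel"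
  assumes char_p: "CHAR('a) = p"
    and into_W1: "\<And>x. x \<in> H0 m n p t \<Longrightarrow> \<phi> x \<in> W1 m n p t"
    and additive: "\<And>x y. x \<in> H0 m n p t \<Longrightarrow> y \<in> H0 m n p t \<Longrightarrow> \<phi> (wadd x y) = wadd (\<phi> x) (\<phi> y)"
    and homog_scal: "\<And>c x. x \<in> H0 m n p t \<Longrightarrow> \<phi> (wsmul c x) = wsmul c (\<phi> x)"
    and derivation: "\<And>x y. x \<in> H0 m n p t \<Longrightarrow> y \<in> H0 m n p t \<Longrightarrow>
         \<phi> (wbr m n p t x y) = wadd (wbr m n p t (\<phi> x) y) (wbr m n p t x (\<phi> y))"
    and vanish: "\<And>x y. x \<in> H0deg m n p t (-1) \<Longrightarrow> y \<in> H0deg m n p t 0 \<Longrightarrow> \<phi> (wadd x y) = wzero"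
begin

abbreviation "HI \<equiv> Hidx m n p t"

text \<open>An even subset is never all of \<open>I1 m n\<close>, which has the odd cardinality
  \<open>n\<close>.\<close>

lemma HI_iff: "b \<in> HI \<longleftrightarrow> b \<in> BB \<and> even (card (snd b))"
proof -
  have "odd (card (I1 m n))" using n_odd by (simp add: I1_def)
  then show ?thesis unfolding Hidx_def by auto
qed

lemma finite_HI [simp]: "finite HI"
  by (rule finite_subset[OF _ finite_BB]) (auto simp: HI_iff)

lemma dh_H0: "b \<in> HI \<Longrightarrow> dh b \<in> H0 m n p t"
  unfolding H0_def by (rule wspan_base) simp

lemma phi_wzero: "\<phi> wzero = wzero"
proof -
  have "\<phi> (wsmul 0 wzero) = wsmul 0 (\<phi> wzero)"
    by (rule homog_scal) (simp add: H0_def wspan_wzero)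
  then show ?thesis by (simp add: wsmul_def wzero_def)
qed

lemma phi_lincomb:
  assumes "finite A" "A \<subseteq> HI"
  shows "wsum (\<lambda>b. wsmul (f b) (dh b)) A \<in> H0 m n p t \<and>
    \<phi> (wsum (\<lambda>b. wsmul (f b) (dh b)) A) = wsum (\<lambda>b. wsmul (f b) (\<phi> (dh b))) A"
  using assms
proof (induction A rule: finite_induct)
  case empty
  have "wsum (\<lambda>b. wsmul (f b) (F b)) {} = wzero" for F :: "idx \<Rightarrow> 'a Wel"
    by (simp add: wsum_def wzero_def)
  then show ?case using phi_wzero by (simp add: H0_def wspan_wzero)
next
  case (insert b A)
  have *: "wsum (\<lambda>b. wsmul (f b) (F b)) (insert b A) = wadd (wsmul (f b) (F b)) (wsum (\<lambda>b. wsmul (f b) (F b)) A)"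
    for F :: "idx \<Rightarrow> 'a Wel"
    using insert by (simp add: wsum_def wadd_def)
  have b: "dh b \<in> H0 m n p t" "wsmul (f b) (dh b) \<in> H0 m n p t"
    using insert dh_H0[of b] by (auto simp: H0_def intro: wspan_wsmul)
  then show ?case
    unfolding * using insert additive[OF b(2)] homog_scal[OF b(1)]
    by (auto simp: H0_def intro: wspan_wadd)
qed

lemma DH_lincomb:
  assumes "\<And>b. f b \<noteq> 0 \<Longrightarrow> b \<in> HI"
  shows "DH m n p t 0 f = wsum (\<lambda>b. wsmul (f b) (dh b)) HI"
proof (intro ext)
  fix k d
  have f: "f = (\<lambda>d. \<Sum>b\<in>HI. f b * bas b d)"
  proof
    fix d
    show "f d = (\<Sum>b\<in>HI. f b * bas b d)"
      using assms[of d] by (cases "f d = 0")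
        (auto simp: bas_def if_distrib sum.delta cong: if_cong)
  qed
  show "DH m n p t 0 f k d = wsum (\<lambda>b. wsmul (f b) (dh b)) HI k d"
  proof (cases "k \<in> II")
    case True
    have "del (pr k) f d = (\<Sum>b\<in>HI. f b * del (pr k) (bas b) d)"
      by (subst f) (simp add: del_sum del_scale)
    then show ?thesis
      using True by (auto simp: DH_apply wsum_def wsmul_def dh_apply HI_iff parO_even osmul_def
          sum_distrib_left mult_ac intro!: sum.cong)
  qed (simp add: DH_outside wsum_def wsmul_def dh_outside)
qed

definition psi :: "idx \<Rightarrow> 'a Wel" where "psi b = \<phi> (dh b)"

lemma dh_notin: "b \<notin> BB \<Longrightarrow> dh b = (wzero :: 'a Wel)"
proof -
  assume b: "b \<notin> BB"
  have "dh b k d = (0 :: 'a)" for k d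
    by (cases "k \<in> II") (simp_all add: dh_apply dh_outside del_bas_notin[OF b] osmul_def)
  then show ?thesis by (simp add: wzero_def fun_eq_iff)
qed

text \<open>Indices with overflowing exponents stand for zero, so bracket sums may run over all
  \<open>i\<close> without membership tests.\<close>

lemma psi_notin: "b \<notin> BB \<Longrightarrow> psi b k d = 0"
  by (simp add: psi_def dh_notin phi_wzero) (simp add: wzero_def)

lemma psi_W1: "b \<in> HI \<Longrightarrow> psi b \<in> W1 m n p t"
  unfolding psi_def by (rule into_W1[OF dh_H0])

lemma psi_nonzero: "b \<in> HI \<Longrightarrow> psi b k d \<noteq> 0 \<Longrightarrow> k \<in> II \<and> d \<in> BB \<and> odd (card (snd d) + mu k)"
  using psi_W1[of b] unfolding W1_def Wset_def parO_def mem_Collect_eq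
  by (metis even_add even_mod_2_iff)

text \<open>The degree of \<open>dh b\<close> is two less than that of \<open>b\<close>, so
  monomials of degree 1 and 2 span the degrees -1 and 0 on which the derivation vanishes.\<close>

lemma psi_low_degree:
  assumes "b \<in> HI" "zdO m b \<in> {1, 2}"
  shows "psi b = wzero"
proof -
  have z: "wadd x wzero = x" "wadd wzero x = x" for x :: "'a Wel"
    by (simp_all add: wadd_def wzero_def)
  have "(dh b :: 'a Wel) \<in> H0deg m n p t (zdO m b - 2)"
    unfolding H0deg_def by (rule wspan_base) (use assms in auto)
  moreover have "(wzero :: 'a Wel) \<in> H0deg m n p t k" for k unfolding H0deg_def by (rule wspan_wzero)
  ultimately show ?thesis
    using assms(2) vanish[of "dh b" wzero] vanish[of wzero "dh b"] by (auto simp: psi_def z)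
qed

definition poicoef :: "idx \<Rightarrow> idx \<Rightarrow> nat \<Rightarrow> 'a" where
  "poicoef b c i = tau i * pdcoef m n i b * pdcoef m n (pr i) c * moncoef m (pdmon m i b) (pdmon m (pr i) c)"

definition poimon :: "idx \<Rightarrow> idx \<Rightarrow> nat \<Rightarrow> idx" where
  "poimon b c i = badd (pdmon m i b) (pdmon m (pr i) c)"

lemma poi_apply:
  assumes "b \<in> BB" "c \<in> BB"
  shows "poi b c d = (\<Sum>i\<in>II. if d \<in> BB \<and> d = poimon b c i then poicoef b c i else 0)"
  unfolding poi_def
proof (intro sum.cong refl)
  fix i
  show "tau i * mul (del i (bas b)) (del (pr i) (bas c)) d
      = (if d \<in> BB \<and> d = poimon b c i then poicoef b c i else 0)"
    unfolding del_bas[OF assms(1)] del_bas[OF assms(2)]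
      mul_osmul_bas[OF pdmon_in_BB[OF assms(1)] pdmon_in_BB[OF assms(2)]]
    by (auto simp: poicoef_def poimon_def)
qed

lemma poicoef_parity:
  assumes "b \<in> HI" "c \<in> HI" "i \<in> II" "poicoef b c i \<noteq> 0"
  shows "even (card (snd (poimon b c i)))"
proof -
  note [simp] = BB_finite_snd
  have fin: "finite (snd b)" "finite (snd c)" using assms by (auto simp: HI_iff)
  have disj: "snd (pdmon m i b) \<inter> snd (pdmon m (pr i) c) = {}"
    and nz: "pdcoef m n i b \<noteq> (0 :: 'a)" "pdcoef m n (pr i) c \<noteq> (0 :: 'a)"
    using assms(4) by (auto simp: poicoef_def moncoef_def split: if_splits)
  have "card (snd (poimon b c i)) = card (snd (pdmon m i b)) + card (snd (pdmon m (pr i) c))"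
    using disj fin by (simp add: poimon_def badd_def card_Un_disjoint pdmon_def)
  also have "even \<dots>"
  proof (cases "i \<in> I0 m")
    case True
    then show ?thesis using assms by (simp add: pdmon_def HI_iff II_iff)
  next
    case False
    then have mem: "i \<in> snd b" "pr i \<in> snd c" "pr i \<notin> I0 m"
      using nz assms(3) by (auto simp: pdcoef_def split: if_splits)
    then have "card (snd b) = Suc (card (snd (pdmon m i b)))"
      "card (snd c) = Suc (card (snd (pdmon m (pr i) c)))"
      using False card.remove[OF fin(1) mem(1)] card.remove[OF fin(2) mem(2)] mem(3)
      by (simp_all add: pdmon_def)
    then show ?thesis using assms(1,2) by (simp add: HI_iff)
  qed
  finally show ?thesis .
qed

text \<open>\<open>bracket_dh\<close> turns the bracket into \<open>D_H\<close> of a Poisson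
  bracket, and linearity spreads the derivation over its monomials.\<close>

lemma master:
  assumes b: "b \<in> HI" and c: "c \<in> HI"
  shows "(\<Sum>i\<in>II. poicoef b c i * psi (poimon b c i) k d) = wb (dh b) (psi c) k d + wb (psi b) (dh c) k d"
proof -
  have bc: "b \<in> BB" "c \<in> BB" "even (card (snd b))" "even (card (snd c))"
    using assms by (auto simp: HI_iff)
  have supp: "e \<in> HI" if nz: "poi b c e \<noteq> (0 :: 'a)" for e
  proof -
    obtain i where "i \<in> II" "(if e \<in> BB \<and> e = poimon b c i then poicoef b c i else 0) \<noteq> 0"
      using nz unfolding poi_apply[OF bc(1,2)] by (rule sum.not_neutral_contains_not_neutral)
    then have "i \<in> II" "e \<in> BB" "e = poimon b c i" "poicoef b c i \<noteq> 0"
      by (auto split: if_splits)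
    then show ?thesis using poicoef_parity[OF b c] by (simp add: HI_iff)
  qed
  have "wb (dh b) (dh c :: 'a Wel) = wsum (\<lambda>e. wsmul (poi b c e) (dh e)) HI"
    unfolding bracket_dh[OF char_p bc(1,3) bc(2,4)] by (rule DH_lincomb[OF supp])
  then have "\<phi> (wb (dh b) (dh c)) k d = (\<Sum>e\<in>HI. poi b c e * psi e k d)"
    using phi_lincomb[of HI "poi b c"] by (simp add: wsum_def wsmul_def psi_def)
  also have "\<dots> = (\<Sum>e\<in>HI. \<Sum>i\<in>II. if e = poimon b c i then poicoef b c i * psi (poimon b c i) k d else 0)"
    unfolding poi_apply[OF bc(1,2)] sum_distrib_right
    by (intro sum.cong refl) (auto simp: HI_iff)
  also have "\<dots> = (\<Sum>i\<in>II. \<Sum>e\<in>HI. if e = poimon b c i then poicoef b c i * psi (poimon b c i) k d else 0)"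
    by (rule sum.swap)
  also have "\<dots> = (\<Sum>i\<in>II. poicoef b c i * psi (poimon b c i) k d)"
  proof (intro sum.cong refl)
    fix i assume i: "i \<in> II"
    \<comment> \<open>If \<open>poimon b c i\<close> is not in \<open>HI\<close>, either its parity
      is wrong and the coefficient vanishes, or it overflows and \<open>psi\<close>
      vanishes.\<close>
    show "(\<Sum>e\<in>HI. if e = poimon b c i then poicoef b c i * psi (poimon b c i) k d else 0)
       = poicoef b c i * psi (poimon b c i) k d"
      using poicoef_parity[OF b c i] psi_notin[of "poimon b c i" k d]
      by (cases "poimon b c i \<in> HI") (auto simp: sum.delta HI_iff)
  qed
  finally show ?thesis
    using derivation[OF dh_H0[OF b] dh_H0[OF c]] by (simp add: psi_def wadd_def add.commute)
qed

text \<open>The bracket of \<open>dh b\<close> with \<open>psi c\<close> in coordinates, free of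
  signs because \<open>dh b\<close> is even. A bracket with an even field is antisymmetric, so the
  other half of the derivation rule is \<open>- act c b\<close>.\<close>

definition act :: "idx \<Rightarrow> idx \<Rightarrow> 'a Wel" where
  "act b c k d = (\<Sum>i\<in>II. mul (dh b i) (del i (psi c k)) d) - (\<Sum>i\<in>II. mul (psi c i) (del i (dh b k)) d)"

lemma master_act:
  assumes b: "b \<in> HI" and c: "c \<in> HI"
  shows "(\<Sum>i\<in>II. poicoef b c i * psi (poimon b c i) k d) = act b c k d - act c b k d"
proof -
  have W: "(dh x :: 'a Wel) \<in> Wset m n p t" for x by (rule dh_Wset)
  have W': "psi b \<in> Wset m n p t" "psi c \<in> Wset m n p t"
    using psi_W1 assms by (auto simp: W1_def)
  have ev: "\<forall>i d. dh x i d \<noteq> (0 :: 'a) \<longrightarrow> even (parO d + mu i)" if "x \<in> HI" for x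
    using that dh_even[of x] by (auto simp: HI_iff)
  show ?thesis
    unfolding master[OF assms] wb_expand[OF W W'(2) disjI1[OF ev[OF b]]] wb_expand[OF W'(1) W disjI2[OF ev[OF c]]]
    by (simp add: act_def)
qed

text \<open>The coefficient of the purely odd monomial \<open>x^v\<close> in component
  \<open>k\<close> of \<open>psi b\<close>. By \<open>psi_C\<close> these values determine
  \<open>psi\<close>.\<close>

definition C :: "idx \<Rightarrow> nat \<Rightarrow> nat set \<Rightarrow> 'a" where "C b k v = psi b k (zeroA, v)"

lemma zero_in_BB [simp]: "(zeroA, v) \<in> BB \<longleftrightarrow> v \<subseteq> I1 m n"
  using p_gt by (simp add: in_BB_iff zeroA_def)

lemma mul_one: "d \<in> BB \<Longrightarrow> mul (bas (zeroA, {})) f d = f d"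
proof -
  assume d: "d \<in> BB"
  have "mul (bas (zeroA, {})) f d = (\<Sum>b\<in>BB. \<Sum>c\<in>BB. if b = (zeroA, {}) \<and> c = d then f d else 0)"
    unfolding omult_def
  proof (intro sum.cong refl)
    fix b c :: idx
    have "c = d \<longleftrightarrow> d \<in> BB \<and> fst d = fst c \<and> snd d = snd c" using d by (auto simp: prod_eq_iff)
    then show "bas (zeroA, {}) b * f c * multcoef m n p t b c d = (if b = (zeroA, {}) \<and> c = d then f d else 0)"
      by (auto simp: bas_def multcoef_def zeroA_def binomA_def)
  qed
  also have "\<dots> = (\<Sum>b\<in>BB. if b = (zeroA, {}) then f d else 0)"
    using d by (intro sum.cong refl) (auto simp: sum.delta)
  finally show ?thesis by (simp add: sum.delta)
qed

lemma epsA_in_BB: "i \<in> I0 m \<Longrightarrow> u \<subseteq> I1 m n \<Longrightarrow> (epsA i, u) \<in> BB"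
proof -
  assume i: "i \<in> I0 m" and u: "u \<subseteq> I1 m n"
  have "1 < p ^ t j" if "j \<in> I0 m" for j
    using t_pos[OF that] p_gt by (intro one_less_power) auto
  then show ?thesis using i u p_gt by (auto simp: in_BB_iff epsA_def)
qed

text \<open>\<open>dh\<close> of the variable \<open>x_(pr i)\<close> is a nonzero multiple of the
  partial derivative along \<open>i\<close> and is killed by \<open>psi\<close>; the cocycle
  identity for it says that \<open>psi\<close> commutes with this derivative.\<close>

lemma del_psi:
  assumes i: "i \<in> I0 m" and c: "c \<in> HI"
  shows "del i (psi c k) d = pdcoef m n i c * psi (pdmon m i c) k d"
proof (cases "d \<in> BB")
  case False
  have "pdmon m i c \<in> HI"
    using pdmon_in_BB[of c i] c i by (simp add: HI_iff) (simp add: pdmon_def)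
  then have "psi (pdmon m i c) k d = 0" using psi_nonzero False by blast
  moreover have "del i (psi c k) d = 0" using del_nonzero_BB False by blast
  ultimately show ?thesis by simp
next
  case d: True
  define j where "j = pr i"
  have II: "i \<in> II" "j \<in> II" "j \<in> I0 m" "pr j = i" using i by (auto simp: II_iff j_def)
  let ?b = "(epsA j, {}) :: idx"
  have b: "?b \<in> HI" using epsA_in_BB[OF II(3)] by (simp add: HI_iff)
  have cBB: "c \<in> BB" using c by (simp add: HI_iff)
  have pdc: "pdcoef m n l ?b = (if l = j then 1 else 0 :: 'a)" for l
    using II(3) by (simp add: pdcoef_def epsA_def)
  have pdm: "pdmon m j ?b = (zeroA, {})"
    using II(3) by (simp add: pdmon_def epsA_def zeroA_def fun_eq_iff)
  have dhb: "dh ?b l = (if l = i then osmul (tau j) (bas (zeroA, {})) else (\<lambda>_. 0 :: 'a))" if "l \<in> II" for l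
  proof -
    have "pr l = j \<longleftrightarrow> l = i" using that II(1,4) by (auto simp: j_def) (metis pr_involution)
    moreover have "?b \<in> BB" "parO ?b = 0" using b by (simp_all add: HI_iff parO_def)
    ultimately show ?thesis
      using that II(4) by (cases "l = i") (simp_all add: dh_apply del_bas pdc pdm j_def[symmetric], simp_all add: osmul_def)
  qed
  have absb: "absA m (epsA j) = 1"
    using II(3) unfolding absA_def by (subst sum_single[of _ j]) (auto simp: epsA_def)
  have psib: "psi ?b = wzero"
    by (rule psi_low_degree[OF b]) (simp add: zdO_def absb)
  have act1: "act ?b c k d = tau j * del i (psi c k) d"
  proof -
    have "(\<Sum>l\<in>II. mul (dh ?b l) (del l (psi c k)) d) = tau j * del i (psi c k) d"
      using II d by (subst sum_single[of _ i]) (auto simp: dhb mul_osmul_left osmul_apply mul_one)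
    moreover have "del l (dh ?b k) = (\<lambda>_. 0 :: 'a)" for l
    proof (cases "k \<in> II \<and> k = i")
      case True
      have "del l (bas (zeroA, {})) = (\<lambda>_. 0 :: 'a)"
        by (simp add: del_bas) (simp add: pdcoef_def zeroA_def osmul_def)
      then show ?thesis using True II(1) by (simp add: dhb del_osmul) (simp add: osmul_def)
    next
      case False
      then have "dh ?b k = (\<lambda>_. 0 :: 'a)" by (cases "k \<in> II") (auto simp: dhb dh_outside)
      then show ?thesis by simp
    qed
    ultimately show ?thesis by (simp add: act_def)
  qed
  have act2: "act c ?b k d = 0"
    unfolding act_def psib wzero_def by simp
  have "(\<Sum>l\<in>II. poicoef ?b c l * psi (poimon ?b c l) k d) = poicoef ?b c j * psi (poimon ?b c j) k d"
    by (rule sum_single) (use II in \<open>auto simp: poicoef_def pdc\<close>)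
  also have "poimon ?b c j = pdmon m i c"
    by (simp add: poimon_def pdm II(4) badd_def zeroA_def)
  also have "poicoef ?b c j = tau j * pdcoef m n i c"
    by (simp add: poicoef_def pdc pdm II(4) moncoef_def binomA_def zeroA_def)
  finally have "tau j * del i (psi c k) d = tau j * (pdcoef m n i c * psi (pdmon m i c) k d)"
    unfolding master_act[OF b c] act1 act2 by (simp add: mult.assoc)
  moreover have "tau j \<noteq> (0 :: 'a)" by (auto simp: tauI_def)
  ultimately show ?thesis by (simp only: mult_cancel_left) simp
qed

text \<open>The coefficient at \<open>\<gamma>\<close> is the constant term of the
  \<open>\<gamma>\<close>-th derivative, and that derivative can be moved inside \<open>psi\<close>.
  Each induction step strips one even variable.\<close>

lemma psi_C:
  assumes "(\<alpha>, u) \<in> HI" "(\<gamma>, v) \<in> BB"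
  shows "psi (\<alpha>, u) k (\<gamma>, v) = (if \<forall>i. \<gamma> i \<le> \<alpha> i then C ((\<lambda>i. \<alpha> i - \<gamma> i), u) k v else 0)"
  using assms
proof (induction "sum \<gamma> (I0 m)" arbitrary: \<alpha> \<gamma> rule: less_induct)
  case less
  show ?case
  proof (cases "\<forall>i\<in>I0 m. \<gamma> i = 0")
    case True
    then have "\<gamma> = zeroA" using less.prems(2) by (auto simp: in_BB_iff zeroA_def fun_eq_iff)
    then show ?thesis by (simp add: C_def zeroA_def)
  next
    case False
    then obtain i where i: "i \<in> I0 m" "\<gamma> i > 0" by blast
    define \<gamma>' where "\<gamma>' = \<gamma>(i := \<gamma> i - 1)"
    have \<gamma>': "\<gamma>'(i := \<gamma>' i + 1) = \<gamma>" using i by (auto simp: \<gamma>'_def)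
    have BB': "(\<gamma>', v) \<in> BB" using less.prems(2) i by (auto simp: in_BB_iff \<gamma>'_def less_imp_diff_less)
    have sm: "sum \<gamma>' (I0 m) < sum \<gamma> (I0 m)"
      by (rule sum_strict_mono_ex1) (use i in \<open>auto simp: \<gamma>'_def\<close>)
    have "psi (\<alpha>, u) k (\<gamma>, v) = del i (psi (\<alpha>, u) k) (\<gamma>', v)"
      using BB' less.prems(2) unfolding del_I0[OF i(1)] \<gamma>' by simp
    also have "\<dots> = pdcoef m n i (\<alpha>, u) * psi (\<alpha>(i := \<alpha> i - 1), u) k (\<gamma>', v)"
      using del_psi[OF i(1) less.prems(1)] i(1) by (simp add: pdmon_def)
    also have "\<dots> = (if \<alpha> i > 0 \<and> (\<forall>j. \<gamma>' j \<le> (\<alpha>(i := \<alpha> i - 1)) j)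
        then C ((\<lambda>j. (\<alpha>(i := \<alpha> i - 1)) j - \<gamma>' j), u) k v else 0)"
    proof -
      have "(\<alpha>(i := \<alpha> i - 1), u) \<in> HI"
        using less.prems(1) pdmon_in_BB[of "(\<alpha>, u)" i] i(1) by (simp add: HI_iff pdmon_def)
      then show ?thesis using less.hyps[OF sm _ BB'] i(1) by (simp add: pdcoef_def)
    qed
    also have "\<alpha> i > 0 \<and> (\<forall>j. \<gamma>' j \<le> (\<alpha>(i := \<alpha> i - 1)) j) \<longleftrightarrow> (\<forall>j. \<gamma> j \<le> \<alpha> j)"
    proof -
      have "\<gamma>' j \<le> (\<alpha>(i := \<alpha> i - 1)) j \<longleftrightarrow> \<gamma> j \<le> \<alpha> j" if "\<alpha> i > 0" for j
        using i(2) that by (cases "j = i") (auto simp: \<gamma>'_def)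
      moreover have "\<alpha> i > 0" if "\<gamma> i \<le> \<alpha> i" using i(2) that by linarith
      ultimately show ?thesis by blast
    qed
    also have "(\<lambda>j. (\<alpha>(i := \<alpha> i - 1)) j - \<gamma>' j) = (\<lambda>j. \<alpha> j - \<gamma> j)"
      using i(2) unfolding \<gamma>'_def by (auto simp: fun_eq_iff)
    finally show ?thesis .
  qed
qed

section \<open>Constant terms of the cocycle identity\<close>

lemma binomA_zeroA: "binomA m zeroA \<beta> = 1" "binomA m \<beta> zeroA = 1"
  by (simp_all add: binomA_def zeroA_def)

lemma mul_bas_const:
  assumes "b \<in> BB" "v \<subseteq> I1 m n"
  shows "mul (osmul s (bas b)) g (zeroA, v) =
    (if fst b = zeroA \<and> snd b \<subseteq> v
     then s * sgnUV (snd b) (v - snd b) * g (zeroA, v - snd b) else (0 :: 'a))"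
proof -
  let ?c = "(zeroA, v - snd b)"
  let ?R = "if fst b = zeroA \<and> snd b \<subseteq> v then s * sgnUV (snd b) (v - snd b) * g ?c else 0"
  have "mul (osmul s (bas b)) g (zeroA, v) = (\<Sum>b'\<in>BB. \<Sum>c'\<in>BB. if b' = b \<and> c' = ?c then ?R else 0)"
    unfolding omult_def
  proof (intro sum.cong refl)
    fix b' c'
    show "osmul s (bas b) b' * g c' * multcoef m n p t b' c' (zeroA, v) =
      (if b' = b \<and> c' = ?c then ?R else 0)"
    proof (cases "b' = b")
      case True
      have "(zeroA = (\<lambda>i. fst b i + fst c' i)) \<longleftrightarrow> fst b = zeroA \<and> fst c' = zeroA"
        by (auto simp: zeroA_def fun_eq_iff)
      moreover have "v = snd b \<union> snd c' \<and> snd b \<inter> snd c' = {} \<longleftrightarrow> snd b \<subseteq> v \<and> snd c' = v - snd b"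
        by auto
      moreover have "multcoef m n p t b c' (zeroA, v) =
        (if zeroA = (\<lambda>i. fst b i + fst c' i) \<and> (v = snd b \<union> snd c' \<and> snd b \<inter> snd c' = {})
         then of_nat (binomA m (fst b) (fst c')) * sgnUV (snd b) (snd c') else (0 :: 'a))"
        using assms by (simp add: multcoef_def)
      ultimately have "multcoef m n p t b c' (zeroA, v) =
        (if fst b = zeroA \<and> snd b \<subseteq> v \<and> c' = ?c then sgnUV (snd b) (v - snd b) else (0 :: 'a))"
        by (cases c') (simp add: binomA_zeroA)
      then show ?thesis using True by (auto simp: osmul_def bas_def)
    qed (simp add: osmul_def bas_def)
  qed
  also have "\<dots> = (\<Sum>b'\<in>BB. if b' = b then ?R else 0)"
    using assms(2) by (intro sum.cong refl) (auto simp: sum.delta)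
  also have "\<dots> = ?R" using assms(1) by (simp add: sum.delta)
  finally show ?thesis .
qed

lemma mul_const_bas:
  assumes "b \<in> BB" "v \<subseteq> I1 m n"
  shows "mul g (osmul s (bas b)) (zeroA, v) =
    (if fst b = zeroA \<and> snd b \<subseteq> v
     then s * sgnUV (v - snd b) (snd b) * g (zeroA, v - snd b) else (0 :: 'a))"
proof -
  let ?c = "(zeroA, v - snd b)"
  let ?R = "if fst b = zeroA \<and> snd b \<subseteq> v then s * sgnUV (v - snd b) (snd b) * g ?c else 0"
  have "mul g (osmul s (bas b)) (zeroA, v) = (\<Sum>c'\<in>BB. \<Sum>b'\<in>BB. if b' = b \<and> c' = ?c then ?R else 0)"
    unfolding omult_def
  proof (intro sum.cong refl)
    fix b' c'
    show "g c' * osmul s (bas b) b' * multcoef m n p t c' b' (zeroA, v) =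
      (if b' = b \<and> c' = ?c then ?R else 0)"
    proof (cases "b' = b")
      case True
      have "(zeroA = (\<lambda>i. fst c' i + fst b i)) \<longleftrightarrow> fst b = zeroA \<and> fst c' = zeroA"
        by (auto simp: zeroA_def fun_eq_iff)
      moreover have "v = snd c' \<union> snd b \<and> snd c' \<inter> snd b = {} \<longleftrightarrow> snd b \<subseteq> v \<and> snd c' = v - snd b"
        by auto
      moreover have "multcoef m n p t c' b (zeroA, v) =
        (if zeroA = (\<lambda>i. fst c' i + fst b i) \<and> (v = snd c' \<union> snd b \<and> snd c' \<inter> snd b = {})
         then of_nat (binomA m (fst c') (fst b)) * sgnUV (snd c') (snd b) else (0 :: 'a))"
        using assms by (simp add: multcoef_def)
      ultimately have "multcoef m n p t c' b (zeroA, v) =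
        (if fst b = zeroA \<and> snd b \<subseteq> v \<and> c' = ?c then sgnUV (v - snd b) (snd b) else (0 :: 'a))"
        by (cases c') (simp add: binomA_zeroA)
      then show ?thesis using True by (auto simp: osmul_def bas_def)
    qed (simp add: osmul_def bas_def)
  qed
  also have "\<dots> = (\<Sum>c'\<in>BB. if c' = ?c then ?R else 0)"
    using assms(1) by (intro sum.cong refl) (auto simp: sum.delta)
  also have "\<dots> = ?R" using assms(2) by (simp add: sum.delta) auto
  finally show ?thesis .
qed

text \<open>The constant term of the \<open>i\<close>-th derivative of component \<open>k\<close> of
  \<open>psi c\<close>. For even \<open>i\<close> it is again a value of \<open>C\<close> by
  \<open>del_psi\<close>; an odd derivative only inserts \<open>i\<close> into the exterior
  index.\<close>

definition dC :: "nat \<Rightarrow> idx \<Rightarrow> nat \<Rightarrow> nat set \<Rightarrow> 'a" where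
  "dC i c k w =
     (if i \<in> I0 m then pdcoef m n i c * C (pdmon m i c) k w
      else if i \<notin> w then sgnUV {i} w * C c k (insert i w) else 0)"

text \<open>\<open>lterm\<close> and \<open>rterm\<close> are the constant terms of the summands in
  the two sums of \<open>act\<close>. A product has a constant term only if both factors do, so the
  tests against \<open>zeroA\<close> admit even degree at most 1 in \<open>b\<close> for
  \<open>lterm\<close> and at most 2 for \<open>rterm\<close>.\<close>

definition lterm :: "idx \<Rightarrow> idx \<Rightarrow> nat \<Rightarrow> nat set \<Rightarrow> nat \<Rightarrow> 'a" where
  "lterm b c k v i =
     (if fst (pdmon m (pr i) b) = zeroA \<and> snd (pdmon m (pr i) b) \<subseteq> v
      then tau (pr i) * pdcoef m n (pr i) b * sgnUV (snd (pdmon m (pr i) b)) (v - snd (pdmon m (pr i) b))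
         * dC i c k (v - snd (pdmon m (pr i) b)) else 0)"

definition rterm :: "idx \<Rightarrow> idx \<Rightarrow> nat \<Rightarrow> nat set \<Rightarrow> nat \<Rightarrow> 'a" where
  "rterm b c k v i =
     (let e = pdmon m i (pdmon m (pr k) b) in
      if fst e = zeroA \<and> snd e \<subseteq> v
      then tau (pr k) * pdcoef m n (pr k) b * pdcoef m n i (pdmon m (pr k) b) * sgnUV (v - snd e) (snd e)
         * C c i (v - snd e) else 0)"

lemma act_const:
  assumes b: "b \<in> HI" and c: "c \<in> HI" and v: "v \<subseteq> I1 m n" and k: "k \<in> II"
  shows "act b c k (zeroA, v) = (\<Sum>i\<in>II. lterm b c k v i) - (\<Sum>i\<in>II. rterm b c k v i)"
proof -
  have bB: "b \<in> BB" and par: "parO b = 0" using b by (auto simp: HI_iff parO_even)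
  have dhb: "dh b i = osmul (tau (pr i) * pdcoef m n (pr i) b) (bas (pdmon m (pr i) b))" if "i \<in> II" for i
    using that par by (simp add: dh_apply del_bas[OF bB]) (simp add: osmul_def mult.assoc)
  have "mul (dh b i) (del i (psi c k)) (zeroA, v) = lterm b c k v i" if i: "i \<in> II" for i
  proof -
    have dps: "del i (psi c k) (zeroA, w) = dC i c k w" if "w \<subseteq> I1 m n" for w
    proof (cases "i \<in> I0 m")
      case True
      then show ?thesis using del_psi[OF True c] by (simp add: dC_def C_def)
    next
      case False
      then have "i \<in> I1 m n" using i by (simp add: II_iff)
      then show ?thesis using False that by (simp add: del_I1 dC_def C_def)
    qed
    show ?thesis
      unfolding dhb[OF i] mul_bas_const[OF pdmon_in_BB[OF bB] v] lterm_def
      using v by (subst dps) auto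
  qed
  moreover have "mul (psi c i) (del i (dh b k)) (zeroA, v) = rterm b c k v i" for i
  proof -
    have "del i (dh b k) = osmul (tau (pr k) * pdcoef m n (pr k) b * pdcoef m n i (pdmon m (pr k) b))
        (bas (pdmon m i (pdmon m (pr k) b)) :: 'a Oel)"
      by (simp add: dhb[OF k] del_osmul del_bas[OF pdmon_in_BB[OF bB]]) (simp add: osmul_def mult.assoc)
    then show ?thesis
      by (simp add: mul_const_bas[OF pdmon_in_BB[OF pdmon_in_BB[OF bB]] v] rterm_def C_def Let_def)
  qed
  ultimately show ?thesis unfolding act_def by simp
qed

text \<open>\<open>lhs b c\<close> is the constant term of \<open>psi\<close> at the Poisson bracket of \<open>b\<close> and \<open>c\<close>, and \<open>actC b c\<close> is that of
  the bracket of \<open>dh b\<close> with \<open>psi c\<close>.\<close>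

definition lhs :: "idx \<Rightarrow> idx \<Rightarrow> nat \<Rightarrow> nat set \<Rightarrow> 'a" where
  "lhs b c k v = (\<Sum>i\<in>II. poicoef b c i * C (poimon b c i) k v)"

definition actC :: "idx \<Rightarrow> idx \<Rightarrow> nat \<Rightarrow> nat set \<Rightarrow> 'a" where
  "actC b c k v = (\<Sum>i\<in>II. lterm b c k v i) - (\<Sum>i\<in>II. rterm b c k v i)"

text \<open>The working form of the derivation property: later arguments choose \<open>b\<close> and
  \<open>c\<close> so that both \<open>actC\<close> terms are known and few values of
  \<open>C\<close> occur in \<open>lhs\<close>.\<close>

lemma relation:
  assumes b: "b \<in> HI" and c: "c \<in> HI" and v: "v \<subseteq> I1 m n" and k: "k \<in> II"
  shows "lhs b c k v = actC b c k v - actC c b k v"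
  using master_act[OF b c, of k "(zeroA, v)"] act_const[OF b c v k] act_const[OF c b v k]
  by (simp add: lhs_def C_def actC_def)

lemma C_nonzero: "b \<in> HI \<Longrightarrow> C b k v \<noteq> 0 \<Longrightarrow> k \<in> II \<and> v \<subseteq> I1 m n \<and> odd (card v + mu k)"
  unfolding C_def using psi_nonzero[of b k "(zeroA, v)"] by simp

lemma C_notin: "b \<notin> BB \<Longrightarrow> C b k v = 0"
  by (simp add: C_def psi_notin)

lemma absA_zeroA [simp]: "absA m zeroA = 0"
  by (simp add: absA_def zeroA_def)

lemma absA_pdmon: "absA m (fst b) \<le> Suc (absA m (fst (pdmon m i b)))"
proof (cases "i \<in> I0 m")
  case True
  have "absA m (fst b) = fst b i + (\<Sum>j\<in>I0 m - {i}. fst b j)"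
    and "absA m (fst (pdmon m i b)) = (fst b i - 1) + (\<Sum>j\<in>I0 m - {i}. fst b j)"
    using True by (simp_all add: absA_def pdmon_def sum.remove)
  then show ?thesis by simp
qed (simp add: pdmon_def)

text \<open>The formula differentiates \<open>b\<close> at most twice, so from degree 3 on an even
  variable always survives.\<close>

lemma actC_high:
  assumes "absA m \<alpha> \<ge> 3"
  shows "actC (\<alpha>, u) c k v = 0"
proof -
  have "fst (pdmon m i (\<alpha>, u)) \<noteq> zeroA" for i
    using absA_pdmon[of "(\<alpha>, u)" i] assms by auto
  moreover have "fst (pdmon m j (pdmon m i (\<alpha>, u))) \<noteq> zeroA" for i j
    using absA_pdmon[of "(\<alpha>, u)" i] absA_pdmon[of "pdmon m i (\<alpha>, u)" j] assms by auto
  ultimately show ?thesis by (simp add: actC_def lterm_def rterm_def Let_def)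
qed

text \<open>\<open>dh\<close> of a quadratic even monomial is a linear field: its coefficients have
  no constant term, which kills the first sum, and its matrix acts on the component index. For
  \<open>i = j\<close> the monomial is a divided square, whose derivative \<open>x_i\<close> occurs
  once; hence the condition \<open>i \<noteq> j\<close>.\<close>

lemma actC_quadratic:
  assumes i: "i \<in> I0 m" and j: "j \<in> I0 m" and k: "k \<in> II"
  shows "actC (\<lambda>l. epsA i l + epsA j l, {}) c k v =
    - ((if k = pr i then tau i * C c j v else 0) + (if k = pr j \<and> i \<noteq> j then tau j * C c i v else 0))"
proof -
  let ?b = "(\<lambda>l. epsA i l + epsA j l, {}) :: idx"
  have "absA m (fst ?b) = absA m (epsA i) + absA m (epsA j)" by (simp add: absA_def sum.distrib)
  moreover have "absA m (epsA l) = 1" if "l \<in> I0 m" for l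
    using that unfolding absA_def by (subst sum_single[of _ l]) (auto simp: epsA_def)
  ultimately have "absA m (fst ?b) = 2" using i j by simp
  then have "fst (pdmon m l ?b) \<noteq> zeroA" for l using absA_pdmon[of ?b l] by auto
  then have l0: "lterm ?b c k v l = 0" for l by (simp add: lterm_def)
  have r: "rterm ?b c k v l = (if (k = pr i \<and> l = j) \<or> (k = pr j \<and> l = i) then tau (pr k) * C c l v else 0)"
    if l: "l \<in> II" for l
  proof (cases "pr k = i \<or> pr k = j")
    case False
    then have "k \<noteq> pr i" "k \<noteq> pr j" using i j k by (auto simp: II_iff)
    moreover have "pdcoef m n (pr k) ?b = (0 :: 'a)" using False by (simp add: pdcoef_def epsA_def)
    ultimately show ?thesis by (simp add: rterm_def Let_def)
  next
    case True
    define o' where "o' = (if pr k = i then j else i)"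
    have kI: "pr k \<in> I0 m" using True i j by auto
    have o': "o' \<in> I0 m" using i j by (simp add: o'_def)
    have e1: "pdmon m (pr k) ?b = (epsA o', {})"
      using True kI by (auto simp: pdmon_def o'_def epsA_def fun_eq_iff)
    have e0: "pdcoef m n (pr k) ?b = (1 :: 'a)" using True kI by (auto simp: pdcoef_def epsA_def)
    have e2: "pdcoef m n l (epsA o', {}) = (if l = o' then 1 else 0 :: 'a)"
      using o' by (simp add: pdcoef_def epsA_def)
    have e3: "pdmon m o' (epsA o', {}) = (zeroA, {})"
      using o' by (simp add: pdmon_def epsA_def zeroA_def fun_eq_iff)
    have "rterm ?b c k v l = (if l = o' then tau (pr k) * C c l v else 0)"
      unfolding rterm_def e1 e0 e2 Let_def using e3 by auto
    moreover have "l = o' \<longleftrightarrow> (k = pr i \<and> l = j) \<or> (k = pr j \<and> l = i)"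
      using True i j k by (auto simp: o'_def II_iff)
    ultimately show ?thesis by simp
  qed
  have ij: "i \<in> II" "j \<in> II" using i j by (auto simp: II_iff)
  have "(\<Sum>l\<in>II. rterm ?b c k v l)
    = (\<Sum>l\<in>II. (if l = j then (if k = pr i then tau i * C c j v else 0) else 0)
        + (if l = i then (if k = pr j \<and> i \<noteq> j then tau j * C c i v else 0) else 0))"
    using ij by (intro sum.cong refl) (auto simp: r)
  also have "\<dots> = (if k = pr i then tau i * C c j v else 0) + (if k = pr j \<and> i \<noteq> j then tau j * C c i v else 0)"
    using ij by (simp add: sum.distrib sum.delta)
  finally show ?thesis unfolding actC_def l0 by simp
qed

section \<open>Poisson brackets with special even monomials\<close>

lemma pr_neq: "i \<in> I0 m \<Longrightarrow> pr i \<noteq> i"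
proof
  assume i: "i \<in> I0 m" "pr i = i"
  have "tauI m (pr i) = - tauI m i" using i(1) by (simp add: tau_pr_int II_iff)
  then have "tauI m i = 0" using i(2) by simp
  then show False using tau_square[of i] by simp
qed

lemma tau_nonzero [simp]: "tau i \<noteq> (0 :: 'a)"
  by (auto simp: tauI_def)

lemma tau_pr_I0: "i \<in> I0 m \<Longrightarrow> tau (pr i) = (- tau i :: 'a)"
  by (simp add: tau_pr_int II_iff)

lemma pr_pr_I0 [simp]: "i \<in> I0 m \<Longrightarrow> pr (pr i) = i" and pr_in_I0 [simp]: "i \<in> I0 m \<Longrightarrow> pr i \<in> I0 m"
  by (simp_all add: II_iff)

lemma poicoef_I1_empty: "i \<in> I1 m n \<Longrightarrow> poicoef (\<alpha>, {}) c i = 0"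
  using I1_not_I0 by (simp add: poicoef_def pdcoef_def)

lemma binomA_two:
  assumes "i \<in> I0 m" "j \<in> I0 m" "i \<noteq> j"
  shows "binomA m (zeroA(i := A, j := B)) \<beta> = (A + \<beta> i choose A) * (B + \<beta> j choose B)"
proof -
  let ?f = "\<lambda>l. (zeroA(i := A, j := B)) l + \<beta> l choose (zeroA(i := A, j := B)) l"
  have "prod ?f (I0 m) = prod ?f {i, j}"
    using assms by (intro prod.mono_neutral_right) (auto simp: zeroA_def)
  then show ?thesis unfolding binomA_def using assms(3) by simp
qed

text \<open>The summands at \<open>i\<close> and \<open>pr i\<close> produce the same monomial, so
  one difference of binomial products decides whether \<open>C\<close> is forced to vanish there.
  Where a truncated subtraction in the index would round, both terms of the coefficient are
  zero.\<close>

lemma lhs_pair: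
  assumes i: "i \<in> I0 m"
  shows "lhs (zeroA(i := A, pr i := B), {}) (\<beta>, w) k v =
    tau i * ((if A > 0 \<and> \<beta> (pr i) > 0
        then of_nat ((A - 1 + \<beta> i choose (A - 1)) * (B + (\<beta> (pr i) - 1) choose B)) else 0)
      - (if B > 0 \<and> \<beta> i > 0
        then of_nat ((A + (\<beta> i - 1) choose A) * (B - 1 + \<beta> (pr i) choose (B - 1))) else 0))
    * C (\<beta>(i := A + \<beta> i - 1, pr i := B + \<beta> (pr i) - 1), w) k v"
proof -
  let ?b = "(zeroA(i := A, pr i := B), {}) :: idx" and ?c = "(\<beta>, w) :: idx"
  note ne = pr_neq[OF i]
  have j: "pr i \<in> I0 m" using i by simp
  have "lhs ?b ?c k v = (\<Sum>l\<in>{i, pr i}. poicoef ?b ?c l * C (poimon ?b ?c l) k v)"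
    unfolding lhs_def
  proof (rule sum_supp)
    fix l assume "l \<in> II" "l \<notin> {i, pr i}"
    then have "poicoef ?b ?c l = 0"
      using poicoef_I1_empty[of l] by (auto simp: II_iff poicoef_def pdcoef_def zeroA_def)
    then show "poicoef ?b ?c l * C (poimon ?b ?c l) k v = 0" by simp
  qed (use i j in \<open>auto simp: II_iff\<close>)
  also have "\<dots> = poicoef ?b ?c i * C (poimon ?b ?c i) k v + poicoef ?b ?c (pr i) * C (poimon ?b ?c (pr i)) k v"
    using ne by simp
  also have "poicoef ?b ?c i * C (poimon ?b ?c i) k v =
      tau i * (if A > 0 \<and> \<beta> (pr i) > 0
        then of_nat ((A - 1 + \<beta> i choose (A - 1)) * (B + (\<beta> (pr i) - 1) choose B)) else 0)
      * C (\<beta>(i := A + \<beta> i - 1, pr i := B + \<beta> (pr i) - 1), w) k v"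
  proof (cases "A > 0 \<and> \<beta> (pr i) > 0")
    case True
    have e: "pdmon m i ?b = (zeroA(i := A - 1, pr i := B), {})"
      using i ne by (auto simp: pdmon_def fun_eq_iff)
    have "poimon ?b ?c i = (\<beta>(i := A + \<beta> i - 1, pr i := B + \<beta> (pr i) - 1), w)"
      unfolding poimon_def e using True i ne by (auto simp: badd_def pdmon_def zeroA_def fun_eq_iff)
    moreover have "poicoef ?b ?c i = tau i * of_nat ((A - 1 + \<beta> i choose (A - 1)) * (B + (\<beta> (pr i) - 1) choose B))"
      unfolding poicoef_def e using True i ne
      by (simp add: pdcoef_def moncoef_def binomA_two pdmon_def)
    ultimately show ?thesis using True by simp
  next
    case False
    then have "poicoef ?b ?c i = 0" using i ne by (auto simp: poicoef_def pdcoef_def)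
    then show ?thesis using False by auto
  qed
  also have "poicoef ?b ?c (pr i) * C (poimon ?b ?c (pr i)) k v =
      - tau i * (if B > 0 \<and> \<beta> i > 0
        then of_nat ((A + (\<beta> i - 1) choose A) * (B - 1 + \<beta> (pr i) choose (B - 1))) else 0)
      * C (\<beta>(i := A + \<beta> i - 1, pr i := B + \<beta> (pr i) - 1), w) k v"
  proof (cases "B > 0 \<and> \<beta> i > 0")
    case True
    have e: "pdmon m (pr i) ?b = (zeroA(i := A, pr i := B - 1), {})"
      using i ne by (auto simp: pdmon_def fun_eq_iff)
    have "poimon ?b ?c (pr i) = (\<beta>(i := A + \<beta> i - 1, pr i := B + \<beta> (pr i) - 1), w)"
      unfolding poimon_def e using True i ne by (auto simp: badd_def pdmon_def zeroA_def fun_eq_iff)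
    moreover have "poicoef ?b ?c (pr i) = - tau i * of_nat ((A + (\<beta> i - 1) choose A) * (B - 1 + \<beta> (pr i) choose (B - 1)))"
      unfolding poicoef_def e using True i ne
      by (simp add: pdcoef_def moncoef_def binomA_two pdmon_def tau_pr_I0)
    ultimately show ?thesis using True by simp
  next
    case False
    then have "poicoef ?b ?c (pr i) = 0" using i ne by (auto simp: poicoef_def pdcoef_def)
    then show ?thesis using False by auto
  qed
  finally show ?thesis
    by (simp only: right_diff_distrib left_diff_distrib mult_minus_left add_uminus_conv_diff)
qed

text \<open>The bracket that links two different symplectic pairs. Its two summands are different
  monomials, so applications first dispose of one of them.\<close>

lemma lhs_mixed:
  assumes i: "i \<in> I0 m" and a: "a \<in> I0 m" and ne: "a \<noteq> i" "a \<noteq> pr i"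
  shows "lhs (zeroA(a := 1, i := A), {}) (\<beta>, w) k v =
    tau a * (if \<beta> (pr a) > 0 then of_nat (A + \<beta> i choose A) else 0)
      * C (\<beta>(pr a := \<beta> (pr a) - 1, i := A + \<beta> i), w) k v
    + tau i * (if A > 0 \<and> \<beta> (pr i) > 0 then of_nat ((1 + \<beta> a) * (A - 1 + \<beta> i choose (A - 1))) else 0)
      * C (\<beta>(pr i := \<beta> (pr i) - 1, a := 1 + \<beta> a, i := A - 1 + \<beta> i), w) k v"
proof -
  let ?b = "(zeroA(a := 1, i := A), {}) :: idx" and ?c = "(\<beta>, w) :: idx"
  have ne': "pr a \<noteq> i" "pr a \<noteq> a" "pr i \<noteq> i" "pr i \<noteq> a"
    using pr_neq i a ne pr_pr_I0[OF a] by auto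
  have "lhs ?b ?c k v = (\<Sum>l\<in>{a, i}. poicoef ?b ?c l * C (poimon ?b ?c l) k v)"
    unfolding lhs_def
  proof (rule sum_supp)
    fix l assume "l \<in> II" "l \<notin> {a, i}"
    then have "poicoef ?b ?c l = 0"
      using poicoef_I1_empty[of l] by (auto simp: II_iff poicoef_def pdcoef_def zeroA_def)
    then show "poicoef ?b ?c l * C (poimon ?b ?c l) k v = 0" by simp
  qed (use i a in \<open>auto simp: II_iff\<close>)
  also have "\<dots> = poicoef ?b ?c a * C (poimon ?b ?c a) k v + poicoef ?b ?c i * C (poimon ?b ?c i) k v"
    using ne by simp
  also have "poicoef ?b ?c a * C (poimon ?b ?c a) k v =
      tau a * (if \<beta> (pr a) > 0 then of_nat (A + \<beta> i choose A) else 0)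
      * C (\<beta>(pr a := \<beta> (pr a) - 1, i := A + \<beta> i), w) k v"
  proof -
    have e: "pdmon m a ?b = (zeroA(a := 0, i := A), {})"
      using a ne by (auto simp: pdmon_def fun_eq_iff zeroA_def)
    have "poimon ?b ?c a = (\<beta>(pr a := \<beta> (pr a) - 1, i := A + \<beta> i), w)"
      unfolding poimon_def e using i a ne ne' by (auto simp: badd_def pdmon_def zeroA_def fun_eq_iff)
    moreover have "poicoef ?b ?c a = tau a * (if \<beta> (pr a) > 0 then of_nat (A + \<beta> i choose A) else 0)"
      unfolding poicoef_def e using i a ne ne'
      by (simp add: pdcoef_def moncoef_def binomA_two pdmon_def)
    ultimately show ?thesis by simp
  qed
  also have "poicoef ?b ?c i * C (poimon ?b ?c i) k v =
      tau i * (if A > 0 \<and> \<beta> (pr i) > 0 then of_nat ((1 + \<beta> a) * (A - 1 + \<beta> i choose (A - 1))) else 0)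
      * C (\<beta>(pr i := \<beta> (pr i) - 1, a := 1 + \<beta> a, i := A - 1 + \<beta> i), w) k v"
  proof -
    have e: "pdmon m i ?b = (zeroA(a := 1, i := A - 1), {})"
      using i ne by (auto simp: pdmon_def fun_eq_iff zeroA_def)
    have "poimon ?b ?c i = (\<beta>(pr i := \<beta> (pr i) - 1, a := 1 + \<beta> a, i := A - 1 + \<beta> i), w)"
      unfolding poimon_def e using i a ne ne' by (auto simp: badd_def pdmon_def zeroA_def fun_eq_iff)
    moreover have "poicoef ?b ?c i
        = tau i * (if A > 0 \<and> \<beta> (pr i) > 0 then of_nat ((1 + \<beta> a) * (A - 1 + \<beta> i choose (A - 1))) else 0)"
      unfolding poicoef_def e using i a ne ne'
      by (simp add: pdcoef_def moncoef_def binomA_two pdmon_def)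
    ultimately show ?thesis by simp
  qed
  finally show ?thesis .
qed

end

section \<open>Orthogonal invariants\<close>

lemma sgnUV_remove: "i \<in> w \<Longrightarrow> sgnUV {i} w = (sgnUV {i} (w - {i}) :: 'a::field)"
  using sgnUV_insert_self[of i "w - {i}"] by (simp add: insert_absorb)

lemma sgnUV_self [simp]: "sgnUV {i} {i} = (1 :: 'a::field)"
  using sgnUV_insert_self[of i "{}"] by simp

lemma sgnUV_pair:
  fixes x y :: nat
  assumes "x < y"
  shows "sgnUV {x} {x, y} = (1 :: 'a::field)" "sgnUV {y} {x, y} = (-1 :: 'a)"
proof -
  have s: "{j \<in> {x, y}. j < x} = {}" "{j \<in> {x, y}. j < y} = {x}" using assms by auto
  show "sgnUV {x} {x, y} = (1 :: 'a)" "sgnUV {y} {x, y} = (-1 :: 'a)"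
    unfolding sgnUV_singleton_left s by simp_all
qed

context hderiv
begin

text \<open>The odd index without a partner, fixed by \<open>pr\<close>. It carries torus weight
  zero and is the largest index, which keeps the signs simple.\<close>

abbreviation "kap \<equiv> m + n"

lemma kap_I1: "kap \<in> I1 m n"
  using n_odd by (cases n) (auto simp: I1_def)

lemma pr_kap: "pr kap = kap"
proof -
  have "kap \<in> II" using kap_I1 by (simp add: II_iff)
  then show ?thesis
  proof (cases rule: pr_cases)
    case 1
    then show ?thesis using n_odd by (cases n) auto
  next
    case 2
    then show ?thesis using n_odd by (cases n) auto
  next
    case 3
    then have "n \<le> n div 2" by linarith
    then show ?thesis using n_odd by (cases n) auto
  qed auto
qed

lemma I1_facts:
  assumes "a \<in> I1 m n"
  shows "a \<in> II" "a \<notin> I0 m" "a \<le> kap" "pr a \<in> I1 m n" "pr a \<notin> I0 m" "pr (pr a) = a" "mu a = 1" "tauI m a = 1"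
    "pr a = kap \<longleftrightarrow> a = kap"
proof -
  show a: "a \<in> II" using assms by (simp add: II_iff)
  show "a \<notin> I0 m" using assms by (rule I1_not_I0)
  show "a \<le> kap" using assms by (simp add: I1_def)
  show "pr a \<in> I1 m n" using assms a by simp
  then show "pr a \<notin> I0 m" by (rule I1_not_I0)
  show "pr (pr a) = a" using a by simp
  then show "pr a = kap \<longleftrightarrow> a = kap" using pr_kap by metis
  show "mu a = 1" using \<open>a \<notin> I0 m\<close> by (simp add: muI_def)
  show "tauI m a = 1" using assms by (auto simp: I1_def tauI_def)
qed

lemma pr_neq_I1: "a \<in> I1 m n \<Longrightarrow> a \<noteq> kap \<Longrightarrow> pr a \<noteq> a"
proof -
  assume a: "a \<in> I1 m n" "a \<noteq> kap"
  then have "a \<in> II" by (simp add: II_iff)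
  then show ?thesis
    by (cases rule: pr_cases) (use a in \<open>auto simp: I1_def\<close>)
qed

lemma pr_inj: "a \<in> II \<Longrightarrow> b \<in> II \<Longrightarrow> pr a = pr b \<longleftrightarrow> a = b"
  by (metis pr_involution)

lemma HI_pair: "(\<alpha>, {}) \<in> BB \<Longrightarrow> x \<in> I1 m n \<Longrightarrow> y \<in> I1 m n \<Longrightarrow> x \<noteq> y \<Longrightarrow> (\<alpha>, {x, y}) \<in> HI"
  by (auto simp: HI_iff in_BB_iff)

lemma zdO_zeroA: "zdO m (zeroA, u) = int (card u)"
  by (simp add: zdO_def)

lemma actC_psi0:
  assumes "b \<in> HI" "c \<in> HI" "v \<subseteq> I1 m n" "k \<in> II" "psi c = wzero"
  shows "actC b c k v = 0"
proof -
  have "act b c k (zeroA, v) = 0"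
    unfolding act_def assms(5) wzero_def by simp
  then show ?thesis using act_const[OF assms(1-4)] by (simp add: actC_def)
qed

text \<open>The kernel of a derivation is closed under brackets; this is that fact at constant
  terms.\<close>

lemma relation_psi0:
  assumes "b \<in> HI" "c \<in> HI" "psi b = wzero" "psi c = wzero" "v \<subseteq> I1 m n" "k \<in> II"
  shows "lhs b c k v = 0"
  using relation[OF assms(1,2,5,6)] actC_psi0[OF assms(1,2,5,6,4)] actC_psi0[OF assms(2,1,5,6,3)] by simp

text \<open>By \<open>psi_C\<close> the coefficients of \<open>psi (\<alpha>, u)\<close> are
  constant terms at smaller even exponents with the same odd part.\<close>

lemma psi_zeroI:
  assumes c: "(\<alpha>, u) \<in> HI" and z: "\<And>\<beta> k v. (\<And>i. \<beta> i \<le> \<alpha> i) \<Longrightarrow> C (\<beta>, u) k v = 0"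
  shows "psi (\<alpha>, u) = wzero"
proof (intro ext)
  fix k and d :: idx
  obtain \<gamma> v where d: "d = (\<gamma>, v)" by fastforce
  have "psi (\<alpha>, u) k d = 0"
  proof (cases "d \<in> BB")
    case True
    then show ?thesis using psi_C[OF c, of \<gamma> v k] z[of "\<lambda>i. \<alpha> i - \<gamma> i" k v] d by simp
  next
    case False
    then show ?thesis using psi_nonzero[OF c] by blast
  qed
  then show "psi (\<alpha>, u) k d = wzero k d" by (simp add: wzero_def)
qed

lemma psi0_C: "psi b = wzero \<Longrightarrow> C b k v = 0"
  by (simp add: C_def wzero_def)

section \<open>The action of so(n) on constant terms\<close>

lemma psi_so: "x \<in> I1 m n \<Longrightarrow> y \<in> I1 m n \<Longrightarrow> x \<noteq> y \<Longrightarrow> psi (zeroA, {x, y}) = wzero"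
  by (rule psi_low_degree) (auto simp: zdO_zeroA intro!: HI_pair)

text \<open>The constant term of \<open>x_z \<partial>_i\<close> applied to component
  \<open>k\<close> of \<open>psi c\<close>; with odd \<open>i\<close> and \<open>z\<close> these
  operators make up the rotations in so(n).\<close>

definition Lop :: "idx \<Rightarrow> nat \<Rightarrow> nat set \<Rightarrow> nat \<Rightarrow> nat \<Rightarrow> 'a" where
  "Lop c k v i z = (if z \<in> v then sgnUV {z} (v - {z}) * dC i c k (v - {z}) else 0)"

text \<open>\<open>dh\<close> of \<open>x_x x_y\<close> is the rotation
  \<open>x_y \<partial>_(pr x) - x_x \<partial>_(pr y)\<close>. The \<open>Lop\<close> terms are its
  action on coefficients, the last two its action on the component index.\<close>

lemma actC_so:
  assumes x: "x \<in> I1 m n" and y: "y \<in> I1 m n" and xy: "x < y" and k: "k \<in> II"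
  shows "actC (zeroA, {x, y}) c k v = Lop c k v (pr x) y - Lop c k v (pr y) x
    - ((if k = pr x then C c y v else 0) - (if k = pr y then C c x v else 0))"
proof -
  let ?b = "(zeroA, {x, y}) :: idx"
  note fx = I1_facts[OF x] and fy = I1_facts[OF y]
  have pdc: "pdcoef m n l ?b = (if l = x then 1 else if l = y then -1 else 0 :: 'a)" for l
    using x y fx fy sgnUV_pair[OF xy, where ?'a = 'a] by (simp add: pdcoef_def zeroA_def)
  have pdm: "pdmon m x ?b = (zeroA, {y})" "pdmon m y ?b = (zeroA, {x})"
    using fx fy xy by (auto simp: pdmon_def)
  have pd1: "pdcoef m n l (zeroA, {z}) = (if l = z then 1 else 0 :: 'a)" "pdmon m z (zeroA, {z}) = (zeroA, {})"
    if "z \<in> I1 m n" for l z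
    using that I1_facts(2)[OF that] by (auto simp: pdcoef_def pdmon_def zeroA_def)
  have ne: "pr x \<noteq> pr y" using pr_inj[OF fx(1) fy(1)] xy by simp
  have lt: "lterm ?b c k v l = (if l = pr x then Lop c k v (pr x) y else 0) - (if l = pr y then Lop c k v (pr y) x else 0)"
    if l: "l \<in> II" for l
  proof -
    consider "l = pr x" | "l = pr y" | "l \<noteq> pr x" "l \<noteq> pr y" by blast
    then show ?thesis
    proof cases
      case 1
      then show ?thesis using ne fx pdc[of x] pdm by (simp add: lterm_def Lop_def)
    next
      case 2
      then show ?thesis using ne fy pdc[of y] pdm xy by (simp add: lterm_def Lop_def)
    next
      case 3
      then have "pr l \<noteq> x" "pr l \<noteq> y" using pr_involution[OF l] by auto
      then show ?thesis using 3 pdc by (simp add: lterm_def)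
    qed
  qed
  have rt: "rterm ?b c k v l = (if l = y then (if k = pr x then C c y v else 0) else 0)
      - (if l = x then (if k = pr y then C c x v else 0) else 0)" for l
  proof -
    consider "k = pr x" | "k = pr y" | "k \<noteq> pr x" "k \<noteq> pr y" by blast
    then show ?thesis
    proof cases
      case 1
      then show ?thesis using ne fx fy pdc[of x] pdm pd1[OF y] xy by (simp add: rterm_def Let_def)
    next
      case 2
      then show ?thesis using ne fy fx pdc[of y] pdm pd1[OF x] xy by (simp add: rterm_def Let_def)
    next
      case 3
      then have "pr k \<noteq> x" "pr k \<noteq> y" using pr_involution[OF k] by auto
      then show ?thesis using 3 pdc by (simp add: rterm_def Let_def)
    qed
  qed
  show ?thesis
    unfolding actC_def using fx fy
    by (simp add: lt rt sum_subtractf sum.delta cong: sum.cong)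
qed

lemma Lop_same:
  assumes "i \<in> I1 m n"
  shows "Lop c k v i i = of_bool (i \<in> v) * C c k v"
  using I1_facts(2)[OF assms] by (simp add: Lop_def dC_def insert_absorb)

text \<open>The torus element \<open>x_a x_(pr a)\<close> acts on \<open>x^w\<close> by its weight.
  An extra factor \<open>x^\<alpha>\<close> is tolerated when \<open>w\<close> meets the pair,
  because the terms with even derivatives then repeat an odd variable.\<close>

lemma lhs_torus:
  assumes a: "a \<in> I1 m n" and lt: "a < pr a" and w: "w \<subseteq> I1 m n" and cond: "\<alpha> = zeroA \<or> a \<in> w \<or> pr a \<in> w"
  shows "lhs (\<alpha>, {a, pr a}) (\<beta>, w) k v =
    (of_bool (pr a \<in> w) - of_bool (a \<in> w)) * of_nat (binomA m \<alpha> \<beta>) * C (\<lambda>i. \<alpha> i + \<beta> i, w) k v"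
proof -
  let ?b = "(\<alpha>, {a, pr a}) :: idx" and ?c = "(\<beta>, w) :: idx"
  note f = I1_facts[OF a]
  have "lhs ?b ?c k v = (\<Sum>l\<in>{a, pr a}. poicoef ?b ?c l * C (poimon ?b ?c l) k v)"
    unfolding lhs_def
  proof (rule sum_supp)
    fix l assume l: "l \<in> II" "l \<notin> {a, pr a}"
    have "poicoef ?b ?c l = 0"
    proof (cases "l \<in> I0 m")
      case True
      then show ?thesis using cond
        by (elim disjE) (auto simp: poicoef_def pdcoef_def moncoef_def pdmon_def zeroA_def)
    qed (use l in \<open>auto simp: poicoef_def pdcoef_def\<close>)
    then show "poicoef ?b ?c l * C (poimon ?b ?c l) k v = 0" by simp
  qed (use f in \<open>auto simp: II_iff\<close>)
  also have "\<dots> = poicoef ?b ?c a * C (poimon ?b ?c a) k v + poicoef ?b ?c (pr a) * C (poimon ?b ?c (pr a)) k v"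
    using lt by simp
  also have "poicoef ?b ?c a * C (poimon ?b ?c a) k v
      = of_bool (pr a \<in> w) * of_nat (binomA m \<alpha> \<beta>) * C (\<lambda>i. \<alpha> i + \<beta> i, w) k v"
  proof (cases "pr a \<in> w")
    case True
    have e: "pdmon m a ?b = (\<alpha>, {pr a})" "pdmon m (pr a) ?c = (\<beta>, w - {pr a})"
      using f lt by (auto simp: pdmon_def)
    have "poimon ?b ?c a = (\<lambda>i. \<alpha> i + \<beta> i, w)"
      using True unfolding poimon_def e by (auto simp: badd_def)
    moreover have "poicoef ?b ?c a = of_nat (binomA m \<alpha> \<beta>)"
      using True f a sgnUV_pair[OF lt, where ?'a = 'a] sgnUV_remove[OF True, where ?'a = 'a]
      unfolding poicoef_def e by (simp add: pdcoef_def moncoef_def)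
    ultimately show ?thesis using True by simp
  qed (use f in \<open>simp add: poicoef_def pdcoef_def\<close>)
  also have "poicoef ?b ?c (pr a) * C (poimon ?b ?c (pr a)) k v
      = - (of_bool (a \<in> w) * of_nat (binomA m \<alpha> \<beta>) * C (\<lambda>i. \<alpha> i + \<beta> i, w) k v)"
  proof (cases "a \<in> w")
    case True
    have e: "pdmon m (pr a) ?b = (\<alpha>, {a})" "pdmon m (pr (pr a)) ?c = (\<beta>, w - {a})"
      using f lt by (auto simp: pdmon_def)
    have "poimon ?b ?c (pr a) = (\<lambda>i. \<alpha> i + \<beta> i, w)"
      using True unfolding poimon_def e by (auto simp: badd_def)
    moreover have "poicoef ?b ?c (pr a) = - of_nat (binomA m \<alpha> \<beta>)"
      using True f a sgnUV_pair[OF lt, where ?'a = 'a] sgnUV_remove[OF True, where ?'a = 'a] I1_facts(8)[OF f(4)]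
      unfolding poicoef_def e by (simp add: pdcoef_def moncoef_def)
    ultimately show ?thesis using True by simp
  qed (use f in \<open>simp add: poicoef_def pdcoef_def\<close>)
  finally show ?thesis by (simp add: algebra_simps)
qed

text \<open>The weights compared below are integers of absolute value at most 3, so
  \<open>p > 3\<close> allows an equation in the field to be read in the integers.\<close>

lemma small_int:
  assumes "of_int z * x = (0 :: 'a)" "x \<noteq> 0" "\<bar>z\<bar> \<le> 3"
  shows "z = 0"
proof (rule ccontr)
  assume "z \<noteq> 0"
  have "of_int z = (0 :: 'a)" using assms(1,2) by simp
  then have "int p dvd z" by (simp add: of_int_eq_0_iff_char_dvd char_p)
  then have "\<bar>int p\<bar> \<le> \<bar>z\<bar>" by (rule dvd_imp_le_int[OF \<open>z \<noteq> 0\<close>])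
  then show False using p_gt assms(3) by simp
qed

text \<open>\<open>psi\<close> kills the torus of so(n) and hence preserves its weights. A component
  \<open>k\<close> counts with the weight opposite to that of \<open>x_k\<close>, which accounts for
  the terms in \<open>k\<close>.\<close>

lemma torus_weight:
  assumes c: "(\<beta>, w) \<in> HI" and nz: "C (\<beta>, w) k v \<noteq> 0" and a: "a \<in> I1 m n" "a \<noteq> kap"
  shows "of_bool (pr a \<in> w) - of_bool (a \<in> w)
    = (of_bool (pr a \<in> v) - of_bool (a \<in> v) - of_bool (k = pr a) + of_bool (k = a) :: int)"
proof -
  have k: "k \<in> II" and v: "v \<subseteq> I1 m n" using C_nonzero[OF c nz] by auto
  have w: "w \<subseteq> I1 m n" using c by (simp add: HI_iff in_BB_iff)
  have *: "of_bool (pr a \<in> w) - of_bool (a \<in> w)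
    = (of_bool (pr a \<in> v) - of_bool (a \<in> v) - of_bool (k = pr a) + of_bool (k = a) :: int)"
    if a: "a \<in> I1 m n" and lt: "a < pr a" for a
  proof -
    note f = I1_facts[OF a]
    let ?b = "(zeroA, {a, pr a}) :: idx"
    have b: "?b \<in> HI" by (rule HI_pair) (use a f lt in auto)
    have A: "actC (\<beta>, w) ?b k v = 0"
      by (rule actC_psi0[OF c b v k psi_so]) (use a f lt in auto)
    have B: "actC ?b (\<beta>, w) k v
        = (of_bool (pr a \<in> v) - of_bool (a \<in> v) - of_bool (k = pr a) + of_bool (k = a)) * C (\<beta>, w) k v"
      using actC_so[OF a f(4) lt k, of "(\<beta>, w)" v] f(6) Lop_same[OF a] Lop_same[OF f(4)] lt
      by (cases "k = a"; cases "k = pr a") (simp_all add: algebra_simps)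
    have L: "lhs ?b (\<beta>, w) k v = (of_bool (pr a \<in> w) - of_bool (a \<in> w)) * C (\<beta>, w) k v"
      using lhs_torus[OF a lt w, of zeroA \<beta> k v] by (simp add: binomA_zeroA) (simp add: zeroA_def)
    have gen: "(x - y) * z = 0" if "x * z = y * z - 0" for x y z :: 'a
      using that by (simp add: left_diff_distrib)
    have "of_int (of_bool (pr a \<in> w) - of_bool (a \<in> w)
      - (of_bool (pr a \<in> v) - of_bool (a \<in> v) - of_bool (k = pr a) + of_bool (k = a))) * C (\<beta>, w) k v = 0"
      unfolding of_int_diff of_int_add of_int_of_bool
      by (rule gen) (rule relation[OF b c v k, unfolded A B L])
    from small_int[OF this nz] show ?thesis by auto
  qed
  note f = I1_facts[OF a(1)]
  show ?thesis
  proof (cases "a < pr a")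
    case False
    then have "pr a < pr (pr a)" using pr_neq_I1[OF a] f(6) by simp
    from *[OF f(4) this] show ?thesis unfolding f(6) by linarith
  qed (rule *[OF a(1)])
qed

text \<open>Away from \<open>kap\<close> the involution \<open>pr\<close> has no fixed point.
  Combined with the parity of \<open>W1\<close> this decides whether \<open>kap\<close> belongs to a
  set, which torus weights cannot do.\<close>

lemma even_card_symmetric:
  assumes v: "v \<subseteq> I1 m n" "kap \<notin> v" and sym: "\<And>a. a \<in> I1 m n \<Longrightarrow> a \<noteq> kap \<Longrightarrow> a \<in> v \<Longrightarrow> pr a \<in> v"
  shows "even (card v)"
proof -
  let ?L = "{a\<in>v. a < pr a}" and ?R = "{a\<in>v. pr a < a}"
  have fin: "finite v" using v finite_sub_I1 by blast
  have ne: "a \<noteq> kap \<and> pr a \<noteq> a \<and> pr a \<in> v \<and> pr (pr a) = a" if "a \<in> v" for a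
    using that v sym[of a] pr_neq_I1[of a] I1_facts(6)[of a] by auto
  have "bij_betw pr ?L ?R"
    by (rule bij_betw_byWitness[of _ pr]) (use ne in auto)
  then have "card ?L = card ?R" by (rule bij_betw_same_card)
  moreover have "v = ?L \<union> ?R" using ne by (auto simp: neq_iff)
  moreover have "card (?L \<union> ?R) = card ?L + card ?R"
    by (rule card_Un_disjoint) (use fin in auto)
  ultimately have "card v = card ?R + card ?R" by (simp only:)
  then show ?thesis by simp
qed

lemma lhs_zeroA_empty: "lhs (zeroA, u) (\<beta>, {}) k v = 0"
  unfolding lhs_def
proof (intro sum.neutral ballI)
  fix i assume "i \<in> II"
  then have "poicoef (zeroA, u) (\<beta>, {}) i = 0"
    using pr_I0[of i] by (cases "i \<in> I0 m") (auto simp: poicoef_def pdcoef_def zeroA_def II_iff)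
  then show "poicoef (zeroA, u) (\<beta>, {}) i * C (poimon (zeroA, u) (\<beta>, {}) i) k v = 0" by simp
qed

text \<open>Purely odd rotations commute with the purely even monomial \<open>x^\<beta>\<close>, so
  its image is invariant. The rotations through \<open>kap\<close> supply what the torus leaves
  open.\<close>

lemma X_relation:
  assumes c: "(\<beta>, {}) \<in> HI" and a: "a \<in> I1 m n" "a \<noteq> kap" and k: "k \<in> II" and v: "v \<subseteq> I1 m n"
  shows "Lop (\<beta>, {}) k v (pr a) kap - Lop (\<beta>, {}) k v kap a
    - (if k = pr a then C (\<beta>, {}) kap v else 0) + (if k = kap then C (\<beta>, {}) a v else 0) = 0"
proof -
  have lt: "a < kap" using I1_facts(3)[OF a(1)] a(2) by simp
  let ?b = "(zeroA, {a, kap}) :: idx"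
  have b: "?b \<in> HI" by (rule HI_pair) (use a kap_I1 in auto)
  have "actC (\<beta>, {}) ?b k v = 0"
    by (rule actC_psi0[OF c b v k psi_so]) (use a kap_I1 in auto)
  then show ?thesis
    using relation[OF b c v k] lhs_zeroA_empty actC_so[OF a(1) kap_I1 lt k, of "(\<beta>, {})" v]
    by (simp add: pr_kap algebra_simps)
qed

text \<open>Weights make \<open>v\<close> symmetric under \<open>pr\<close> up to the component
  index, and parity settles the membership of \<open>kap\<close>. Rotations between
  \<open>kap\<close> and a supposedly missing index then show that nothing else is missing.\<close>

lemma C_empty_support:
  assumes c: "(\<beta>, {}) \<in> HI" and nz: "C (\<beta>, {}) k v \<noteq> 0"
  shows "(k \<in> I0 m \<and> v = I1 m n) \<or> (k \<in> I1 m n \<and> v = I1 m n - {pr k})"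
proof -
  have k: "k \<in> II" and v: "v \<subseteq> I1 m n" and par: "odd (card v + mu k)" using C_nonzero[OF c nz] by auto
  have fin: "finite v" using v finite_sub_I1 by blast
  have wt: "of_bool (pr a \<in> v) - of_bool (a \<in> v) - of_bool (k = pr a) + of_bool (k = a) = (0 :: int)"
    if "a \<in> I1 m n" "a \<noteq> kap" for a
    using torus_weight[OF c nz that] by simp
  consider "k \<in> I0 m" | "k = kap" | "k \<in> I1 m n" "k \<noteq> kap" using k by (auto simp: II_iff)
  then show ?thesis
  proof cases
    case 1
    have sym: "pr a \<in> v \<longleftrightarrow> a \<in> v" if "a \<in> I1 m n" "a \<noteq> kap" for a
      using wt[OF that] I1_facts(2,5)[OF that(1)] 1 by (auto simp: of_bool_def split: if_splits)
    have kv: "kap \<in> v"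
      using even_card_symmetric[OF v] sym par 1 by (auto simp: muI_def)
    have "a \<in> v" if a: "a \<in> I1 m n" for a
    proof (rule ccontr)
      assume "a \<notin> v"
      then have ak: "a \<noteq> kap" using kv by auto
      note f = I1_facts[OF a]
      \<comment> \<open>At the set with \<open>kap\<close> exchanged for the missing
        \<open>a\<close>, only the operator \<open>x_a \<partial>_kap\<close> contributes, and it
        returns the coefficient at \<open>v\<close> itself.\<close>
      let ?v = "insert a (v - {kap})"
      have "?v \<subseteq> I1 m n" using v a by auto
      from X_relation[OF c a ak k this]
      have "Lop (\<beta>, {}) k ?v kap a = 0"
        using 1 f kap_I1 I1_not_I0 ak by (auto simp: Lop_def split: if_splits)
      moreover have "?v - {a} = v - {kap}" using \<open>a \<notin> v\<close> by auto
      ultimately have "C (\<beta>, {}) k (insert kap (v - {kap})) = 0"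
        using I1_facts(2)[OF kap_I1] by (simp add: Lop_def dC_def)
      then show False using nz kv by (simp add: insert_absorb)
    qed
    then show ?thesis using 1 v by blast
  next
    case 2
    have sym: "pr a \<in> v \<longleftrightarrow> a \<in> v" if "a \<in> I1 m n" "a \<noteq> kap" for a
      using wt[OF that] I1_facts(9)[OF that(1)] that 2 by (auto simp: of_bool_def split: if_splits)
    have "even (card v)" using par 2 I1_facts(7)[OF kap_I1] by simp
    have kv: "kap \<notin> v"
    proof
      assume "kap \<in> v"
      moreover have "even (card (v - {kap}))"
      proof (rule even_card_symmetric)
        fix a assume a: "a \<in> I1 m n" "a \<noteq> kap" "a \<in> v - {kap}"
        then show "pr a \<in> v - {kap}" using sym[OF a(1,2)] I1_facts(9)[OF a(1)] by blast
      qed (use v in auto)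
      ultimately show False
        using \<open>even (card v)\<close> card.remove[OF fin \<open>kap \<in> v\<close>] by (metis even_Suc)
    qed
    have "a \<in> v" if a: "a \<in> I1 m n" "a \<noteq> kap" for a
    proof (rule ccontr)
      assume "a \<notin> v"
      note f = I1_facts[OF a(1)]
      have "pr a \<in> II" using f(4) by (simp add: II_iff)
      \<comment> \<open>In component \<open>pr a\<close> both operator terms vanish, since neither
        \<open>a\<close> nor \<open>kap\<close> lies in \<open>v\<close>. What remains is the
        rotated component index, that is, the value at component \<open>kap\<close>.\<close>
      from X_relation[OF c a this v]
      have "C (\<beta>, {}) kap v = 0"
        using \<open>a \<notin> v\<close> kv f a by (auto simp: Lop_def split: if_splits)
      then show False using nz 2 by simp
    qed
    then show ?thesis using 2 v kv kap_I1 pr_kap by auto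
  next
    case 3
    note fk = I1_facts[OF 3(1)]
    have ke: "even (card v)" using par fk by simp
    have kv: "k \<in> v" "pr k \<notin> v" using wt[OF 3] pr_neq_I1[OF 3] by (auto simp: of_bool_def split: if_splits)
    have sym: "pr a \<in> v \<longleftrightarrow> a \<in> v" if "a \<in> I1 m n" "a \<noteq> kap" "a \<noteq> k" "a \<noteq> pr k" for a
      using wt[OF that(1,2)] that I1_facts(6)[OF that(1)] by (auto simp: of_bool_def split: if_splits)
    \<comment> \<open>The weights put \<open>k\<close> but not \<open>pr k\<close> into
      \<open>v\<close>, so without \<open>kap\<close> the set \<open>v\<close> would consist of
      \<open>k\<close> and a symmetric set, and its size would be odd.\<close>
    have kapv: "kap \<in> v"
    proof (rule ccontr)
      assume "kap \<notin> v"
      have "even (card (v - {k}))"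
      proof (rule even_card_symmetric)
        fix a assume a: "a \<in> I1 m n" "a \<noteq> kap" "a \<in> v - {k}"
        then have "a \<noteq> pr k" using kv by auto
        then show "pr a \<in> v - {k}" using sym[of a] a I1_facts(6)[OF a(1)] by auto
      qed (use v \<open>kap \<notin> v\<close> in auto)
      then show False using ke card.remove[OF fin kv(1)] by (metis even_Suc)
    qed
    have "a \<in> v" if a: "a \<in> I1 m n" "a \<noteq> pr k" for a
    proof (rule ccontr)
      assume av: "a \<notin> v"
      then have ak: "a \<noteq> kap" "a \<noteq> k" using kapv kv by auto
      note f = I1_facts[OF a(1)]
      have prk: "pr a \<noteq> k" using a f(6) by auto
      let ?v = "insert a (v - {kap})"
      have "?v \<subseteq> I1 m n" using v a by auto
      from X_relation[OF c a(1) ak(1) k this]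
      have "Lop (\<beta>, {}) k ?v kap a = 0"
        using 3 f prk ak by (auto simp: Lop_def split: if_splits)
      moreover have "?v - {a} = v - {kap}" using av by auto
      ultimately have "C (\<beta>, {}) k (insert kap (v - {kap})) = 0"
        using I1_facts(2)[OF kap_I1] by (simp add: Lop_def dC_def)
      then show False using nz kapv by (simp add: insert_absorb)
    qed
    then have "v = I1 m n - {pr k}" using v kv by auto
    then show ?thesis using 3 by blast
  qed
qed

lemma sgn_kap:
  assumes "w \<subseteq> I1 m n" "kap \<notin> w"
  shows "sgnUV {kap} w = ((-1) ^ card w :: 'a)" "sgnUV w {kap} = (1 :: 'a)"
proof -
  have lt: "j < kap" if "j \<in> w" for j using assms that by (metis I1_facts(3) le_neq_implies_less subsetD)
  then have s: "{j \<in> w. j < kap} = w" "{j \<in> w. kap < j} = {}" using less_asym by blast+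
  show "sgnUV {kap} w = ((-1) ^ card w :: 'a)" "sgnUV w {kap} = (1 :: 'a)"
    unfolding sgnUV_singleton_left sgnUV_singleton_right s by simp_all
qed

lemma card_I1: "card (I1 m n) = n"
  by (simp add: I1_def)

text \<open>The rotation in the plane of \<open>k\<close> and \<open>kap\<close> ties component
  \<open>k\<close> to component \<open>kap\<close>. The resulting proportions are those of
  \<open>D_H(x^omega)\<close>, so a single scalar is left.\<close>

lemma C_empty_omega:
  assumes c: "(\<beta>, {}) \<in> HI" and k: "k \<in> I1 m n"
  shows "C (\<beta>, {}) k (I1 m n - {pr k}) = sgnUV {pr k} (I1 m n) * C (\<beta>, {}) kap (I1 m n - {kap})"
proof (cases "k = kap")
  case True
  have "sgnUV {kap} (I1 m n) = (1 :: 'a)"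
    using sgn_kap(1)[of "I1 m n - {kap}"] sgnUV_remove[OF kap_I1, where ?'a = 'a] kap_I1 n_odd card_I1
    by (simp add: card_Diff_singleton)
  then show ?thesis by (simp add: True pr_kap)
next
  case False
  note f = I1_facts[OF k]
  let ?v = "I1 m n - {pr k}" and ?w = "I1 m n - {pr k} - {kap}"
  have nek: "pr k \<noteq> kap" using f False by simp
  have "Lop (\<beta>, {}) kap ?v kap k = 0"
    using nek kap_I1 I1_facts(2)[OF kap_I1] False by (simp add: Lop_def dC_def)
  moreover have "Lop (\<beta>, {}) kap ?v (pr k) kap
      = sgnUV {kap} ?w * (sgnUV {pr k} ?w * C (\<beta>, {}) kap (I1 m n - {kap}))"
  proof -
    have "insert (pr k) ?w = I1 m n - {kap}" using f nek by auto
    then show ?thesis using f nek kap_I1 by (simp add: Lop_def dC_def)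
  qed
  moreover have "sgnUV {kap} ?w = (-1 :: 'a)"
  proof -
    have "card (I1 m n) = Suc (card (I1 m n - {pr k}))"
      by (rule card.remove) (use f in auto)
    moreover have "card (I1 m n - {pr k}) = Suc (card ?w)"
      by (rule card.remove) (use kap_I1 nek in auto)
    ultimately have "n = Suc (Suc (card ?w))" unfolding card_I1 by simp
    then have "odd (card ?w)" using n_odd by (metis even_Suc)
    moreover have "?w \<subseteq> I1 m n" "kap \<notin> ?w" by auto
    ultimately show ?thesis using sgn_kap(1)[of ?w] by simp
  qed
  moreover have "sgnUV {pr k} (I1 m n) = (sgnUV {pr k} ?w :: 'a)"
  proof -
    have "pr k < kap" using I1_facts(3)[OF f(4)] nek by simp
    then have "{j \<in> I1 m n. j < pr k} = {j \<in> ?w. j < pr k}" by auto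
    then show ?thesis by (simp add: sgnUV_singleton_left)
  qed
  moreover have "kap \<in> II" using kap_I1 by (simp add: II_iff)
  ultimately show ?thesis
    using X_relation[OF c k False, of kap ?v] nek
    by (auto simp: algebra_simps intro: add_left_imp_eq[of "Lop (\<beta>, {}) kap ?v (pr k) kap"])
qed

section \<open>Vanishing on monomials with odd variables\<close>

lemma p_le_power: "i \<in> I0 m \<Longrightarrow> p \<le> p ^ t i"
  using power_increasing[of 1 "t i" p] t_pos[of i] p_gt by simp

lemma BB_down:
  assumes "(\<alpha>, u) \<in> BB" "\<And>j. \<delta> j \<le> \<alpha> j"
  shows "(\<delta>, u) \<in> BB"
proof -
  have "\<delta> j < p ^ t j" if "j \<in> I0 m" for j
    using assms that by (auto simp: in_BB_iff intro: le_less_trans)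
  moreover have "\<delta> j = 0" if "j \<notin> I0 m" for j
    using assms(1) assms(2)[of j] that by (simp add: in_BB_iff)
  ultimately show ?thesis using assms(1) by (simp add: in_BB_iff)
qed

lemma absA_eps: "i \<in> I0 m \<Longrightarrow> absA m (epsA i) = 1"
  unfolding absA_def by (subst sum_single[of _ i]) (auto simp: epsA_def)

lemma quadratic_HI:
  assumes "i \<in> I0 m" "j \<in> I0 m"
  shows "(\<lambda>l. epsA i l + epsA j l, {}) \<in> HI" "psi (\<lambda>l. epsA i l + epsA j l, {}) = wzero"
proof -
  have "2 < p ^ t l" if "l \<in> I0 m" for l using p_le_power[OF that] p_gt by linarith
  then show *: "(\<lambda>l. epsA i l + epsA j l, {}) \<in> HI"
    using assms p_gt by (auto simp: HI_iff in_BB_iff epsA_def) force+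
  have "absA m (\<lambda>l. epsA i l + epsA j l) = absA m (epsA i) + absA m (epsA j)"
    by (simp add: absA_def sum.distrib)
  then show "psi (\<lambda>l. epsA i l + epsA j l, {}) = wzero"
    using assms by (intro psi_low_degree[OF *]) (simp add: zdO_def absA_eps)
qed

text \<open>\<open>psi\<close> kills quadratic even monomials, so only their matrix action on the
  component index appears on the right.\<close>

lemma quadratic_relation:
  assumes i: "i \<in> I0 m" and j: "j \<in> I0 m" and c: "c \<in> HI" and k: "k \<in> II" and v: "v \<subseteq> I1 m n"
  shows "lhs (\<lambda>l. epsA i l + epsA j l, {}) c k v =
    - ((if k = pr i then tau i * C c j v else 0) + (if k = pr j \<and> i \<noteq> j then tau j * C c i v else 0))"
  using relation[OF quadratic_HI(1)[OF i j] c v k] actC_quadratic[OF i j k, of c v]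
    actC_psi0[OF c quadratic_HI(1)[OF i j] v k quadratic_HI(2)[OF i j]] by simp

text \<open>The root vector \<open>x_i^(2)\<close> raises the exponent at \<open>i\<close> and
  lowers the one at \<open>pr i\<close>; it moves the component index only for
  \<open>k = pr i\<close>.\<close>

lemma sp_square:
  assumes i: "i \<in> I0 m" and c: "(\<beta>, w) \<in> HI" and k: "k \<in> II" and v: "v \<subseteq> I1 m n"
  shows "(if \<beta> (pr i) > 0 then of_nat (\<beta> i + 1) else 0) * C (\<beta>(i := \<beta> i + 1, pr i := \<beta> (pr i) - 1), w) k v
    = (if k = pr i then - C (\<beta>, w) i v else 0)"
proof -
  have e: "(\<lambda>l. epsA i l + epsA i l) = zeroA(i := 2, pr i := 0)"
    using pr_neq[OF i] by (auto simp: epsA_def zeroA_def fun_eq_iff)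
  have L: "lhs (zeroA(i := 2, pr i := 0), {}) (\<beta>, w) k v
    = tau i * ((if \<beta> (pr i) > 0 then of_nat (\<beta> i + 1) else 0) * C (\<beta>(i := \<beta> i + 1, pr i := \<beta> (pr i) - 1), w) k v)"
    unfolding lhs_pair[OF i] by (simp add: mult.assoc)
  have R: "- ((if k = pr i then tau i * C (\<beta>, w) i v else 0)
      + (if k = pr i \<and> i \<noteq> i then tau i * C (\<beta>, w) i v else 0))
    = tau i * (if k = pr i then - C (\<beta>, w) i v else 0)" by simp
  show ?thesis
    using quadratic_relation[OF i i c k v] unfolding e L R mult_left_cancel[OF tau_nonzero] .
qed

lemma sp_torus:
  assumes i: "i \<in> I0 m" and c: "(\<beta>, w) \<in> HI" and k: "k \<in> II" and v: "v \<subseteq> I1 m n"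
  shows "(of_nat (\<beta> (pr i)) - of_nat (\<beta> i)) * C (\<beta>, w) k v = (of_bool (k = i) - of_bool (k = pr i)) * C (\<beta>, w) k v"
proof -
  have e: "(\<lambda>l. epsA i l + epsA (pr i) l) = zeroA(i := 1, pr i := 1)"
    using pr_neq[OF i] by (auto simp: epsA_def zeroA_def fun_eq_iff)
  have up: "\<beta>(i := 1 + \<beta> i - 1, pr i := 1 + \<beta> (pr i) - 1) = \<beta>" by auto
  have L: "lhs (zeroA(i := 1, pr i := 1), {}) (\<beta>, w) k v = tau i * ((of_nat (\<beta> (pr i)) - of_nat (\<beta> i)) * C (\<beta>, w) k v)"
    unfolding lhs_pair[OF i] up by (simp add: mult.assoc)
  have "tau i * ((of_nat (\<beta> (pr i)) - of_nat (\<beta> i)) * C (\<beta>, w) k v)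
    = tau i * ((of_bool (k = i) - of_bool (k = pr i)) * C (\<beta>, w) k v)"
    unfolding L[symmetric] e[symmetric] quadratic_relation[OF i pr_in_I0[OF i] c k v]
    using pr_neq[OF i] i by (auto simp: tau_pr_I0)
  then show ?thesis unfolding mult_left_cancel[OF tau_nonzero] .
qed

text \<open>Exponents may exceed \<open>p\<close>, so unlike the weights of so(n) these are known
  only modulo \<open>p\<close>.\<close>

lemma sp_weight:
  assumes i: "i \<in> I0 m" and c: "(\<beta>, w) \<in> HI" and nz: "C (\<beta>, w) k v \<noteq> 0"
  shows "int p dvd int (\<beta> (pr i)) - int (\<beta> i) - of_bool (k = i) + of_bool (k = pr i)"
proof -
  have k: "k \<in> II" and v: "v \<subseteq> I1 m n" using C_nonzero[OF c nz] by auto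
  have "of_nat (\<beta> (pr i)) - of_nat (\<beta> i) = (of_bool (k = i) - of_bool (k = pr i) :: 'a)"
    using sp_torus[OF i c k v] nz by simp
  then have "of_int (int (\<beta> (pr i)) - int (\<beta> i) - of_bool (k = i) + of_bool (k = pr i)) = (0 :: 'a)"
    by (simp add: algebra_simps)
  then show ?thesis by (simp only: of_int_eq_0_iff_char_dvd char_p)
qed

section \<open>The monomials \<open>x^\<alpha> x_k x_kap\<close>\<close>

lemma lterm_eps:
  assumes i: "i \<in> I0 m" and l: "l \<in> II"
  shows "lterm (epsA i, u) c k v l =
    (if l = pr i \<and> u \<subseteq> v then tau i * sgnUV u (v - u) * dC (pr i) c k (v - u) else 0)"
proof -
  have "fst (pdmon m (pr l) (epsA i, u)) = zeroA \<longleftrightarrow> pr l = i"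
  proof
    assume "pr l = i"
    then show "fst (pdmon m (pr l) (epsA i, u)) = zeroA"
      using i by (auto simp: pdmon_def epsA_def zeroA_def fun_eq_iff)
  next
    assume *: "fst (pdmon m (pr l) (epsA i, u)) = zeroA"
    show "pr l = i"
      using fun_cong[OF *, of i] by (auto simp: pdmon_def epsA_def zeroA_def split: if_splits)
  qed
  moreover have "pr l = i \<longleftrightarrow> l = pr i" using l i by auto
  ultimately show ?thesis using i by (auto simp: lterm_def pdmon_def pdcoef_def epsA_def)
qed

text \<open>The two derivatives must remove \<open>x_i\<close> and exactly one odd variable
  \<open>x\<close>, in either order; the other odd variables remain as a factor and must fit into
  \<open>v\<close>.\<close>

lemma rterm_eps_nonzero:
  assumes i: "i \<in> I0 m" and u: "u \<subseteq> I1 m n" and k: "k \<in> II" and l: "l \<in> II"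
    and nz: "rterm (epsA i, u) c k v l \<noteq> 0"
  shows "\<exists>x\<in>u. u - {x} \<subseteq> v \<and> C c l (v - (u - {x})) \<noteq> 0 \<and> (l \<in> I1 m n \<longrightarrow> x = l)"
proof -
  define e where "e = pdmon m l (pdmon m (pr k) (epsA i, u))"
  have nzs: "fst e = zeroA" "snd e \<subseteq> v" "pdcoef m n (pr k) (epsA i, u) \<noteq> (0 :: 'a)"
    "pdcoef m n l (pdmon m (pr k) (epsA i, u)) \<noteq> (0 :: 'a)" "C c l (v - snd e) \<noteq> 0"
    using nz unfolding rterm_def Let_def e_def[symmetric] by (auto split: if_splits)
  show ?thesis
  proof (cases "pr k \<in> I0 m")
    case True
    then have "pr k = i" using nzs(3) by (auto simp: pdcoef_def epsA_def split: if_splits)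
    then have pk: "pdmon m (pr k) (epsA i, u) = (zeroA, u)"
      using i by (auto simp: pdmon_def epsA_def zeroA_def fun_eq_iff)
    then have "l \<notin> I0 m" "l \<in> u" using nzs(4) by (auto simp: pdcoef_def zeroA_def split: if_splits)
    moreover from this have "snd e = u - {l}" unfolding e_def pk by (simp add: pdmon_def)
    ultimately show ?thesis using nzs(2,5) by auto
  next
    case False
    then have ku: "pr k \<in> u" using nzs(3) by (auto simp: pdcoef_def split: if_splits)
    have pk: "pdmon m (pr k) (epsA i, u) = (epsA i, u - {pr k})" using False by (simp add: pdmon_def)
    have "l \<in> I0 m"
    proof (rule ccontr)
      assume "l \<notin> I0 m"
      then have "fst e = epsA i" unfolding e_def pk by (simp add: pdmon_def)
      then have "epsA i i = zeroA i" using nzs(1) by simp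
      then show False by (simp add: epsA_def zeroA_def)
    qed
    moreover from this have "snd e = u - {pr k}" unfolding e_def pk by (simp add: pdmon_def)
    ultimately show ?thesis using nzs(2,5) ku I0_I1_disjoint by auto
  qed
qed

text \<open>By \<open>C_empty_support\<close> the image of an even monomial misses at most the odd
  index \<open>pr j\<close> in component \<open>j\<close>. The first sum multiplies by both
  \<open>x_k\<close> and \<open>x_kap\<close>, needing two missing indices. In the second sum one
  factor \<open>y\<close> remains and would have to be \<open>pr j\<close> with \<open>j\<close> the
  other factor, but \<open>k\<close> and \<open>kap\<close> are not partners.\<close>

lemma actC_eps_empty:
  assumes i: "i \<in> I0 m" and k: "k \<in> I1 m n" "k \<noteq> kap" and c: "(\<beta>, {}) \<in> HI" and l: "l \<in> II" and v: "v \<subseteq> I1 m n"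
  shows "actC (epsA i, {k, kap}) (\<beta>, {}) l v = 0"
proof -
  let ?u = "{k, kap}"
  have pk: "pr k \<noteq> kap" "pr kap \<noteq> k" using k I1_facts(9)[OF k(1)] pr_kap by auto
  have "rterm (epsA i, ?u) (\<beta>, {}) l v j = 0" if j: "j \<in> II" for j
  proof (rule ccontr)
    assume "rterm (epsA i, ?u) (\<beta>, {}) l v j \<noteq> 0"
    then obtain x where x: "x \<in> ?u" "C (\<beta>, {}) j (v - (?u - {x})) \<noteq> 0" "j \<in> I1 m n \<longrightarrow> x = j"
      using rterm_eps_nonzero[OF i _ l j] k kap_I1 by (metis empty_subsetI insert_subset)
    obtain y where y: "?u - {x} = {y}" "y \<in> I1 m n" "pr x \<noteq> y"
    proof (cases "x = k")
      case True
      then show ?thesis using that[of kap] k kap_I1 pk by auto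
    next
      case False
      then show ?thesis using that[of k] x(1) k pk by auto
    qed
    have "(j \<in> I0 m \<and> v - {y} = I1 m n) \<or> (j \<in> I1 m n \<and> v - {y} = I1 m n - {pr j})"
      using C_empty_support[OF c x(2)] unfolding y(1) .
    then show False
    proof
      assume "j \<in> I0 m \<and> v - {y} = I1 m n"
      then show False using y(2) by blast
    next
      assume *: "j \<in> I1 m n \<and> v - {y} = I1 m n - {pr j}"
      then have "y = pr j" using y(2) by blast
      then show False using * x(3) y(3) by blast
    qed
  qed
  moreover have "lterm (epsA i, ?u) (\<beta>, {}) l v j = 0" if j: "j \<in> II" for j
  proof -
    have "dC (pr i) (\<beta>, {}) l (v - ?u) = 0"
    proof (rule ccontr)
      assume "dC (pr i) (\<beta>, {}) l (v - ?u) \<noteq> 0"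
      then have nz: "C (\<beta>(pr i := \<beta> (pr i) - 1), {}) l (v - ?u) \<noteq> 0"
        using i by (auto simp: dC_def pdmon_def)
      have "(\<beta>(pr i := \<beta> (pr i) - 1), {}) \<in> HI"
        using pdmon_in_BB[of "(\<beta>, {})" "pr i"] c i by (simp add: HI_iff pdmon_def)
      from C_empty_support[OF this nz] have "I1 m n - {pr l} \<subseteq> v - ?u"
        by (metis Diff_subset order_refl)
      then have "k \<notin> I1 m n - {pr l}" "kap \<notin> I1 m n - {pr l}" by blast+
      then show False using k kap_I1 by (metis DiffI singletonD)
    qed
    then show ?thesis by (simp add: lterm_eps[OF i j])
  qed
  ultimately show ?thesis by (simp add: actC_def)
qed

text \<open>Removing the even variable leaves \<open>x_k x_kap\<close>, which \<open>psi\<close>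
  kills, so the first sum vanishes. In the second, component \<open>pr k\<close> differentiates
  along \<open>k\<close>, the other derivative must be along \<open>i\<close>, and the remaining
  \<open>x_kap\<close> fills the index \<open>kap\<close>.\<close>

lemma actC_eps_eps:
  assumes i: "i \<in> I0 m" and k: "k \<in> I1 m n" "k \<noteq> kap" and v: "v \<subseteq> I1 m n" "kap \<notin> v"
  shows "actC (epsA i, {k, kap}) (epsA (pr i), {k, kap}) (pr k) (insert kap v)
    = - C (epsA (pr i), {k, kap}) i v"
proof -
  let ?b = "(epsA i, {k, kap}) :: idx" and ?c = "(epsA (pr i), {k, kap}) :: idx"
  note f = I1_facts[OF k(1)]
  have lt: "k < kap" using f(3) k(2) by simp
  have "dC (pr i) ?c l w = 0" for l w
  proof -
    have "pdmon m (pr i) ?c = (zeroA, {k, kap})"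
      using i by (auto simp: pdmon_def epsA_def zeroA_def fun_eq_iff)
    then show ?thesis using i psi0_C[OF psi_so[OF k(1) kap_I1 k(2)]] by (simp add: dC_def)
  qed
  then have l0: "lterm ?b ?c (pr k) (insert kap v) l = 0" if "l \<in> II" for l
    by (simp add: lterm_eps[OF i that])
  have e1: "pdmon m (pr (pr k)) ?b = (epsA i, {kap})"
    using f lt by (auto simp: pdmon_def)
  have r: "rterm ?b ?c (pr k) (insert kap v) l = (if l = i then C ?c i v else 0)" if l: "l \<in> II" for l
  proof (cases "l = i")
    case True
    have "pdmon m i (epsA i, {kap}) = (zeroA, {kap})"
      using i by (auto simp: pdmon_def epsA_def zeroA_def fun_eq_iff)
    moreover have "pdcoef m n k ?b = (1 :: 'a)"
      using f k sgnUV_pair(1)[OF lt] by (simp add: pdcoef_def)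
    moreover have "pdcoef m n i (epsA i, {kap}) = (1 :: 'a)" using i by (simp add: pdcoef_def epsA_def)
    moreover have "insert kap v - {kap} = v" using v by auto
    ultimately show ?thesis
      unfolding rterm_def e1 using True f v sgn_kap(2)[OF v] by simp
  next
    case False
    have "fst (pdmon m l (epsA i, {kap})) \<noteq> zeroA"
    proof
      assume *: "fst (pdmon m l (epsA i, {kap})) = zeroA"
      show False using fun_cong[OF *, of i] False by (auto simp: pdmon_def epsA_def zeroA_def split: if_splits)
    qed
    then show ?thesis unfolding rterm_def e1 using False by simp
  qed
  have "i \<in> II" using i by (simp add: II_iff)
  then show ?thesis unfolding actC_def by (simp add: l0 r sum.delta cong: sum.cong)
qed

lemma eps_pair_HI: "i \<in> I0 m \<Longrightarrow> x \<in> I1 m n \<Longrightarrow> y \<in> I1 m n \<Longrightarrow> x \<noteq> y \<Longrightarrow> (epsA i, {x, y}) \<in> HI"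
  by (rule HI_pair) (auto intro: epsA_in_BB)

text \<open>The torus weights leave only the component in direction \<open>pr i\<close> of \<open>C (epsA i, {k, kap})\<close>. The relation
  coming from \<open>x_i^(2)\<close> and the vanishing bracket of \<open>x_i x_k x_kap\<close> with \<open>x_(pr i) x_k x_kap\<close> give
  it opposite signs.\<close>

lemma C_eps_kap:
  assumes i: "i \<in> I0 m" and k: "k \<in> I1 m n" "k \<noteq> kap"
  shows "C (epsA i, {k, kap}) l v = 0"
proof (rule ccontr)
  assume nz: "C (epsA i, {k, kap}) l v \<noteq> 0"
  let ?b = "(epsA i, {k, kap}) :: idx" and ?c = "(epsA (pr i), {k, kap}) :: idx"
  note fk = I1_facts[OF k(1)]
  have b: "?b \<in> HI" and c: "?c \<in> HI" using eps_pair_HI i k kap_I1 by auto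
  have l: "l \<in> II" and v: "v \<subseteq> I1 m n" and par: "odd (card v + mu l)" using C_nonzero[OF b nz] by auto
  \<comment> \<open>The number is -2, -1 or 0, so the weight condition leaves only
    \<open>l = pr i\<close>.\<close>
  have "int p dvd -1 - of_bool (l = i) + of_bool (l = pr i)"
    using sp_weight[OF i b nz] pr_neq[OF i] by (simp add: epsA_def)
  moreover have "\<not> int p dvd -1" "\<not> int p dvd -2" using p_gt zdvd_imp_le[of "int p" 1] zdvd_imp_le[of "int p" 2] by auto
  ultimately have lpr: "l = pr i" using pr_neq[OF i] by (cases "l = i"; cases "l = pr i") auto
  then have lI0: "l \<in> I0 m" using i by simp
  then have ov: "odd (card v)" using par by (simp add: muI_def)
  have ne: "l \<noteq> a" "l \<noteq> pr a" if "a \<in> I1 m n" for a using lI0 I1_facts(2,5)[OF that] by auto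
  have wt: "of_bool (pr a = k) - of_bool (a = k) = (of_bool (pr a \<in> v) - of_bool (a \<in> v) :: int)"
    if "a \<in> I1 m n" "a \<noteq> kap" for a
    using torus_weight[OF b nz that] ne[OF that(1)] I1_facts(9)[OF that(1)] that by simp
  have kv: "k \<in> v" "pr k \<notin> v" using wt[OF k] pr_neq_I1[OF k] by (auto simp: of_bool_def split: if_splits)
  have sym: "pr a \<in> v - {k}" if a: "a \<in> I1 m n" "a \<noteq> kap" "a \<in> v - {k}" for a
  proof -
    have "pr a \<noteq> k" using a kv(2) I1_facts(6)[OF a(1)] by auto
    then show ?thesis using wt[OF a(1,2)] a by (auto simp: of_bool_def split: if_splits)
  qed
  have fin: "finite v" using v finite_sub_I1 by blast
  \<comment> \<open>Apart from the unpaired \<open>k\<close> the set \<open>v\<close> is symmetric,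
    so its odd size excludes \<open>kap\<close>. This makes room for \<open>insert kap v\<close>,
    where the bracket relation is read below.\<close>
  have kapv: "kap \<notin> v"
  proof
    assume kap: "kap \<in> v"
    have "even (card (v - {k} - {kap}))"
    proof (rule even_card_symmetric)
      fix a assume "a \<in> I1 m n" "a \<noteq> kap" "a \<in> v - {k} - {kap}"
      then show "pr a \<in> v - {k} - {kap}" using sym[of a] I1_facts(9)[of a] by auto
    qed (use v in auto)
    moreover have "card v = Suc (card (v - {k}))" by (rule card.remove) (use fin kv in auto)
    moreover have "card (v - {k}) = Suc (card (v - {k} - {kap}))" by (rule card.remove) (use fin kap k in auto)
    ultimately show False using ov by (metis even_Suc)
  qed
  have sq: "C ?b (pr i) v = - C ?c i v"
  proof -
    have "(epsA (pr i))(i := epsA (pr i) i + 1, pr i := epsA (pr i) (pr i) - 1) = epsA i"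
      using pr_neq[OF i] by (auto simp: epsA_def fun_eq_iff)
    then show ?thesis
      using sp_square[OF i c, of "pr i" v] pr_neq[OF i] lpr l v by (simp add: epsA_def)
  qed
  \<comment> \<open>Even derivatives leave repeated odd variables, the one along \<open>k\<close>
    needs \<open>pr k\<close> in the second factor, and the one along \<open>kap\<close> leaves
    \<open>x_k\<close> twice.\<close>
  have "lhs ?b ?c (pr k) (insert kap v) = 0"
    unfolding lhs_def
  proof (intro sum.neutral ballI)
    fix j assume j: "j \<in> II"
    have "poicoef ?b ?c j = 0"
    proof (cases "j \<in> I0 m")
      case True
      then show ?thesis using j by (simp add: poicoef_def moncoef_def pdmon_def)
    next
      case False
      have jk: "poicoef ?b ?c j = 0" if "j = k"
      proof -
        have "pr k \<notin> {k, kap}" "pr k \<notin> I0 m" using fk pr_neq_I1[OF k] k by auto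
        then show ?thesis using that by (simp add: poicoef_def pdcoef_def)
      qed
      have "poicoef ?b ?c j = 0" if "j = kap"
        using that k I1_facts(2)[OF kap_I1] by (simp add: poicoef_def moncoef_def pdmon_def pr_kap)
      moreover have "poicoef ?b ?c j = 0" if "j \<noteq> k" "j \<noteq> kap"
        using that False by (simp add: poicoef_def pdcoef_def)
      ultimately show ?thesis using jk by blast
    qed
    then show "poicoef ?b ?c j * C (poimon ?b ?c j) (pr k) (insert kap v) = 0" by simp
  qed
  moreover have "insert kap v \<subseteq> I1 m n" "pr k \<in> II" using v kap_I1 fk by (auto simp: II_iff)
  moreover have "actC ?b ?c (pr k) (insert kap v) = - C ?c i v"
    by (rule actC_eps_eps[OF i k v kapv])
  moreover have "actC ?c ?b (pr k) (insert kap v) = - C ?b (pr i) v"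
    using actC_eps_eps[OF pr_in_I0[OF i] k v kapv] i by simp
  ultimately have "C ?b (pr i) v = C ?c i v" using relation[OF b c] by fastforce
  with sq have "of_int 2 * C ?b (pr i) v = 0" by simp
  from small_int[OF this] nz lpr show False by simp
qed

lemma psi_eps_kap:
  assumes "i \<in> I0 m" "k \<in> I1 m n" "k \<noteq> kap"
  shows "psi (epsA i, {k, kap}) = wzero"
proof (rule psi_zeroI)
  show "(epsA i, {k, kap}) \<in> HI" using eps_pair_HI assms kap_I1 by auto
next
  fix \<beta> l v assume le: "\<And>j. \<beta> j \<le> epsA i j"
  have "\<beta> = zeroA \<or> \<beta> = epsA i"
  proof (cases "\<beta> i = 0")
    case True
    then have "\<beta> j = 0" for j using le[of j] by (cases "j = i") (auto simp: epsA_def)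
    then show ?thesis by (auto simp: zeroA_def fun_eq_iff)
  next
    case False
    then have "\<beta> j = epsA i j" for j using le[of j] by (cases "j = i") (auto simp: epsA_def)
    then show ?thesis by (auto simp: fun_eq_iff)
  qed
  then show "C (\<beta>, {k, kap}) l v = 0"
    using C_eps_kap[OF assms] psi0_C[OF psi_so[OF assms(2) kap_I1 assms(3)]] by auto
qed

text \<open>If \<open>\<alpha> j\<close> can be raised, then \<open>x^\<alpha> x_k x_kap\<close> is
  up to sign the bracket of \<open>x_i x_k x_kap\<close>, with \<open>i = pr j\<close>, and the
  purely even monomial raised at \<open>j\<close>. The latter need not be killed by
  \<open>psi\<close>, but \<open>actC_eps_empty\<close> removes its contribution.\<close>

lemma C_kap_not_top:
  assumes k: "k \<in> I1 m n" "k \<noteq> kap" and \<alpha>: "(\<alpha>, {}) \<in> BB" "\<alpha> \<noteq> piA m p t"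
  shows "C (\<alpha>, {k, kap}) l v = 0"
proof (rule ccontr)
  assume nz: "C (\<alpha>, {k, kap}) l v \<noteq> 0"
  have "(\<alpha>, {k, kap}) \<in> HI" using HI_pair[OF \<alpha>(1) k(1) kap_I1 k(2)] .
  then have l: "l \<in> II" and v: "v \<subseteq> I1 m n" using C_nonzero nz by auto
  have "\<exists>j\<in>I0 m. \<alpha> j + 1 < p ^ t j"
  proof (rule ccontr)
    assume *: "\<not> (\<exists>j\<in>I0 m. \<alpha> j + 1 < p ^ t j)"
    have "\<alpha> j = piA m p t j" for j
    proof (cases "j \<in> I0 m")
      case True
      then have "\<alpha> j < p ^ t j" "\<not> \<alpha> j + 1 < p ^ t j" using * \<alpha>(1) by (auto simp: in_BB_iff)
      then show ?thesis using True by (simp add: piA_def)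
    qed (use \<alpha>(1) in \<open>simp add: in_BB_iff piA_def\<close>)
    then show False using \<alpha>(2) by blast
  qed
  then obtain j where j: "j \<in> I0 m" "\<alpha> j + 1 < p ^ t j" by blast
  define i where "i = pr j"
  have i: "i \<in> I0 m" "pr i = j" using j by (simp_all add: i_def)
  let ?b = "(epsA i, {k, kap}) :: idx" and ?c = "(\<alpha>(j := \<alpha> j + 1), {}) :: idx"
  have b: "?b \<in> HI" using eps_pair_HI i k kap_I1 by auto
  have c: "?c \<in> HI" using \<alpha>(1) j by (auto simp: HI_iff in_BB_iff)
  have "lhs ?b ?c l v = poicoef ?b ?c i * C (poimon ?b ?c i) l v"
    unfolding lhs_def
  proof (rule sum_single)
    fix h assume h: "h \<in> II" "h \<noteq> i"
    have "poicoef ?b ?c h = 0"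
    proof (cases "h \<in> I0 m")
      case True
      then show ?thesis using h by (simp add: poicoef_def pdcoef_def epsA_def)
    next
      case False
      then have "pr h \<notin> I0 m" using h by simp
      then show ?thesis by (simp add: poicoef_def pdcoef_def)
    qed
    then show "poicoef ?b ?c h * C (poimon ?b ?c h) l v = 0" by simp
  qed (use i in \<open>auto simp: II_iff\<close>)
  also have "\<dots> = tau i * C (\<alpha>, {k, kap}) l v"
  proof -
    have e: "pdmon m i ?b = (zeroA, {k, kap})" "pdmon m j ?c = (\<alpha>, {})"
      using i j by (auto simp: pdmon_def epsA_def zeroA_def fun_eq_iff)
    have "poimon ?b ?c i = (\<alpha>, {k, kap})"
      unfolding poimon_def i(2) e by (simp add: badd_def zeroA_def)
    moreover have "poicoef ?b ?c i = tau i"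
      unfolding poicoef_def i(2) e using i j by (simp add: pdcoef_def moncoef_def binomA_zeroA epsA_def)
    ultimately show ?thesis by simp
  qed
  finally have "lhs ?b ?c l v = \<dots>" .
  moreover have "lhs ?b ?c l v = 0"
    using relation[OF b c v l] actC_eps_empty[OF i(1) k c l v] actC_psi0[OF c b v l psi_eps_kap[OF i(1) k]] by simp
  ultimately show False using nz by simp
qed

section \<open>Extension to all nonempty odd monomials\<close>

lemma lhs_kap:
  assumes u: "u \<subseteq> I1 m n" "kap \<notin> u" and k: "k \<in> u"
  shows "\<exists>x. x \<noteq> 0 \<and> lhs (zeroA, {k, kap}) (\<alpha>, insert kap (u - {k})) l v = x * C (\<alpha>, u) l v"
proof -
  let ?b = "(zeroA, {k, kap}) :: idx" and ?c = "(\<alpha>, insert kap (u - {k})) :: idx"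
  have kI: "k \<in> I1 m n" "k \<noteq> kap" using u k by auto
  note fk = I1_facts[OF kI(1)] and fkap = I1_facts[OF kap_I1]
  have "lhs ?b ?c l v = poicoef ?b ?c kap * C (poimon ?b ?c kap) l v"
    unfolding lhs_def
  proof (rule sum_single)
    fix h assume h: "h \<in> II" "h \<noteq> kap"
    have "poicoef ?b ?c h = 0"
    proof (cases "h = k")
      case True
      have "kap \<in> snd (pdmon m h ?b) \<inter> snd (pdmon m (pr h) ?c)"
        using True fk kI by (auto simp: pdmon_def)
      then show ?thesis by (auto simp: poicoef_def moncoef_def)
    qed (use h in \<open>auto simp: poicoef_def pdcoef_def zeroA_def\<close>)
    then show "poicoef ?b ?c h * C (poimon ?b ?c h) l v = 0" by simp
  qed (use fkap in auto)
  moreover have e: "pdmon m kap ?b = (zeroA, {k})" "pdmon m kap ?c = (\<alpha>, u - {k})"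
    using fkap kI u by (auto simp: pdmon_def)
  have "poimon ?b ?c kap = (\<alpha>, u)"
    unfolding poimon_def pr_kap e using k by (auto simp: badd_def zeroA_def)
  moreover have "poicoef ?b ?c kap \<noteq> 0"
    unfolding poicoef_def pr_kap e using fkap kap_I1 by (simp add: pdcoef_def moncoef_def binomA_zeroA)
  ultimately show ?thesis by metis
qed

lemma lhs_torus_nonzero:
  assumes k: "k \<in> I1 m n" "k \<noteq> kap" and w: "w \<subseteq> I1 m n" "k \<in> w" "pr k \<notin> w"
  shows "\<exists>x. x \<noteq> 0 \<and> lhs (\<alpha>, {k, pr k}) (\<beta>, w) l v = x * of_nat (binomA m \<alpha> \<beta>) * C (\<lambda>i. \<alpha> i + \<beta> i, w) l v"
proof (cases "k < pr k")
  case True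
  show ?thesis
    by (rule exI[of _ "-1"]) (use lhs_torus[OF k(1) True w(1), of \<alpha> \<beta> l v] w in simp)
next
  case False
  note f = I1_facts[OF k(1)]
  have lt: "pr k < pr (pr k)" using False pr_neq_I1[OF k] f by simp
  have "lhs (\<alpha>, {k, pr k}) (\<beta>, w) l v = 1 * of_nat (binomA m \<alpha> \<beta>) * C (\<lambda>i. \<alpha> i + \<beta> i, w) l v"
    using lhs_torus[OF f(4) lt w(1), of \<alpha> \<beta> l v] w f(6) by (simp add: insert_commute)
  then show ?thesis by (intro exI[of _ 1]) simp
qed

text \<open>Bracketing with \<open>x_k x_kap\<close> replaces \<open>kap\<close> by
  \<open>k\<close>, so sets avoiding \<open>kap\<close> are reached from sets of the same size
  containing it.\<close>

lemma C_from_kap: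
  assumes u: "u \<subseteq> I1 m n" "kap \<notin> u" "even (card u)" "k \<in> u"
    and z: "\<And>\<beta> l v. (\<And>i. \<beta> i \<le> \<alpha> i) \<Longrightarrow> C (\<beta>, insert kap (u - {k})) l v = 0"
    and \<alpha>: "(\<alpha>, {}) \<in> BB"
  shows "C (\<alpha>, u) l v = 0"
proof (rule ccontr)
  assume nz: "C (\<alpha>, u) l v \<noteq> 0"
  have \<alpha>u: "(\<alpha>, u) \<in> HI" using \<alpha> u by (simp add: HI_iff in_BB_iff)
  have l: "l \<in> II" and v: "v \<subseteq> I1 m n" using C_nonzero[OF \<alpha>u nz] by auto
  have kI: "k \<in> I1 m n" "k \<noteq> kap" using u by auto
  let ?b = "(zeroA, {k, kap}) :: idx" and ?c = "(\<alpha>, insert kap (u - {k})) :: idx"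
  have b: "?b \<in> HI" by (rule HI_pair) (use kI kap_I1 in auto)
  have fin: "finite u" using u finite_sub_I1 by blast
  have "card (insert kap (u - {k})) = Suc (card (u - {k}))" using fin u by simp
  moreover have "card u = Suc (card (u - {k}))" by (rule card.remove[OF fin u(4)])
  ultimately have "card (insert kap (u - {k})) = card u" by (simp only:)
  then have c: "?c \<in> HI" using \<alpha> u kap_I1 by (auto simp: HI_iff in_BB_iff)
  have "lhs ?b ?c l v = 0"
    by (rule relation_psi0[OF b c psi_so psi_zeroI[OF c z] v l]) (use kI kap_I1 in auto)
  then show False using lhs_kap[OF u(1,2,4), of \<alpha> l v] nz by auto
qed

lemma binomA_eps:
  assumes "i \<in> I0 m"
  shows "binomA m (epsA i) \<beta> = 1 + \<beta> i"
proof -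
  have "binomA m (epsA i) \<beta> = (1 + \<beta> i choose 1) * (\<Prod>j\<in>I0 m - {i}. epsA i j + \<beta> j choose epsA i j)"
    using binomA_split[OF assms, of "epsA i" \<beta>] by (simp add: epsA_def)
  also have "(\<Prod>j\<in>I0 m - {i}. epsA i j + \<beta> j choose epsA i j) = 1"
    by (rule prod.neutral) (simp add: epsA_def)
  finally show ?thesis by simp
qed

text \<open>The top monomial has no exponent to raise. Instead \<open>x_i x_k x_(pr k)\<close> is
  bracketed with the monomial lowered at \<open>i\<close>; the torus weight of
  \<open>x_k x_kap\<close> is nonzero, and the binomial factor is
  \<open>\<alpha> i = p ^ t i - 1\<close>, which is -1 in the field.\<close>

lemma C_kap_pair:
  assumes k: "k \<in> I1 m n" "k \<noteq> kap" and \<alpha>: "(\<alpha>, {}) \<in> BB"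
  shows "C (\<alpha>, {k, kap}) l v = 0"
proof (cases "\<alpha> = piA m p t")
  case False
  then show ?thesis using C_kap_not_top[OF k \<alpha>] by simp
next
  case top: True
  note f = I1_facts[OF k(1)]
  have kk: "pr k \<noteq> k" "pr k \<noteq> kap" using pr_neq_I1[OF k] f k by auto
  have "1 \<in> I0 m" using m_pos by (simp add: I0_def)
  then obtain i where i: "i \<in> I0 m" by blast
  define \<beta> where "\<beta> = \<alpha>(i := \<alpha> i - 1)"
  have pos: "\<alpha> i + 1 = p ^ t i" "\<alpha> i > 0" using p_le_power[OF i] p_gt i top by (auto simp: piA_def)
  have \<beta>: "(\<beta>, {}) \<in> BB" using pdmon_in_BB[OF \<alpha>, of i] i by (simp add: pdmon_def \<beta>_def)
  let ?b = "(epsA i, {k, pr k}) :: idx" and ?c = "(\<beta>, {k, kap}) :: idx"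
  have b: "?b \<in> HI" by (rule eps_pair_HI) (use i k f kk in auto)
  have c: "?c \<in> HI" by (rule HI_pair[OF \<beta> k(1) kap_I1 k(2)])
  \<comment> \<open>\<open>x_i\<close> is not the top monomial because
    \<open>p ^ t i - 1 > 1\<close>, so replacing \<open>k\<close> by \<open>kap\<close> leads to the
    case already settled.\<close>
  have pb: "psi ?b = wzero"
  proof (rule psi_zeroI[OF b])
    fix \<gamma> l v assume le: "\<And>j. \<gamma> j \<le> epsA i j"
    show "C (\<gamma>, {k, pr k}) l v = 0"
    proof (rule C_from_kap[of _ k])
      have "insert kap ({k, pr k} - {k}) = {pr k, kap}" using kk by auto
      moreover have "C (\<delta>, {pr k, kap}) l v = 0" if le': "\<And>j. \<delta> j \<le> \<gamma> j" for \<delta> l v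
      proof (rule C_kap_not_top[OF f(4) kk(2)])
        have \<delta>: "\<delta> j \<le> epsA i j" for j using le[of j] le'[of j] by simp
        have "1 < p ^ t i" using p_le_power[OF i] p_gt by linarith
        then show "(\<delta>, {}) \<in> BB"
          using \<delta> epsA_in_BB[OF i, of "{}"] by (blast intro: BB_down)
        have "\<delta> i \<le> 1" using \<delta>[of i] by (simp add: epsA_def)
        moreover have "piA m p t i > 1" using p_le_power[OF i] p_gt i by (simp add: piA_def)
        ultimately show "\<delta> \<noteq> piA m p t" by auto
      qed
      ultimately show "C (\<delta>, insert kap ({k, pr k} - {k})) l v = 0" if "\<And>j. \<delta> j \<le> \<gamma> j" for \<delta> l v
        using that by simp
      show "(\<gamma>, {}) \<in> BB"
        using le epsA_in_BB[OF i, of "{}"] by (blast intro: BB_down)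
    qed (use k kk f in auto)
  qed
  have pc: "psi ?c = wzero"
  proof (rule psi_zeroI[OF c])
    fix \<gamma> l v assume le: "\<And>j. \<gamma> j \<le> \<beta> j"
    show "C (\<gamma>, {k, kap}) l v = 0"
    proof (rule C_kap_not_top[OF k])
      show "(\<gamma>, {}) \<in> BB"
        using le \<beta> by (blast intro: BB_down)
      show "\<gamma> \<noteq> piA m p t" using le[of i] pos unfolding \<beta>_def top[symmetric] by auto
    qed
  qed
  have e: "(\<lambda>j. epsA i j + \<beta> j) = \<alpha>" using pos by (auto simp: \<beta>_def epsA_def fun_eq_iff)
  have nzb: "of_nat (binomA m (epsA i) \<beta>) \<noteq> (0 :: 'a)"
  proof -
    have "binomA m (epsA i) \<beta> + 1 = p ^ t i" using binomA_eps[OF i] pos by (simp add: \<beta>_def)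
    then have "of_nat (binomA m (epsA i) \<beta>) + 1 = (of_nat (p ^ t i) :: 'a)"
      by (metis of_nat_1 of_nat_add)
    also have "\<dots> = 0" using t_pos[OF i] unfolding of_nat_eq_0_iff_char_dvd char_p by simp
    finally show ?thesis by auto
  qed
  obtain x where x: "x \<noteq> 0" "lhs ?b ?c l v
      = x * of_nat (binomA m (epsA i) \<beta>) * C (\<lambda>j. epsA i j + \<beta> j, {k, kap}) l v"
    using lhs_torus_nonzero[OF k, of "{k, kap}" "epsA i" \<beta> l v] k kk kap_I1 by auto
  show ?thesis
  proof (rule ccontr)
    assume "C (\<alpha>, {k, kap}) l v \<noteq> 0"
    moreover from this have "v \<subseteq> I1 m n" "l \<in> II"
      using C_nonzero[OF HI_pair[OF \<alpha> k(1) kap_I1 k(2)]] by blast+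
    then have "lhs ?b ?c l v = 0" by (rule relation_psi0[OF b c pb pc])
    ultimately show False using x nzb unfolding e by simp
  qed
qed

text \<open>Without \<open>kap\<close> the set has odd size, whereas a set avoiding
  \<open>kap\<close> and closed under \<open>pr\<close> has even size.\<close>

lemma exists_unpaired:
  assumes u: "u \<subseteq> I1 m n" "kap \<in> u" "even (card u)"
  obtains k where "k \<in> u" "k \<noteq> kap" "pr k \<notin> u"
proof (rule ccontr)
  assume no: "\<not> thesis"
  have "even (card (u - {kap}))"
  proof (rule even_card_symmetric)
    fix a assume "a \<in> I1 m n" "a \<noteq> kap" "a \<in> u - {kap}"
    then show "pr a \<in> u - {kap}" using no that I1_facts(9)[of a] by auto
  qed (use u in auto)
  moreover have "card u = Suc (card (u - {kap}))"
    by (rule card.remove) (use u finite_sub_I1 in auto)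
  ultimately show False using u(3) by (metis even_Suc)
qed

text \<open>Once \<open>psi\<close> vanishes on smaller nonempty exterior degrees, the bracket of \<open>x_i x_k x_l\<close> and
  \<open>x_(pr i) x^w\<close> equals \<open>x_k x_l x^w\<close> up to terms of exterior degree \<open>card w\<close>.\<close>

lemma C_zeroA_step:
  assumes u: "u \<subseteq> I1 m n" "even (card u)" "card u \<ge> 4"
    and IH: "\<And>w \<alpha> l v. w \<subseteq> I1 m n \<Longrightarrow> even (card w) \<Longrightarrow> w \<noteq> {} \<Longrightarrow> card w < card u \<Longrightarrow> C (\<alpha>, w) l v = 0"
  shows "C (zeroA, u) l v = 0"
proof (rule ccontr)
  assume nz: "C (zeroA, u) l v \<noteq> 0"
  have "(zeroA, u) \<in> HI" using u by (simp add: HI_iff)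
  then have l: "l \<in> II" and v: "v \<subseteq> I1 m n" using C_nonzero nz by auto
  have fin: "finite u" using u finite_sub_I1 by blast
  obtain x where x: "x \<in> u" using u(3) by fastforce
  have cx: "card u = Suc (card (u - {x}))" by (rule card.remove[OF fin x])
  then obtain y where y: "y \<in> u" "y \<noteq> x" using u(3) by (cases "u - {x} = {}") auto
  define w where "w = u - {x} - {y}"
  have "card (u - {x}) = Suc (card w)" unfolding w_def by (rule card.remove) (use fin y in auto)
  then have cw: "card u = Suc (Suc (card w))" using cx by simp
  have w: "w \<subseteq> I1 m n" "x \<notin> w" "y \<notin> w" "u = {x, y} \<union> w" "finite w"
    using u x y fin by (auto simp: w_def)
  have we: "even (card w)" "w \<noteq> {}" using u(2,3) cw by auto
  have "1 \<in> I0 m" using m_pos by (simp add: I0_def)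
  then obtain i where i: "i \<in> I0 m" by blast
  let ?b = "(epsA i, {x, y}) :: idx" and ?c = "(epsA (pr i), w) :: idx"
  have xy: "x \<in> I1 m n" "y \<in> I1 m n" using x y u by auto
  have b: "?b \<in> HI" by (rule eps_pair_HI[OF i xy]) (use y in auto)
  have c: "?c \<in> HI" using epsA_in_BB[of "pr i" w] i w we by (simp add: HI_iff)
  have "psi ?b = wzero"
    by (rule psi_zeroI[OF b IH]) (use xy y u(3) in auto)
  moreover have "psi ?c = wzero"
    by (rule psi_zeroI[OF c IH]) (use w we cw in auto)
  ultimately have L0: "lhs ?b ?c l v = 0" by (rule relation_psi0[OF b c _ _ v l])
  have "lhs ?b ?c l v = poicoef ?b ?c i * C (poimon ?b ?c i) l v"
    unfolding lhs_def
  proof (rule sum_single)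
    fix h assume h: "h \<in> II" "h \<noteq> i"
    show "poicoef ?b ?c h * C (poimon ?b ?c h) l v = 0"
    proof (cases "h \<in> I0 m \<or> poicoef ?b ?c h = 0")
      case True
      then show ?thesis using h by (auto simp: poicoef_def pdcoef_def epsA_def)
    next
      case False
      then have hn: "h \<notin> I0 m" "pr h \<notin> I0 m" using h by auto
      have nz: "pdcoef m n h ?b \<noteq> (0 :: 'a)" "pdcoef m n (pr h) ?c \<noteq> (0 :: 'a)"
        "moncoef m (pdmon m h ?b) (pdmon m (pr h) ?c) \<noteq> (0 :: 'a)"
        using False by (auto simp: poicoef_def)
      then have hm: "h \<in> {x, y}" "pr h \<in> w" using hn by (auto simp: pdcoef_def split: if_splits)
      have disj: "({x, y} - {h}) \<inter> (w - {pr h}) = {}"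
        using nz(3) hn by (auto simp: moncoef_def pdmon_def split: if_splits)
      have sn: "snd (poimon ?b ?c h) = ({x, y} - {h}) \<union> (w - {pr h})"
        using hn by (simp add: poimon_def badd_def pdmon_def)
      have "card ({x, y} - {h}) = 1" using hm(1) y(2) by auto
      moreover have "card w = Suc (card (w - {pr h}))" by (rule card.remove) (use w hm in auto)
      ultimately have "card (snd (poimon ?b ?c h)) = card w"
        unfolding sn by (subst card_Un_disjoint[OF _ _ disj]) (use w in auto)
      moreover have "snd (poimon ?b ?c h) \<subseteq> I1 m n" unfolding sn using w xy by auto
      moreover have "card w \<ge> 2" using cw u(3) by linarith
      ultimately have "C (fst (poimon ?b ?c h), snd (poimon ?b ?c h)) l v = 0"
        using we(1) cw by (intro IH) (simp, simp, fastforce, simp)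
      then show ?thesis by simp
    qed
  qed (use i in \<open>auto simp: II_iff\<close>)
  moreover have e: "pdmon m i ?b = (zeroA, {x, y})" "pdmon m (pr i) ?c = (zeroA, w)"
    using i by (auto simp: pdmon_def epsA_def zeroA_def fun_eq_iff)
  have "poimon ?b ?c i = (zeroA, u)"
    unfolding poimon_def e by (simp add: badd_def zeroA_def w(4))
  moreover have "poicoef ?b ?c i \<noteq> 0"
    unfolding poicoef_def e using i w by (simp add: pdcoef_def moncoef_def binomA_zeroA epsA_def)
  ultimately show False using L0 nz by simp
qed

text \<open>Induction on exterior degree. A set containing \<open>kap\<close> has an unpaired index
  \<open>k\<close>, whose torus weight is nonzero; it lets an even factor \<open>x^\<alpha>\<close>
  be attached to \<open>x^u\<close>. Sets without \<open>kap\<close> follow by exchange.\<close>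

lemma C_nonempty_zero:
  assumes "u \<subseteq> I1 m n" "even (card u)" "u \<noteq> {}"
  shows "C (\<alpha>, u) l v = 0"
  using assms
proof (induction "card u" arbitrary: u \<alpha> l v rule: less_induct)
  case less
  have IH: "C (\<alpha>, w) l v = 0" if "w \<subseteq> I1 m n" "even (card w)" "w \<noteq> {}" "card w < card u" for w \<alpha> l v
    by (rule less.hyps[OF that(4,1,2,3)])
  have fin: "finite u" using less.prems(1) finite_sub_I1 by blast
  have c2: "card u \<ge> 2" using less.prems(2,3) fin by (cases "card u"; cases "card u - 1") auto
  have main: "C (\<alpha>, u') l v = 0" if u': "u' \<subseteq> I1 m n" "card u' = card u" "kap \<in> u'" for u' \<alpha> l v
  proof (rule ccontr)
    assume nz: "C (\<alpha>, u') l v \<noteq> 0"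
    then have \<alpha>: "(\<alpha>, u') \<in> BB" using C_notin by blast
    then have \<alpha>e: "(\<alpha>, {}) \<in> BB" by (simp add: in_BB_iff)
    have HI: "(\<alpha>, u') \<in> HI" using \<alpha> u' less.prems(2) by (simp add: HI_iff)
    have l: "l \<in> II" and v: "v \<subseteq> I1 m n" using C_nonzero[OF HI nz] by auto
    obtain k where k: "k \<in> u'" "k \<noteq> kap" "pr k \<notin> u'"
      using exists_unpaired[OF u'(1,3)] u'(2) less.prems(2) by metis
    have kI: "k \<in> I1 m n" using k u' by auto
    have fin': "finite u'" using u' finite_sub_I1 by blast
    show False
    proof (cases "card u = 2")
      case True
      have "card {k, kap} = 2" using k by simp
      then have "u' = {k, kap}"
        using True u'(2,3) k card_subset_eq[OF fin', of "{k, kap}"] by auto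
      then show False using C_kap_pair[OF kI k(2) \<alpha>e] nz by simp
    next
      case False
      have "card u \<noteq> 3" using less.prems(2) by auto
      then have c4: "card u' \<ge> 4" using False c2 u'(2) by linarith
      have z: "C (zeroA, u') l v = 0" for l v
        by (rule C_zeroA_step) (use u' less.prems(2) c4 IH in auto)
      \<comment> \<open>\<open>?b\<close> has exterior degree 2, below that of \<open>u\<close>, and
        is covered by induction. \<open>?c\<close> has no even exponent, so the bracket returns the
        monomial without a binomial factor.\<close>
      let ?b = "(\<alpha>, {k, pr k}) :: idx" and ?c = "(zeroA, u') :: idx"
      have kk: "pr k \<in> I1 m n" "pr k \<noteq> k" using I1_facts(4)[OF kI] pr_neq_I1[OF kI k(2)] by auto
      have b: "?b \<in> HI" by (rule HI_pair[OF \<alpha>e]) (use kI kk in auto)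
      have c: "?c \<in> HI" using u' less.prems(2) by (simp add: HI_iff)
      have "psi ?b = wzero"
        by (rule psi_zeroI[OF b IH]) (use kI kk c4 u' in auto)
      moreover have "psi ?c = wzero"
      proof (rule psi_zeroI[OF c])
        fix \<beta> l v assume "\<And>j. \<beta> j \<le> zeroA j"
        then have "\<beta> = zeroA" by (auto simp: zeroA_def fun_eq_iff)
        then show "C (\<beta>, u') l v = 0" using z by simp
      qed
      ultimately have "lhs ?b ?c l v = 0" by (rule relation_psi0[OF b c _ _ v l])
      moreover obtain x where "x \<noteq> 0" "lhs ?b ?c l v = x * of_nat (binomA m \<alpha> zeroA) * C (\<lambda>j. \<alpha> j + zeroA j, u') l v"
        using lhs_torus_nonzero[OF kI k(2) u'(1) k(1,3)] by metis
      moreover have "(\<lambda>j. \<alpha> j + zeroA j) = \<alpha>" by (simp add: zeroA_def)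
      ultimately show False using nz by (simp add: binomA_zeroA)
    qed
  qed
  show ?case
  proof (cases "kap \<in> u")
    case True
    then show ?thesis using main less.prems(1) by blast
  next
    case False
    obtain k where k: "k \<in> u" using less.prems(3) by blast
    show ?thesis
    proof (cases "(\<alpha>, u) \<in> BB")
      case True
      have "card (insert kap (u - {k})) = Suc (card (u - {k}))" using fin False by simp
      moreover have "card u = Suc (card (u - {k}))" by (rule card.remove[OF fin k])
      ultimately have "card (insert kap (u - {k})) = card u" by (simp only:)
      moreover have "insert kap (u - {k}) \<subseteq> I1 m n" using less.prems(1) kap_I1 by auto
      ultimately show ?thesis
        using True by (intro C_from_kap[OF less.prems(1) False less.prems(2) k] main) (auto simp: in_BB_iff)
    qed (rule C_notin)
  qed
qed

end

section \<open>Functionals on the divided power algebra\<close>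

text \<open>Take the exact power \<open>p ^ v\<close> dividing \<open>N\<close>: the binomial has
  the same \<open>p\<close>-adic valuation as the cofactor \<open>N'\<close>, namely 0, and
  \<open>p ^ v < N\<close> because \<open>N\<close> is not itself a power of
  \<open>p\<close>.\<close>

lemma binomial_prime_power_not_dvd:
  fixes p N :: nat
  assumes p: "prime p" and N: "p dvd N" "N > 0" "\<And>e. N \<noteq> p ^ e"
  obtains v where "v \<ge> 1" "p ^ v < N" "\<not> p dvd N choose p ^ v"
proof -
  define v where "v = multiplicity p N"
  have np: "\<not> is_unit p" using p by (simp add: prime_nat_iff)
  obtain N' where N': "N = p ^ v * N'" "\<not> p dvd N'"
    using multiplicity_decompose'[of N p] N(2) np unfolding v_def by auto
  have "v \<ge> 1" using N' N(1) by (cases v) auto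
  moreover have "N' > 0" "p ^ v > 0" using N' N(2) p prime_gt_0_nat by auto
  moreover have "N' \<noteq> 1" using N' N(3)[of v] by auto
  ultimately have lt: "p ^ v < N" using N'(1) by simp
  have "multiplicity p (N choose p ^ v) = multiplicity p N'"
    unfolding N'(1) by (rule const_p_fac[OF \<open>N' > 0\<close> p])
  also have "\<dots> = 0" using N'(2) by (rule not_dvd_imp_multiplicity_0)
  finally have "\<not> p dvd N choose p ^ v"
    using lt p by (subst (asm) prime_elem_multiplicity_eq_zero_iff) auto
  then show thesis using that \<open>v \<ge> 1\<close> lt by blast
qed

context hderiv
begin

lemma of_nat_zero_iff: "of_nat x = (0 :: 'a) \<longleftrightarrow> p dvd x"
  by (simp add: of_nat_eq_0_iff_char_dvd char_p)

lemma zeroA_apply [simp]: "zeroA i = 0"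
  by (simp add: zeroA_def)

lemma absA_upd: "i \<in> I0 m \<Longrightarrow> absA m (\<alpha>(i := x)) + \<alpha> i = absA m \<alpha> + x"
  by (simp add: absA_def sum.remove)

lemma absA_upd2:
  assumes "i \<in> I0 m" "j \<in> I0 m" "i \<noteq> j"
  shows "absA m (\<alpha>(i := x, j := y)) + \<alpha> i + \<alpha> j = absA m \<alpha> + x + y"
  using absA_upd[OF assms(1), of \<alpha> x] absA_upd[OF assms(2), of "\<alpha>(i := x)" y] assms(3) by simp

lemma absA_ge: "i \<in> I0 m \<Longrightarrow> \<alpha> i \<le> absA m \<alpha>"
  unfolding absA_def by (rule member_le_sum) auto

lemma absA_ge2:
  assumes "i \<in> I0 m" "j \<in> I0 m" "i \<noteq> j"
  shows "\<alpha> i + \<alpha> j \<le> absA m \<alpha>"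
  using absA_upd2[OF assms, of \<alpha> 0 0] by simp

lemma BB_upd: "(\<alpha>, {}) \<in> BB \<Longrightarrow> i \<in> I0 m \<Longrightarrow> x < p ^ t i \<Longrightarrow> (\<alpha>(i := x), {}) \<in> BB"
  by (auto simp: in_BB_iff)

lemma zeroA_BB: "(zeroA, {}) \<in> BB"
  by simp

lemma HI_empty: "(\<alpha>, {}) \<in> HI \<longleftrightarrow> (\<alpha>, {}) \<in> BB"
  by (simp add: HI_iff)

lemma p_ge_5: "p \<ge> 5"
proof -
  have "odd p" using prime_odd_nat[OF prime_p] p_gt by simp
  then show ?thesis using p_gt by presburger
qed

text \<open>A maximal exponent \<open>p ^ t i - 1\<close> is -1 in the field, which separates it
  from the multiples of \<open>p\<close>.\<close>

lemma top_facts: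
  assumes "i \<in> I0 m" "x + 1 = p ^ t i"
  shows "\<not> p dvd x" "of_nat x = (-1 :: 'a)" "x \<ge> 4"
proof -
  have d: "p dvd x + 1" unfolding assms(2) using t_pos[OF assms(1)] by simp
  have "of_nat (x + 1) = (0 :: 'a)" using d by (simp only: of_nat_zero_iff)
  then show of: "of_nat x = (-1 :: 'a)" by (simp add: eq_neg_iff_add_eq_0 add.commute)
  show "\<not> p dvd x"
  proof
    assume "p dvd x"
    then have "of_nat x = (0 :: 'a)" by (simp only: of_nat_zero_iff)
    then show False using of by simp
  qed
  show "x \<ge> 4" using p_ge_5 p_le_power[OF assms(1)] assms(2) by linarith
qed

text \<open>A multiple of \<open>p\<close> is never maximal; this gives the room to raise it by one
  that \<open>peel_zero\<close> requires.\<close>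

lemma mult_p_lt:
  assumes "i \<in> I0 m" "p dvd x" "x < p ^ t i"
  shows "x + 1 < p ^ t i"
  using top_facts(1)[OF assms(1), of x] assms(2,3) by linarith

text \<open>For fixed \<open>k\<close> and \<open>v\<close> this concerns the functional
  \<open>C (_, {}) k v\<close>. The degree bound \<open>D\<close> is meant to make both action terms
  of \<open>relation\<close> vanish.\<close>

definition bracket_closed :: "nat \<Rightarrow> nat \<Rightarrow> nat set \<Rightarrow> bool" where
  "bracket_closed D k v \<longleftrightarrow> (\<forall>\<alpha> \<beta>. (\<alpha>, {}) \<in> BB \<longrightarrow> (\<beta>, {}) \<in> BB \<longrightarrow> D \<le> absA m \<alpha> \<longrightarrow> D \<le> absA m \<beta>
     \<longrightarrow> lhs (\<alpha>, {}) (\<beta>, {}) k v = 0)"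

text \<open>The Hamiltonian field of an even monomial has no entry in direction \<open>kap\<close>,
  so the sum with second derivatives is absent; first derivatives already lose their constant term
  in degree 2.\<close>

lemma actC_kap:
  assumes "absA m \<alpha> \<ge> 2"
  shows "actC (\<alpha>, {}) c kap v = 0"
proof -
  have "fst (pdmon m i (\<alpha>, {})) \<noteq> zeroA" for i
    using absA_pdmon[of "(\<alpha>, {})" i] assms by auto
  moreover have "pdcoef m n (pr kap) (\<alpha>, {}) = (0 :: 'a)"
    using I1_facts(2)[OF kap_I1] by (simp add: pr_kap pdcoef_def)
  ultimately have "lterm (\<alpha>, {}) c kap v i = 0" "rterm (\<alpha>, {}) c kap v i = 0" for i
    by (simp_all add: lterm_def rterm_def Let_def)
  then show ?thesis by (simp add: actC_def)
qed

lemma closed_kap: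
  assumes "v \<subseteq> I1 m n"
  shows "bracket_closed 2 kap v"
proof -
  have "kap \<in> II" using kap_I1 by (simp add: II_iff)
  then show ?thesis
    unfolding bracket_closed_def using relation[OF _ _ assms] actC_kap by (simp add: HI_empty)
qed

lemma closed_high:
  assumes "v \<subseteq> I1 m n" "k \<in> II"
  shows "bracket_closed 3 k v"
  unfolding bracket_closed_def using relation[OF _ _ assms] actC_high by (simp add: HI_empty)

section \<open>Vanishing criteria from single brackets\<close>

lemma pair_zero:
  assumes cl: "bracket_closed D k v" and i: "i \<in> I0 m"
    and b: "A < p ^ t i" "B < p ^ t (pr i)" "D \<le> A + B" and c: "(\<beta>, {}) \<in> BB" "D \<le> absA m \<beta>"
    and nz: "(if A > 0 \<and> \<beta> (pr i) > 0
        then of_nat ((A - 1 + \<beta> i choose (A - 1)) * (B + (\<beta> (pr i) - 1) choose B)) else 0)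
      - (if B > 0 \<and> \<beta> i > 0
        then of_nat ((A + (\<beta> i - 1) choose A) * (B - 1 + \<beta> (pr i) choose (B - 1))) else 0) \<noteq> (0 :: 'a)"
  shows "C (\<beta>(i := A + \<beta> i - 1, pr i := B + \<beta> (pr i) - 1), {}) k v = 0"
proof -
  have "(zeroA(i := A, pr i := B), {}) \<in> BB" using i b by (intro BB_upd zeroA_BB) auto
  moreover have "absA m (zeroA(i := A, pr i := B)) = A + B"
    using absA_upd2[of i "pr i" zeroA A B] pr_neq[OF i] i by simp
  ultimately have "lhs (zeroA(i := A, pr i := B), {}) (\<beta>, {}) k v = 0"
    using cl b c unfolding bracket_closed_def by simp
  then show ?thesis using nz unfolding lhs_pair[OF i] by simp
qed

text \<open>Up to sign \<open>x^\<alpha>\<close> is the bracket of the pure power of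
  \<open>x_i\<close> with exponent \<open>\<alpha> i + 1\<close> and the remaining factor raised at
  \<open>pr i\<close>. Divided powers make the coefficient 1.\<close>

lemma peel_zero:
  assumes cl: "bracket_closed D k v" and i: "i \<in> I0 m" and \<alpha>: "(\<alpha>, {}) \<in> BB"
    and lt: "\<alpha> i + 1 < p ^ t i" "\<alpha> (pr i) + 1 < p ^ t (pr i)" and d: "D \<le> \<alpha> i + 1" "D + \<alpha> i \<le> absA m \<alpha> + 1"
  shows "C (\<alpha>, {}) k v = 0"
proof -
  define \<beta> where "\<beta> = \<alpha>(i := 0, pr i := \<alpha> (pr i) + 1)"
  note ne = pr_neq[OF i]
  have "(\<beta>, {}) \<in> BB" unfolding \<beta>_def using i lt \<alpha> p_gt by (intro BB_upd) auto
  moreover have "D \<le> absA m \<beta>"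
    using absA_upd2[of i "pr i" \<alpha> 0 "\<alpha> (pr i) + 1"] i ne d unfolding \<beta>_def by simp
  ultimately have "C (\<beta>(i := (\<alpha> i + 1) + \<beta> i - 1, pr i := 0 + \<beta> (pr i) - 1), {}) k v = 0"
    by (intro pair_zero[OF cl i lt(1)]) (use d ne p_gt in \<open>auto simp: \<beta>_def\<close>)
  moreover have "\<beta>(i := (\<alpha> i + 1) + \<beta> i - 1, pr i := 0 + \<beta> (pr i) - 1) = \<alpha>"
    using ne by (auto simp: \<beta>_def fun_eq_iff)
  ultimately show ?thesis by simp
qed

text \<open>Bracket \<open>x_i^(M) x_(pr i)\<close> with the monomial whose exponent at
  \<open>i\<close> is \<open>\<alpha> i - M + 1\<close>. Since \<open>pr i\<close> is absent from
  the second factor, one term survives, with coefficient \<open>\<alpha> i choose M\<close> up to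
  sign.\<close>

lemma binomial_zero:
  assumes cl: "bracket_closed D k v" and i: "i \<in> I0 m" and \<alpha>: "(\<alpha>, {}) \<in> BB" "\<alpha> (pr i) = 0"
    and M: "0 < M" "M < \<alpha> i" "\<not> p dvd \<alpha> i choose M" and d: "D \<le> M + 1" "D + M \<le> absA m \<alpha> + 1"
  shows "C (\<alpha>, {}) k v = 0"
proof -
  define \<beta> where "\<beta> = \<alpha>(i := \<alpha> i - M + 1)"
  note ne = pr_neq[OF i]
  have lt: "\<alpha> i < p ^ t i" using \<alpha>(1) i by (simp add: in_BB_iff)
  have b: "(\<beta>, {}) \<in> BB" unfolding \<beta>_def using i lt \<alpha> M by (intro BB_upd) auto
  moreover have "D \<le> absA m \<beta>"
    using absA_upd[of i \<alpha> "\<alpha> i - M + 1"] i d M unfolding \<beta>_def by simp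
  moreover have "1 < p ^ t (pr i)" using p_le_power[OF pr_in_I0[OF i]] p_gt by linarith
  moreover have "M + (\<beta> i - 1) = \<alpha> i" using M by (simp add: \<beta>_def)
  ultimately have "C (\<beta>(i := M + \<beta> i - 1, pr i := 1 + \<beta> (pr i) - 1), {}) k v = 0"
    by (intro pair_zero[OF cl i]) (use d ne M lt \<alpha>(2) in \<open>auto simp: \<beta>_def of_nat_zero_iff\<close>)
  moreover have "\<beta>(i := M + \<beta> i - 1, pr i := 1 + \<beta> (pr i) - 1) = \<alpha>"
    using ne M \<alpha>(2) by (auto simp: \<beta>_def fun_eq_iff)
  ultimately show ?thesis by simp
qed

text \<open>Move one unit of exponent from \<open>i\<close> to \<open>pr i\<close> and let
  \<open>x_i^(2)\<close> bring it back: the coefficient is \<open>\<alpha> i\<close>, and the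
  component is untouched because \<open>k \<noteq> pr i\<close>.\<close>

lemma sq_zero:
  assumes i: "i \<in> I0 m" "k \<noteq> pr i" and \<alpha>: "(\<alpha>, {}) \<in> BB"
    and lt: "\<not> p dvd \<alpha> i" "\<alpha> (pr i) + 1 < p ^ t (pr i)"
  shows "C (\<alpha>, {}) k v = 0"
proof (rule ccontr)
  assume nz: "C (\<alpha>, {}) k v \<noteq> 0"
  have "(\<alpha>, {}) \<in> HI" using \<alpha> by (simp add: HI_empty)
  from C_nonzero[OF this nz] have k: "k \<in> II" and v: "v \<subseteq> I1 m n" by auto
  note ne = pr_neq[OF i(1)]
  define \<beta> where "\<beta> = \<alpha>(i := \<alpha> i - 1, pr i := \<alpha> (pr i) + 1)"
  have pos: "\<alpha> i > 0" using lt(1) by (cases "\<alpha> i") auto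
  have "\<alpha> i < p ^ t i" using \<alpha> i by (simp add: in_BB_iff)
  then have "(\<beta>, {}) \<in> HI" unfolding \<beta>_def HI_empty using i lt \<alpha> by (intro BB_upd) auto
  from sp_square[OF i(1) this k v] have "of_nat (\<beta> i + 1) * C (\<beta>(i := \<beta> i + 1, pr i := \<beta> (pr i) - 1), {}) k v = 0"
    using i ne by (simp add: \<beta>_def)
  moreover have "\<beta>(i := \<beta> i + 1, pr i := \<beta> (pr i) - 1) = \<alpha>"
    using ne pos by (auto simp: \<beta>_def fun_eq_iff)
  moreover have "\<beta> i + 1 = \<alpha> i" using ne pos by (simp add: \<beta>_def)
  ultimately have "of_nat (\<alpha> i) * C (\<alpha>, {}) k v = 0" by (simp only:)
  then show False using nz lt(1) by (simp add: of_nat_zero_iff)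
qed

text \<open>\<open>sq_zero\<close> in both directions makes each exponent a multiple of
  \<open>p\<close> unless its partner is maximal. Mixed cases fail because maximal exponents are
  prime to \<open>p\<close>.\<close>

lemma pair_dichotomy:
  assumes i: "i \<in> I0 m" "k \<noteq> i" "k \<noteq> pr i" and \<alpha>: "(\<alpha>, {}) \<in> BB" and nz: "C (\<alpha>, {}) k v \<noteq> 0"
  shows "(p dvd \<alpha> i \<and> p dvd \<alpha> (pr i)) \<or> (\<alpha> i + 1 = p ^ t i \<and> \<alpha> (pr i) + 1 = p ^ t (pr i))"
proof -
  have lt: "\<alpha> i < p ^ t i" "\<alpha> (pr i) < p ^ t (pr i)" using \<alpha> i by (auto simp: in_BB_iff)
  have "p dvd \<alpha> i \<or> \<alpha> (pr i) + 1 = p ^ t (pr i)"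
    using sq_zero[OF i(1,3) \<alpha>] nz lt by (metis Suc_eq_plus1 Suc_lessI)
  moreover have "p dvd \<alpha> (pr i) \<or> \<alpha> i + 1 = p ^ t i"
    using sq_zero[of "pr i" k \<alpha> v] i nz lt \<alpha> by (metis Suc_eq_plus1 Suc_lessI pr_in_I0 pr_pr_I0)
  ultimately show ?thesis
    using top_facts(1)[OF i(1)] top_facts(1)[OF pr_in_I0[OF i(1)]] by blast
qed

lemma psi_one: "psi (zeroA, {}) = wzero"
proof -
  have "dh (zeroA, {}) k d = (0 :: 'a)" for k d
    by (cases "k \<in> II") (simp_all add: dh_apply dh_outside del_bas, simp add: osmul_def pdcoef_def)
  then have "dh (zeroA, {}) = (wzero :: 'a Wel)" by (simp add: wzero_def fun_eq_iff)
  then show ?thesis by (simp add: psi_def phi_wzero)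
qed

lemma only_entry:
  assumes "(\<alpha>, {}) \<in> BB" "i \<in> I0 m" "absA m \<alpha> \<le> \<alpha> i"
  shows "\<alpha> = (\<lambda>j. \<alpha> i * epsA i j)"
proof
  fix j
  show "\<alpha> j = \<alpha> i * epsA i j"
  proof (cases "j \<in> I0 m \<and> j \<noteq> i")
    case True
    then show ?thesis using absA_ge2[OF assms(2), of j \<alpha>] assms(3) by (simp add: epsA_def)
  next
    case False
    moreover have "\<alpha> j = 0" if "j \<notin> I0 m" using assms(1) that by (simp add: in_BB_iff)
    ultimately show ?thesis by (cases "j = i") (simp_all add: epsA_def)
  qed
qed

text \<open>A nonzero exponent divisible by \<open>p\<close> can be peeled off unless it stands
  alone, and then \<open>binomial_zero\<close> makes it a power of \<open>p\<close>. Otherwise each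
  pair of exponents is zero or maximal, and a zero pair beside a maximal one is excluded by a
  bracket joining the two pairs.\<close>

lemma C_kap_support:
  assumes \<alpha>: "(\<alpha>, {}) \<in> BB" and nz: "C (\<alpha>, {}) kap v \<noteq> 0"
  shows "\<alpha> = piA m p t \<or> (\<exists>i\<in>I0 m. \<exists>e. 1 \<le> e \<and> e < t i \<and> \<alpha> = (\<lambda>j. p ^ e * epsA i j))"
proof -
  have "(\<alpha>, {}) \<in> HI" using \<alpha> by (simp add: HI_empty)
  from C_nonzero[OF this nz] have v: "v \<subseteq> I1 m n" by auto
  note cl = closed_kap[OF v]
  have kne: "kap \<noteq> i" "kap \<noteq> pr i" if "i \<in> I0 m" for i
    using that I1_facts(2)[OF kap_I1] pr_in_I0[OF that] by auto
  have dich: "(p dvd \<alpha> i \<and> p dvd \<alpha> (pr i)) \<or> (\<alpha> i + 1 = p ^ t i \<and> \<alpha> (pr i) + 1 = p ^ t (pr i))"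
    if "i \<in> I0 m" for i by (rule pair_dichotomy[OF that kne[OF that] \<alpha> nz])
  have lt: "\<alpha> i < p ^ t i" if "i \<in> I0 m" for i using \<alpha> that by (simp add: in_BB_iff)
  show ?thesis
  proof (cases "\<exists>i\<in>I0 m. p dvd \<alpha> i \<and> \<alpha> i > 0")
    case True
    then obtain i where i: "i \<in> I0 m" "p dvd \<alpha> i" "\<alpha> i > 0" by blast
    note j = pr_in_I0[OF i(1)]
    have pj: "p dvd \<alpha> (pr i)" using dich[OF i(1)] i(2) top_facts(1)[OF i(1)] by blast
    have "absA m \<alpha> \<le> \<alpha> i"
    proof (rule ccontr)
      assume "\<not> absA m \<alpha> \<le> \<alpha> i"
      then have "C (\<alpha>, {}) kap v = 0"
        using i by (intro peel_zero[OF cl i(1) \<alpha> mult_p_lt mult_p_lt]) (use i j pj lt in auto)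
      then show False using nz by simp
    qed
    note only = only_entry[OF \<alpha> i(1) this]
    have "\<exists>e. \<alpha> i = p ^ e"
    proof (rule ccontr)
      assume "\<nexists>e. \<alpha> i = p ^ e"
      then obtain w where w: "w \<ge> 1" "p ^ w < \<alpha> i" "\<not> p dvd \<alpha> i choose p ^ w"
        using binomial_prime_power_not_dvd[OF prime_p i(2,3)] by metis
      have "\<alpha> (pr i) = 0" using fun_cong[OF only, of "pr i"] pr_neq[OF i(1)] by (simp add: epsA_def)
      then have "C (\<alpha>, {}) kap v = 0"
        using w p_power_pos[of w] absA_ge[OF i(1), of \<alpha>]
        by (intro binomial_zero[OF cl i(1) \<alpha>, of "p ^ w"]) linarith+
      then show False using nz by simp
    qed
    then obtain e where e: "\<alpha> i = p ^ e" by blast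
    have "e \<ge> 1" using i(2) e prime_p by (cases e) auto
    moreover have "e < t i" using lt[OF i(1)] e p_gt by (simp add: power_less_imp_less_exp)
    ultimately show ?thesis using i(1) only e by metis
  next
    case False
    then have dich': "(\<alpha> i = 0 \<and> \<alpha> (pr i) = 0) \<or> (\<alpha> i + 1 = p ^ t i \<and> \<alpha> (pr i) + 1 = p ^ t (pr i))"
      if "i \<in> I0 m" for i using dich[OF that] that pr_in_I0[OF that] by auto
    show ?thesis
    proof (cases "\<exists>i\<in>I0 m. \<alpha> i = 0")
      case False
      have "\<alpha> j = piA m p t j" for j
      proof (cases "j \<in> I0 m")
        case True
        then have "\<alpha> j + 1 = p ^ t j" using dich'[OF True] False by blast
        then show ?thesis using True by (simp add: piA_def)
      qed (use \<alpha> in \<open>simp add: in_BB_iff piA_def\<close>)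
      then have "\<alpha> = piA m p t" by (simp add: fun_eq_iff)
      then show ?thesis by blast
    next
      case True
      then obtain i where i: "i \<in> I0 m" "\<alpha> i = 0" by blast
      note ne = pr_neq[OF i(1)]
      have i': "\<alpha> (pr i) = 0" using dich'[OF i(1)] i(2) top_facts(3)[OF i(1)] by fastforce
      have "\<alpha> \<noteq> zeroA" using nz psi0_C[OF psi_one] by auto
      then obtain a where a: "\<alpha> a \<noteq> 0" by (auto simp: zeroA_def fun_eq_iff)
      then have aI: "a \<in> I0 m" using \<alpha> by (metis in_BB_iff)
      then have at: "\<alpha> a + 1 = p ^ t a" using dich'[OF aI] a by simp
      have an: "a \<noteq> i" "a \<noteq> pr i" using a i i' by auto
      \<comment> \<open>Chosen so that the bracket with \<open>x_a x_i\<close> returns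
        \<open>\<alpha>\<close> with coefficient \<open>\<alpha> a\<close>, which is -1. Its other
        term has exponent 1 at \<open>i\<close> and is killed by \<open>sq_zero\<close>.\<close>
      define \<beta> where "\<beta> = \<alpha>(a := \<alpha> a - 1, pr i := 1)"
      have one: "1 < p ^ t j" if "j \<in> I0 m" for j using p_le_power[OF that] p_gt by linarith
      have "(\<beta>, {}) \<in> BB"
        unfolding \<beta>_def using aI i \<alpha> lt[OF aI] one by (intro BB_upd) auto
      then have c: "(\<beta>, {}) \<in> HI" by (simp add: HI_empty)
      have kap: "kap \<in> II" using kap_I1 by (simp add: II_iff)
      have q: "(\<lambda>l. epsA a l + epsA i l) = zeroA(a := 1, i := 1)"
        using an by (auto simp: epsA_def zeroA_def fun_eq_iff)
      have L: "lhs (zeroA(a := 1, i := 1), {}) (\<beta>, {}) kap v = 0"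
        using quadratic_relation[OF aI i(1) c kap v] kne aI i unfolding q by simp
      have T1: "C (\<beta>(pr a := \<beta> (pr a) - 1, i := 1 + \<beta> i), {}) kap v = 0"
      proof (rule sq_zero[OF i(1) kne(2)[OF i(1)]])
        have ap: "pr a \<noteq> i" "pr a \<noteq> pr i" using an aI i(1) by (metis pr_pr_I0)+
        have bi: "\<beta> i = 0" "\<beta> (pr i) = 1" using an ne i by (auto simp: \<beta>_def)
        have "\<beta> (pr a) - 1 < p ^ t (pr a)"
          using \<open>(\<beta>, {}) \<in> BB\<close> aI by (auto simp: in_BB_iff intro: le_less_trans[OF diff_le_self])
        then show "(\<beta>(pr a := \<beta> (pr a) - 1, i := 1 + \<beta> i), {}) \<in> BB"
          using \<open>(\<beta>, {}) \<in> BB\<close> aI i one bi by (intro BB_upd) auto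
        show "\<not> p dvd (\<beta>(pr a := \<beta> (pr a) - 1, i := 1 + \<beta> i)) i" using bi p_gt by simp
        show "(\<beta>(pr a := \<beta> (pr a) - 1, i := 1 + \<beta> i)) (pr i) + 1 < p ^ t (pr i)"
          using bi ne ap p_le_power[OF pr_in_I0[OF i(1)]] p_gt by simp
      qed
      have e: "\<beta>(pr i := \<beta> (pr i) - 1, a := 1 + \<beta> a, i := 1 - 1 + \<beta> i) = \<alpha>"
        using an ne i i' a by (auto simp: \<beta>_def fun_eq_iff)
      have "tau i * of_nat (1 + \<beta> a) * C (\<alpha>, {}) kap v = 0"
        using L an ne unfolding lhs_mixed[OF i(1) aI an] T1 e by (simp add: \<beta>_def)
      moreover have "1 + \<beta> a = \<alpha> a" using an a by (simp add: \<beta>_def)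
      ultimately have "tau i * of_nat (\<alpha> a) * C (\<alpha>, {}) kap v = 0" by (simp only:)
      then show ?thesis using nz top_facts(2)[OF aI at] by simp
    qed
  qed
qed

section \<open>The vector field component\<close>

lemma only_two:
  assumes "(\<alpha>, {}) \<in> BB" "i \<in> I0 m" "y \<in> I0 m" "i \<noteq> y" "absA m \<alpha> \<le> \<alpha> i + \<alpha> y"
  shows "\<alpha> = (\<lambda>j. \<alpha> i * epsA i j + \<alpha> y * epsA y j)"
proof
  fix j
  consider "j \<notin> I0 m" | "j = i" | "j = y" | "j \<in> I0 m" "j \<noteq> i" "j \<noteq> y" by blast
  then show "\<alpha> j = \<alpha> i * epsA i j + \<alpha> y * epsA y j"
  proof cases
    case 1
    then have "\<alpha> j = 0" using assms(1) by (simp add: in_BB_iff)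
    then show ?thesis using 1 assms(2,3) by (auto simp: epsA_def)
  next
    case 4
    have "absA m (\<alpha>(i := 0)) + \<alpha> i = absA m \<alpha>" using absA_upd[OF assms(2), of \<alpha> 0] by simp
    moreover have "\<alpha> y + \<alpha> j \<le> absA m (\<alpha>(i := 0))"
      using absA_ge2[OF assms(3) 4(1), of "\<alpha>(i := 0)"] 4 assms(4) by simp
    ultimately have "\<alpha> j = 0" using assms(5) by linarith
    then show ?thesis using 4 by (simp add: epsA_def)
  qed (use assms(4) in \<open>auto simp: epsA_def\<close>)
qed

lemma p_power_ge:
  assumes "w \<ge> 1"
  shows "p \<le> p ^ w" "p dvd p ^ w"
  using assms power_increasing[of 1 w p] p_gt by (simp_all add: dvd_power)

lemma low_degree_zero:
  assumes \<alpha>: "(\<alpha>, {}) \<in> BB" and d: "absA m \<alpha> \<le> 2"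
  shows "C (\<alpha>, {}) k v = 0"
proof (cases "absA m \<alpha> = 0")
  case True
  have "\<alpha> j = 0" for j
    using absA_ge[of j \<alpha>] True \<alpha> by (cases "j \<in> I0 m") (auto simp: in_BB_iff)
  then have "\<alpha> = zeroA" by (simp add: fun_eq_iff)
  then show ?thesis using psi0_C[OF psi_one] by simp
next
  case False
  then have "zdO m (\<alpha>, {}) \<in> {1, 2}" using d by (auto simp: zdO_def)
  then show ?thesis using \<alpha> by (intro psi0_C psi_low_degree) (simp_all add: HI_empty)
qed

text \<open>The component contributes a weight, so with \<open>y = pr k\<close> the exponent at
  \<open>y\<close> is congruent to \<open>\<alpha> k + 1\<close>. The argument parallels that for
  \<open>kap\<close>, but brackets now need degree 3 in both factors, and the pair of
  \<open>k\<close> and \<open>y\<close>, to which the dichotomy does not apply, is treated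
  separately.\<close>

lemma C_I0_support:
  assumes k: "k \<in> I0 m" and \<alpha>: "(\<alpha>, {}) \<in> BB" and nz: "C (\<alpha>, {}) k v \<noteq> 0"
  shows "\<exists>i\<in>I0 m. \<exists>e. 1 \<le> e \<and> e < t i \<and> \<alpha> = (\<lambda>j. p ^ e * epsA i j + epsA (pr k) j)"
proof -
  have HI: "(\<alpha>, {}) \<in> HI" using \<alpha> by (simp add: HI_empty)
  have v: "v \<subseteq> I1 m n" and kI: "k \<in> II" using C_nonzero[OF HI nz] by auto
  note cl = closed_high[OF v kI]
  define y where "y = pr k"
  have y: "y \<in> I0 m" "y \<noteq> k" "pr y = k" "pr k = y" using k pr_neq[OF k] by (simp_all add: y_def)
  have lt: "\<alpha> i < p ^ t i" if "i \<in> I0 m" for i using \<alpha> that by (simp add: in_BB_iff)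
  have deg: "absA m \<alpha> \<ge> 3" using low_degree_zero[OF \<alpha>] nz by (metis not_less_eq_eq numeral_2_eq_2 numeral_3_eq_3)
  have "int p dvd int (\<alpha> y) - int (\<alpha> k) - 1"
    using sp_weight[OF k HI nz] y by simp
  then have "of_int (int (\<alpha> y) - int (\<alpha> k) - 1) = (0 :: 'a)" by (simp only: of_int_eq_0_iff_char_dvd char_p)
  then have W: "of_nat (\<alpha> y) = of_nat (\<alpha> k) + (1 :: 'a)" by (simp add: algebra_simps)
  have two: "of_int 2 \<noteq> (0 :: 'a)" using small_int[of 2 1] by auto
  have pk: "p dvd \<alpha> k"
  proof (rule ccontr)
    assume pk: "\<not> p dvd \<alpha> k"
    have yt: "\<alpha> y + 1 = p ^ t y"
      using sq_zero[OF k _ \<alpha> pk, of k v] y nz lt[OF y(1)] by (metis Suc_eq_plus1 Suc_lessI)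
    note ty = top_facts[OF y(1) yt]
    have wk: "of_nat (\<alpha> k) = (-2 :: 'a)" using W ty(2) by (simp add: algebra_simps eq_neg_iff_add_eq_0)
    then have "of_nat (\<alpha> k + 2) = (0 :: 'a)" by simp
    then have "p dvd \<alpha> k + 2" by (simp only: of_nat_zero_iff)
    then have "p \<le> \<alpha> k + 2" by (rule dvd_imp_le) simp
    then have k3: "\<alpha> k \<ge> 3" using p_ge_5 by linarith
    \<comment> \<open>In the field \<open>\<alpha> k = -2\<close> and
      \<open>\<alpha> y = -1\<close>. The bracket with \<open>x_k^(2) x_y\<close>, of the minimal
      degree 3, returns \<open>\<alpha>\<close> with coefficient \<open>2 - 3\<close> up to sign:
      the product of these two values minus \<open>\<alpha> k choose 2\<close>.\<close>
    define \<beta> where "\<beta> = \<alpha>(k := \<alpha> k - 1)"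
    have b: "(\<beta>, {}) \<in> BB" unfolding \<beta>_def using k lt[OF k] \<alpha> by (intro BB_upd) auto
    have d: "3 \<le> absA m \<beta>"
      using absA_upd[OF k, of \<alpha> "\<alpha> k - 1"] absA_ge2[OF k y(1), of \<alpha>] y(2) k3 ty(3) unfolding \<beta>_def by linarith
    have b1: "\<beta> k = \<alpha> k - 1" "\<beta> y = \<alpha> y" using y by (simp_all add: \<beta>_def)
    define c2 where "c2 = \<alpha> k choose 2"
    have "2 * c2 = \<alpha> k * (\<alpha> k - 1)"
      using times_binomial_minus1_eq[of 2 "\<alpha> k"] by (simp add: c2_def)
    then have "of_nat (2 * c2) = (of_nat (\<alpha> k) * of_nat (\<alpha> k - 1) :: 'a)" by (metis of_nat_mult)
    then have c2: "2 * of_nat c2 = (6 :: 'a)" using wk k3 by (simp add: of_nat_diff)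
    have "C (\<beta>(k := 2 + \<beta> k - 1, pr k := 1 + \<beta> (pr k) - 1), {}) k v = 0"
    proof (rule pair_zero[OF cl k _ _ _ b d])
      show "2 < p ^ t k" "1 < p ^ t (pr k)"
        using p_le_power[OF k] p_le_power[OF y(1)] p_gt y by auto
      have "(if 2 > (0::nat) \<and> \<beta> (pr k) > 0
          then of_nat ((2 - 1 + \<beta> k choose (2 - 1)) * (1 + (\<beta> (pr k) - 1) choose 1)) else 0)
        - (if 1 > (0::nat) \<and> \<beta> k > 0
          then of_nat ((2 + (\<beta> k - 1) choose 2) * (1 - 1 + \<beta> (pr k) choose (1 - 1))) else 0)
        = of_nat (\<alpha> k) * of_nat (\<alpha> y) - (of_nat c2 :: 'a)"
      proof -
        have "2 - 1 + \<beta> k = \<alpha> k" "2 + (\<beta> k - 1) = \<alpha> k" "1 + (\<beta> y - 1) = \<alpha> y" "\<beta> k > 0" "\<beta> y > 0"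
          using b1 k3 ty(3) by linarith+
        then show ?thesis unfolding y(4) by (simp add: c2_def)
      qed
      also have "\<dots> = 2 - of_nat c2" by (simp add: wk ty(2))
      also have "\<dots> \<noteq> 0"
      proof
        assume "2 - of_nat c2 = (0 :: 'a)"
        then have "of_nat c2 = (2 :: 'a)" by simp
        then have "(2 :: 'a) * 2 = 6" using c2 by (simp only:)
        then have "6 - 2 * 2 = (0 :: 'a)" by (simp only: diff_self)
        then have "(2 :: 'a) = 0" by simp
        then show False using two by simp
      qed
      finally show "(if 2 > (0::nat) \<and> \<beta> (pr k) > 0
          then of_nat ((2 - 1 + \<beta> k choose (2 - 1)) * (1 + (\<beta> (pr k) - 1) choose 1)) else 0)
        - (if 1 > (0::nat) \<and> \<beta> k > 0
          then of_nat ((2 + (\<beta> k - 1) choose 2) * (1 - 1 + \<beta> (pr k) choose (1 - 1))) else 0) \<noteq> (0 :: 'a)" .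
    qed simp
    moreover have "\<beta>(k := 2 + \<beta> k - 1, pr k := 1 + \<beta> (pr k) - 1) = \<alpha>"
      using b1 k3 y by (auto simp: \<beta>_def fun_eq_iff)
    ultimately show False using nz by simp
  qed
  then have "of_nat (\<alpha> k) = (0 :: 'a)" by (simp only: of_nat_zero_iff)
  then have wy: "of_nat (\<alpha> y) = (1 :: 'a)" using W by simp
  have ypos: "\<alpha> y \<ge> 1" using wy by (cases "\<alpha> y") auto
  have py: "p dvd \<alpha> y - 1"
  proof -
    have "of_nat (\<alpha> y - 1) = (0 :: 'a)" using wy ypos by (simp add: of_nat_diff)
    then show ?thesis by (simp only: of_nat_zero_iff)
  qed
  have ylt: "\<alpha> y + 1 < p ^ t y"
  proof (rule ccontr)
    assume "\<not> \<alpha> y + 1 < p ^ t y"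
    then have "\<alpha> y + 1 = p ^ t y" using lt[OF y(1)] by linarith
    then have "(1 :: 'a) = -1" using top_facts(2)[OF y(1)] wy by metis
    then show False using two by (simp add: eq_neg_iff_add_eq_0)
  qed
  have klt: "\<alpha> k + 1 < p ^ t k" by (rule mult_p_lt[OF k pk lt[OF k]])
  have dich: "(p dvd \<alpha> i \<and> p dvd \<alpha> (pr i)) \<or> (\<alpha> i + 1 = p ^ t i \<and> \<alpha> (pr i) + 1 = p ^ t (pr i))"
    if "i \<in> I0 m" "i \<noteq> k" "i \<noteq> y" for i
    using pair_dichotomy[OF that(1) _ _ \<alpha> nz] that y by (metis pr_pr_I0)
  show ?thesis
  proof (cases "\<exists>i\<in>I0 m. i \<noteq> y \<and> p dvd \<alpha> i \<and> \<alpha> i > 0")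
    case True
    then obtain i where i: "i \<in> I0 m" "i \<noteq> y" "p dvd \<alpha> i" "\<alpha> i > 0" by blast
    have ip: "\<alpha> i \<ge> p" using i(3,4) by (simp add: dvd_imp_le)
    have prlt: "\<alpha> (pr i) + 1 < p ^ t (pr i)"
    proof (cases "i = k")
      case False
      then have "p dvd \<alpha> (pr i)" using dich[OF i(1) False i(2)] i(3) top_facts(1)[OF i(1)] by blast
      then show ?thesis using mult_p_lt[OF pr_in_I0[OF i(1)]] lt i(1) by simp
    qed (use ylt y in simp)
    \<comment> \<open>Peeling fails only if the second factor has degree below 3, which leaves room
      for one further unit; \<open>\<alpha> y \<ge> 1\<close> takes it.\<close>
    have "absA m \<alpha> \<le> \<alpha> i + 1"
    proof (rule ccontr)
      assume "\<not> absA m \<alpha> \<le> \<alpha> i + 1"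
      then have "C (\<alpha>, {}) k v = 0"
        using ip p_ge_5 by (intro peel_zero[OF cl i(1) \<alpha> mult_p_lt[OF i(1,3) lt[OF i(1)]] prlt]) linarith+
      then show False using nz by simp
    qed
    moreover have "\<alpha> i + \<alpha> y \<le> absA m \<alpha>" by (rule absA_ge2[OF i(1) y(1) i(2)])
    ultimately have y1: "\<alpha> y = 1" and ab: "absA m \<alpha> = \<alpha> i + 1" using ypos by linarith+
    have only: "\<alpha> = (\<lambda>j. \<alpha> i * epsA i j + epsA y j)"
      using only_two[OF \<alpha> i(1) y(1) i(2)] ab y1 by simp
    have "\<exists>e. \<alpha> i = p ^ e"
    proof (rule ccontr)
      assume "\<nexists>e. \<alpha> i = p ^ e"
      then obtain w where w: "w \<ge> 1" "p ^ w < \<alpha> i" "\<not> p dvd \<alpha> i choose p ^ w"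
        using binomial_prime_power_not_dvd[OF prime_p i(3,4)] by metis
      note pw = p_power_ge[OF w(1)]
      define N M where "N = \<alpha> i" and "M = p ^ w"
      have M: "M \<ge> 5" "M < N" "p dvd M" "p dvd N" "\<not> p dvd N choose M"
        using pw p_ge_5 w i by (auto simp: M_def N_def)
      have "C (\<alpha>, {}) k v = 0"
      proof (cases "i = k")
        case False
        have "pr i \<noteq> y" using False i(1) y by (metis pr_pr_I0)
        then have "\<alpha> (pr i) = 0" using fun_cong[OF only, of "pr i"] pr_neq[OF i(1)] by (simp add: epsA_def)
        then show ?thesis
          using M ab by (intro binomial_zero[OF cl i(1) \<alpha>, of M]) (auto simp: N_def)
      next
        case ik: True
        \<comment> \<open>Here \<open>y\<close> occurs in both factors, so the coefficient is
          \<open>N choose (M - 1)\<close> minus \<open>N choose M\<close>, up to sign. The former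
          vanishes modulo \<open>p\<close> since
          \<open>(N - M + 1) * (N choose (M - 1)) = M * (N choose M)\<close> with \<open>p\<close>
          dividing \<open>M\<close> but not \<open>N - M + 1\<close>.\<close>
        define \<beta> where "\<beta> = \<alpha>(k := N - M + 1)"
        have b: "(\<beta>, {}) \<in> BB" unfolding \<beta>_def using k lt[OF k] \<alpha> M ik by (intro BB_upd) (auto simp: N_def)
        have d: "3 \<le> absA m \<beta>"
          using absA_upd[OF k, of \<alpha> "N - M + 1"] ab M ik unfolding \<beta>_def N_def by simp
        have b1: "\<beta> k = N - M + 1" "\<beta> y = 1" using y y1 by (simp_all add: \<beta>_def)
        have "p dvd N - M" using M by simp
        then have "\<not> p dvd N - M + 1" using p_gt
          by (metis dvd_add_right_iff nat_dvd_1_iff_1 less_numeral_extra(4) not_numeral_less_one)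
        moreover have "(N - (M - 1)) * (N choose (M - 1)) = M * (N choose M)"
          using times_binomial_minus1_eq[of M N] binomial_absorb_comp[of N "M - 1"] M(1) by simp
        then have "p dvd (N - M + 1) * (N choose (M - 1))" using M by (simp add: Suc_diff_le)
        ultimately have "p dvd N choose (M - 1)" using prime_dvd_multD[OF prime_p] by blast
        then have z: "of_nat (N choose (M - 1)) = (0 :: 'a)" by (simp only: of_nat_zero_iff)
        have nz2: "of_nat (N choose M) \<noteq> (0 :: 'a)" using M(5) by (simp only: of_nat_zero_iff not_False_eq_True)
        have "C (\<beta>(k := M + \<beta> k - 1, pr k := 1 + \<beta> (pr k) - 1), {}) k v = 0"
        proof (rule pair_zero[OF cl k _ _ _ b d])
          show "M < p ^ t k" using M lt[OF k] ik by (simp add: N_def)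
          show "1 < p ^ t (pr k)" using p_le_power[OF y(1)] p_gt y by simp
          show "3 \<le> M + 1" using M by simp
          have "M - 1 + \<beta> k = N" "M + (\<beta> k - 1) = N" "\<beta> k > 0" using b1 M by linarith+
          then show "(if M > 0 \<and> \<beta> (pr k) > 0
              then of_nat ((M - 1 + \<beta> k choose (M - 1)) * (1 + (\<beta> (pr k) - 1) choose 1)) else 0)
            - (if 1 > (0::nat) \<and> \<beta> k > 0
              then of_nat ((M + (\<beta> k - 1) choose M) * (1 - 1 + \<beta> (pr k) choose (1 - 1))) else 0) \<noteq> (0 :: 'a)"
            unfolding y(4) using b1 z nz2 by simp
        qed
        moreover have "\<beta>(k := M + \<beta> k - 1, pr k := 1 + \<beta> (pr k) - 1) = \<alpha>"
          using b1 M y ik by (auto simp: \<beta>_def N_def fun_eq_iff)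
        ultimately show ?thesis by simp
      qed
      then show False using nz by simp
    qed
    then obtain e where e: "\<alpha> i = p ^ e" by blast
    have "e \<ge> 1" using i(3) e prime_p by (cases e) auto
    moreover have "e < t i" using lt[OF i(1)] e p_gt by (simp add: power_less_imp_less_exp)
    ultimately show ?thesis using i(1) only e unfolding y(4) by metis
  next
    case False
    then have k0: "\<alpha> k = 0" using pk k y(2) by auto
    have rest: "\<alpha> i = 0 \<or> \<alpha> i + 1 = p ^ t i" if "i \<in> I0 m" "i \<noteq> y" for i
      using dich[OF that(1) _ that(2)] False that k0 by (cases "i = k") auto
    show ?thesis
    proof (cases "\<alpha> y = 1")
      case y1: False
      have "absA m \<alpha> \<le> \<alpha> y + 1"
      proof (rule ccontr)
        assume "\<not> absA m \<alpha> \<le> \<alpha> y + 1"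
        then have "C (\<alpha>, {}) k v = 0"
          using y1 ypos klt ylt y by (intro peel_zero[OF cl y(1) \<alpha>]) auto
        then show False using nz by simp
      qed
      have z: "\<alpha> j = 0" if "j \<noteq> y" for j
      proof (cases "j \<in> I0 m")
        case True
        have "\<alpha> j \<le> 1" using absA_ge2[OF y(1) True, of \<alpha>] that \<open>absA m \<alpha> \<le> \<alpha> y + 1\<close> by simp
        then show ?thesis using rest[OF True that] top_facts(3)[OF True] by fastforce
      qed (use \<alpha> in \<open>simp add: in_BB_iff\<close>)
      have ab: "absA m \<alpha> = \<alpha> y" unfolding absA_def by (rule sum_single) (use y z in auto)
      \<comment> \<open>In this case the power of \<open>p\<close> and the extra unit share the
        exponent at \<open>y\<close>, so the power is to be found in
        \<open>\<alpha> y - 1\<close>.\<close>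
      define N where "N = \<alpha> y - 1"
      have N: "N > 0" "p dvd N" "\<alpha> y = Suc N" using y1 ypos py by (auto simp: N_def)
      have "\<exists>e. N = p ^ e"
      proof (rule ccontr)
        assume "\<nexists>e. N = p ^ e"
        then obtain w where w: "w \<ge> 1" "p ^ w < N" "\<not> p dvd N choose p ^ w"
          using binomial_prime_power_not_dvd[OF prime_p N(2,1)] by metis
        note pw = p_power_ge[OF w(1)]
        define M where "M = p ^ w"
        have M: "M \<ge> 5" "M < N" "p dvd M" "\<not> p dvd N choose M"
          using pw p_ge_5 w by (auto simp: M_def)
        \<comment> \<open>Two distinct multiples of \<open>p\<close> differ by at least
          \<open>p\<close>, which leaves the second factor of the bracket enough degree.\<close>
        have "p dvd N - M" using M N by simp
        then have "p \<le> N - M" using M by (simp add: dvd_imp_le)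
        then have MN: "M + 5 \<le> N" using p_ge_5 M by linarith
        \<comment> \<open>As \<open>Suc N\<close> is prime to \<open>p\<close>, absorption carries
          non-divisibility from \<open>N choose M\<close> to
          \<open>Suc N choose Suc M\<close>.\<close>
        have "\<not> p dvd Suc N" using N(2) p_gt
          by (metis Suc_eq_plus1 dvd_add_right_iff nat_dvd_1_iff_1 less_numeral_extra(4) not_numeral_less_one)
        then have "\<not> p dvd Suc N * (N choose M)" using M(4) prime_dvd_multD[OF prime_p] by blast
        then have "\<not> p dvd Suc M * (Suc N choose Suc M)" by (subst Suc_times_binomial)
        then have nd: "\<not> p dvd \<alpha> y choose Suc M" unfolding N(3) by (meson dvd_mult)
        have "C (\<alpha>, {}) k v = 0"
          using MN M ab N k0 y nd by (intro binomial_zero[OF cl y(1) \<alpha>, of "Suc M"]) auto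
        then show False using nz by simp
      qed
      then obtain e where e: "N = p ^ e" by blast
      have "e \<ge> 1" using N(2) e prime_p by (cases e) auto
      moreover have "p ^ e < p ^ t y" using ylt N(3) e by linarith
      then have "e < t y" using p_gt by (simp add: power_less_imp_less_exp)
      moreover have "\<alpha> = (\<lambda>j. p ^ e * epsA y j + epsA (pr k) j)"
        using z N(3) e y by (auto simp: epsA_def fun_eq_iff)
      ultimately show ?thesis using y(1) by blast
    next
      case y1: True
      have "\<exists>a\<in>I0 m. a \<noteq> y \<and> \<alpha> a \<noteq> 0"
      proof (rule ccontr)
        assume "\<not> ?thesis"
        then have "absA m \<alpha> = \<alpha> y" unfolding absA_def by (intro sum_single) (use y in auto)
        then show False using deg y1 by simp
      qed
      then obtain a where a: "a \<in> I0 m" "a \<noteq> y" "\<alpha> a \<noteq> 0" by blast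
      then have ak: "a \<noteq> k" using k0 by auto
      have at: "\<alpha> a + 1 = p ^ t a" using rest[OF a(1,2)] a(3) by blast
      note ta = top_facts[OF a(1) at]
      \<comment> \<open>The bracket with \<open>x_a x_y^(2)\<close>, again of degree 3, returns
        \<open>\<alpha>\<close> through the pair of \<open>y\<close> and \<open>k\<close> with
        coefficient \<open>\<alpha> a\<close>, which is -1. The term through the pair of
        \<open>a\<close> keeps exponent 1 at \<open>k\<close> and dies by
        \<open>sq_zero\<close>.\<close>
      define \<beta> where "\<beta> = \<alpha>(a := \<alpha> a - 1, k := 1, y := 0)"
      have one: "3 < p ^ t j" if "j \<in> I0 m" for j using p_le_power[OF that] p_gt by linarith
      have b: "(\<beta>, {}) \<in> BB"
        unfolding \<beta>_def using \<alpha> a k y lt[OF a(1)] one[OF k] one[OF y(1)] p_gt by (intro BB_upd) auto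
      have b1: "\<beta> a = \<alpha> a - 1" "\<beta> k = 1" "\<beta> y = 0" using a ak y by (auto simp: \<beta>_def)
      have dB: "3 \<le> absA m \<beta>" using absA_ge2[OF a(1) k ak, of \<beta>] b1 ta(3) by linarith
      have "absA m (zeroA(a := 1, y := 2)) = 3" using absA_upd2[OF a(1) y(1) a(2), of zeroA 1 2] by simp
      moreover have "(zeroA(a := 1, y := 2), {}) \<in> BB"
        using a(1) y(1) one[OF a(1)] one[OF y(1)] by (intro BB_upd zeroA_BB) auto
      ultimately have L: "lhs (zeroA(a := 1, y := 2), {}) (\<beta>, {}) k v = 0"
        using cl b dB unfolding bracket_closed_def by simp
      have ay: "a \<noteq> pr y" using ak y by simp
      have ap: "pr a \<noteq> y" "pr a \<noteq> k" using a ak y by (metis pr_pr_I0)+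
      have T1: "C (\<beta>(pr a := \<beta> (pr a) - 1, y := 2 + \<beta> y), {}) k v = 0"
      proof (rule sq_zero[OF k])
        have "\<beta> (pr a) - 1 < p ^ t (pr a)"
          using b a(1) by (auto simp: in_BB_iff intro: le_less_trans[OF diff_le_self])
        then show "(\<beta>(pr a := \<beta> (pr a) - 1, y := 2 + \<beta> y), {}) \<in> BB"
          using b a y one[OF y(1)] b1 by (intro BB_upd) auto
        show "\<not> p dvd (\<beta>(pr a := \<beta> (pr a) - 1, y := 2 + \<beta> y)) k" using b1 ap y p_gt by simp
        show "(\<beta>(pr a := \<beta> (pr a) - 1, y := 2 + \<beta> y)) (pr k) + 1 < p ^ t (pr k)"
          unfolding y(4) using b1 one[OF y(1)] by simp
        show "k \<noteq> pr k" using y by simp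
      qed
      have e: "\<beta>(pr y := \<beta> (pr y) - 1, a := 1 + \<beta> a, y := 2 - 1 + \<beta> y) = \<alpha>"
        using a ak y k0 y1 b1 by (auto simp: \<beta>_def fun_eq_iff)
      have "tau y * of_nat (1 + \<beta> a) * C (\<alpha>, {}) k v = 0"
        using L unfolding lhs_mixed[OF y(1) a(1,2) ay] T1 e unfolding y(3) using b1 by simp
      moreover have "1 + \<beta> a = \<alpha> a" using b1 a by simp
      ultimately have "tau y * of_nat (\<alpha> a) * C (\<alpha>, {}) k v = 0" by (simp only:)
      then show ?thesis using nz ta(2) by simp
    qed
  qed
qed

text \<open>Equivariance under sp(m) ties the components together: partners through
  \<open>sp_square\<close>, all others through the quadratic element \<open>x_(pr k) x_l\<close>.
  Hence one scalar per \<open>j\<close> and \<open>e\<close> remains.\<close>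

lemma C_I0_consistent:
  assumes k: "k \<in> I0 m" and l: "l \<in> I0 m" and j: "j \<in> I0 m" and e: "1 \<le> e" "e < t j" and v: "v \<subseteq> I1 m n"
  shows "tau k * C (\<lambda>i. p ^ e * epsA j i + epsA (pr k) i, {}) k v
    = tau l * C (\<lambda>i. p ^ e * epsA j i + epsA (pr l) i, {}) l v"
proof -
  let ?N = "p ^ e"
  have N: "?N + 1 < p ^ t j"
    using e p_gt t_pos[OF j] by (intro mult_p_lt[OF j]) (auto intro: power_strict_increasing simp: dvd_power)
  have Np: "p dvd ?N" "?N > 0" "?N \<noteq> 1" using p_power_ge[OF e(1)] p_gt e(1) by auto
  have kI: "k \<in> II" using k by (simp add: II_iff)
  have one: "2 < p ^ t j" if "j \<in> I0 m" for j using p_le_power[OF that] p_gt by linarith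
  define \<beta> where "\<beta> = (\<lambda>i. ?N * epsA j i + epsA (pr l) i)"
  have \<beta>: "(\<beta>, {}) \<in> HI"
    using N e(2) j l one[OF pr_in_I0[OF l]] p_gt by (auto simp: \<beta>_def HI_empty in_BB_iff epsA_def)
  show ?thesis
  proof (cases "k = l")
    case kl: False
    note nk = pr_neq[OF k] and nl = pr_neq[OF l]
    show ?thesis
    proof (cases "k = pr l")
      case True
      have pk: "pr k = l" using True l by simp
      have "(if \<beta> (pr l) > 0 then of_nat (\<beta> l + 1) else 0) * C (\<beta>(l := \<beta> l + 1, pr l := \<beta> (pr l) - 1), {}) k v
        = - C (\<beta>, {}) l v"
        using sp_square[OF l \<beta> kI v] True by simp
      moreover have "\<beta>(l := \<beta> l + 1, pr l := \<beta> (pr l) - 1) = (\<lambda>i. ?N * epsA j i + epsA (pr k) i)"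
        using nl unfolding pk \<beta>_def by (auto simp: epsA_def fun_eq_iff)
      moreover have "\<beta> (pr l) > 0" by (simp add: \<beta>_def epsA_def)
      moreover have "of_nat (\<beta> l + 1) = (1 :: 'a)"
      proof -
        have "p dvd \<beta> l" using nl Np(1) by (auto simp: \<beta>_def epsA_def)
        then have "of_nat (\<beta> l) = (0 :: 'a)" by (simp only: of_nat_zero_iff)
        then show ?thesis by simp
      qed
      ultimately have "C (\<lambda>i. ?N * epsA j i + epsA (pr k) i, {}) k v = - C (\<beta>, {}) l v" by simp
      then show ?thesis unfolding \<beta>_def using True l by (simp add: tau_pr_I0)
    next
      case False
      define a where "a = pr k"
      have "pr k \<noteq> pr l" "pr k \<noteq> l" using kl False k l by (metis pr_pr_I0)+
      then have a: "a \<in> I0 m" "pr a = k" "a \<noteq> l" "a \<noteq> pr l" "k \<noteq> a"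
        using k nk by (auto simp: a_def)
      have q: "(\<lambda>i. epsA a i + epsA l i) = zeroA(a := 1, l := 1)"
        using a by (auto simp: epsA_def fun_eq_iff)
      have R: "lhs (zeroA(a := 1, l := 1), {}) (\<beta>, {}) k v = tau k * C (\<beta>, {}) l v"
        using quadratic_relation[OF a(1) l \<beta> kI v] a False k unfolding q by (simp add: a_def tau_pr_I0)
      \<comment> \<open>By \<open>C_I0_support\<close> a nonzero value requires a positive exponent
        at \<open>a = pr k\<close>, but this monomial has none there.\<close>
      have T1: "(if \<beta> k > 0 then of_nat (1 + \<beta> l choose 1) else 0) * C (\<beta>(k := \<beta> k - 1, l := 1 + \<beta> l), {}) k v = 0"
      proof (rule ccontr)
        assume n: "\<not> ?thesis"
        then have bk: "\<beta> k > 0" and n: "C (\<beta>(k := \<beta> k - 1, l := 1 + \<beta> l), {}) k v \<noteq> 0" by (auto split: if_splits)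
        then have jk: "j = k" using False by (auto simp: \<beta>_def epsA_def split: if_splits)
        have "(\<beta>(k := \<beta> k - 1, l := 1 + \<beta> l), {}) \<in> BB" using n C_notin by blast
        from C_I0_support[OF k this n] obtain i e' where
          "\<beta>(k := \<beta> k - 1, l := 1 + \<beta> l) = (\<lambda>j. p ^ e' * epsA i j + epsA (pr k) j)" by blast
        from fun_cong[OF this, of a] show False
          using a jk kl by (auto simp: \<beta>_def epsA_def a_def split: if_splits)
      qed
      have T2: "\<beta>(pr l := \<beta> (pr l) - 1, a := 1 + \<beta> a, l := 1 - 1 + \<beta> l) = (\<lambda>i. ?N * epsA j i + epsA (pr k) i)"
        using a nl by (auto simp: \<beta>_def epsA_def fun_eq_iff a_def)
      have bp: "\<beta> (pr l) > 0" by (simp add: \<beta>_def epsA_def)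
      have "of_nat (1 + \<beta> a) = (1 :: 'a)"
      proof -
        have "p dvd \<beta> a" using a Np(1) by (auto simp: \<beta>_def epsA_def)
        then have "of_nat (\<beta> a) = (0 :: 'a)" by (simp only: of_nat_zero_iff)
        then show ?thesis by simp
      qed
      then have "lhs (zeroA(a := 1, l := 1), {}) (\<beta>, {}) k v = tau l * C (\<lambda>i. ?N * epsA j i + epsA (pr k) i, {}) k v"
        unfolding lhs_mixed[OF l a(1,3,4)] T2 a(2) using T1 bp by (simp add: mult.assoc)
      then have E: "tau l * C (\<lambda>i. ?N * epsA j i + epsA (pr k) i, {}) k v = tau k * C (\<beta>, {}) l v"
        using R by simp
      have sq: "tau i * (tau i * x) = (x :: 'a)" for i x
        by (metis mult.assoc of_int_1 of_int_mult tau_square mult_1)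
      have "C (\<lambda>i. ?N * epsA j i + epsA (pr k) i, {}) k v = tau l * (tau k * C (\<beta>, {}) l v)"
        using arg_cong[OF E, of "\<lambda>x. tau l * x"] by (simp add: sq)
      then show ?thesis unfolding \<beta>_def by (metis sq mult.left_commute)
    qed
  qed simp
qed

section \<open>The formula for the derivation\<close>

lemma mul_outside: "d \<notin> BB \<Longrightarrow> mul f g d = 0"
  by (simp add: omult_def multcoef_def)

text \<open>With divided powers no factorial appears, so derivatives of order \<open>p ^ q\<close>
  need not vanish in characteristic \<open>p\<close>.\<close>

lemma del_funpow_bas:
  assumes "(\<alpha>, u) \<in> BB" "j \<in> I0 m"
  shows "(del j ^^ N) (bas (\<alpha>, u)) = (if N \<le> \<alpha> j then bas (\<alpha>(j := \<alpha> j - N), u) else (\<lambda>_. 0 :: 'a))"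
proof (induction N)
  case (Suc N)
  show ?case
  proof (cases "N \<le> \<alpha> j")
    case True
    let ?\<beta> = "\<alpha>(j := \<alpha> j - N)"
    have "\<alpha> j - N < p ^ t j" using assms by (auto simp: in_BB_iff intro: le_less_trans[OF diff_le_self])
    then have BB: "(?\<beta>, u) \<in> BB" using assms by (simp add: in_BB_iff)
    have "(del j ^^ Suc N) (bas (\<alpha>, u)) = del j (bas (?\<beta>, u) :: 'a Oel)"
      using Suc True by simp
    also have "\<dots> = (if Suc N \<le> \<alpha> j then bas (\<alpha>(j := \<alpha> j - Suc N), u) else (\<lambda>_. 0))"
    proof (cases "Suc N \<le> \<alpha> j")
      case lt: True
      have "pdmon m j (?\<beta>, u) = (\<alpha>(j := \<alpha> j - Suc N), u)"
        using assms(2) by (simp add: pdmon_def)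
      moreover have "pdcoef m n j (?\<beta>, u) = (1 :: 'a)" using assms(2) lt by (simp add: pdcoef_def)
      ultimately show ?thesis using lt del_bas[OF BB, of j, where ?'a = 'a] by (simp add: osmul_def)
    next
      case False
      then have "pdcoef m n j (?\<beta>, u) = (0 :: 'a)" using assms(2) by (simp add: pdcoef_def)
      then show ?thesis using False del_bas[OF BB, of j, where ?'a = 'a] by (simp add: osmul_def)
    qed
    finally show ?thesis .
  next
    case False
    then show ?thesis using Suc by simp
  qed
qed simp

lemma del_funpow_osmul: "(del j ^^ N) (osmul s f) = osmul s ((del j ^^ N) f)"
  by (induction N) (simp_all add: del_osmul)

text \<open>The minus sign comes from the odd parity of \<open>x^omega\<close>, through
  \<open>gradcoef 1 k\<close>.\<close>

lemma dh_omega: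
  "dh (omegaI m n) k = (if k \<in> I1 m n
     then osmul (- sgnUV {pr k} (I1 m n)) (bas (zeroA, I1 m n - {pr k})) else (\<lambda>_. 0 :: 'a))"
proof -
  have om: "(zeroA, I1 m n) \<in> BB" by simp
  have par: "parO (omegaI m n) = 1"
    using n_odd by (simp add: parO_def omegaI_def card_I1 odd_iff_mod_2_eq_one)
  consider "k \<notin> II" | "k \<in> I0 m" | "k \<in> I1 m n" by (auto simp: II_iff)
  then show ?thesis
  proof cases
    case 1
    then show ?thesis by (simp add: dh_outside II_iff)
  next
    case 2
    then have "del (pr k) (bas (zeroA, I1 m n)) = (\<lambda>_. 0 :: 'a)"
      using del_bas[OF om, of "pr k", where ?'a = 'a] by (simp add: pdcoef_def osmul_def)
    then show ?thesis
      using 2 I0_I1_disjoint[OF 2] by (simp add: dh_apply II_iff omegaI_def) (simp add: osmul_def)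
  next
    case 3
    note f = I1_facts[OF 3]
    have "del (pr k) (bas (zeroA, I1 m n)) = osmul (sgnUV {pr k} (I1 m n)) (bas (zeroA, I1 m n - {pr k}) :: 'a Oel)"
      using f del_bas[OF om, of "pr k", where ?'a = 'a] by (simp add: pdcoef_def pdmon_def)
    moreover have "gradcoef 1 k = (-1 :: 'a)"
      using f I1_facts(8)[OF f(4)] by (simp add: gradcoef_def)
    moreover have "dh (omegaI m n) k = osmul (gradcoef 1 k) (del (pr k) (bas (zeroA, I1 m n)) :: 'a Oel)"
      using f(1) par by (simp add: dh_apply) (simp add: omegaI_def)
    ultimately show ?thesis using 3 by (simp add: osmul_def fun_eq_iff)
  qed
qed

lemma dh_omega_eval: "dh (omegaI m n) k (\<gamma>, v) = (if \<gamma> = zeroA then dh (omegaI m n) k (zeroA, v) else (0 :: 'a))"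
  unfolding dh_omega by (simp add: osmul_def bas_def)

text \<open>A nonempty set of even size is not a single index. Hence \<open>x^u\<close> times a
  component of \<open>D_H(x^omega)\<close> vanishes unless \<open>u\<close> is empty.\<close>

lemma I1_meets:
  assumes "u \<subseteq> I1 m n" "even (card u)" "u \<noteq> {}"
  shows "u \<inter> (I1 m n - {x}) \<noteq> {}"
proof
  assume "u \<inter> (I1 m n - {x}) = {}"
  then have "u = {x}" using assms by auto
  then show False using assms(2) by simp
qed

lemma Phi_eval:
  assumes b: "(\<alpha>, u) \<in> HI" and j: "j \<in> I0 m" and d: "(\<gamma>, v) \<in> BB"
  shows "PhiM m n p t j q (\<alpha>, u) k (\<gamma>, v) =
    (if u = {} \<and> p ^ q \<le> \<alpha> j \<and> \<gamma> = \<alpha>(j := \<alpha> j - p ^ q) then dh (omegaI m n) k (zeroA, v) else (0 :: 'a))"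
proof -
  have bB: "(\<alpha>, u) \<in> BB" and u: "u \<subseteq> I1 m n" "even (card u)" using b by (auto simp: HI_iff in_BB_iff)
  let ?\<beta> = "\<alpha>(j := \<alpha> j - p ^ q)"
  have eq: "PhiM m n p t j q (\<alpha>, u) k (\<gamma>, v) = (if p ^ q \<le> \<alpha> j
      then mul (bas (?\<beta>, u)) (dh (omegaI m n) k) (\<gamma>, v) else (0 :: 'a))"
    by (simp add: PhiM_def omw_def del_funpow_bas[OF bB j])
  show ?thesis
  proof (cases "p ^ q \<le> \<alpha> j \<and> k \<in> I1 m n")
    case False
    then show ?thesis unfolding eq by (auto simp: dh_omega)
  next
    case True
    let ?w = "I1 m n - {pr k}"
    have "\<alpha> j - p ^ q < p ^ t j" using bB j by (auto simp: in_BB_iff intro: le_less_trans[OF diff_le_self])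
    then have BB: "(?\<beta>, u) \<in> BB" using bB j by (simp add: in_BB_iff)
    have BB': "(zeroA, ?w) \<in> BB" by auto
    have bd: "badd (?\<beta>, u) (zeroA, ?w) = (?\<beta>, u \<union> ?w)" by (simp add: badd_def fun_eq_iff)
    have "mul (osmul 1 (bas (?\<beta>, u))) (dh (omegaI m n) k) (\<gamma>, v) =
        (if (\<gamma>, v) = (?\<beta>, u \<union> ?w) then - sgnUV {pr k} (I1 m n) * moncoef m (?\<beta>, u) (zeroA, ?w) else (0 :: 'a))"
      using True d mul_osmul_bas[OF BB BB', of 1 "- sgnUV {pr k} (I1 m n) :: 'a" "(\<gamma>, v)"]
      by (simp add: dh_omega bd)
    moreover have "moncoef m (?\<beta>, u) (zeroA, ?w) = (if u = {} then 1 else (0 :: 'a))"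
      using I1_meets[OF u, of "pr k"] by (simp add: moncoef_def binomA_zeroA)
    moreover have "osmul 1 (bas (?\<beta>, u)) = (bas (?\<beta>, u) :: 'a Oel)" by (simp add: osmul_def)
    ultimately have "mul (bas (?\<beta>, u)) (dh (omegaI m n) k) (\<gamma>, v) =
        (if (\<gamma>, v) = (?\<beta>, u \<union> ?w) then - sgnUV {pr k} (I1 m n) * (if u = {} then 1 else 0) else (0 :: 'a))"
      by (simp only:)
    also have "\<dots> = (if u = {} \<and> \<gamma> = ?\<beta> then (if v = ?w then - sgnUV {pr k} (I1 m n) else 0) else 0)"
      by (cases "u = {}") (simp_all only: if_True if_False Un_empty_left prod.inject, simp_all)
    also have "(if v = ?w then - sgnUV {pr k} (I1 m n) else 0) = (dh (omegaI m n) k (zeroA, v) :: 'a)"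
      using True by (simp add: dh_omega osmul_def bas_def)
    finally have X: "mul (bas (?\<beta>, u)) (dh (omegaI m n) k) (\<gamma>, v) =
        (if u = {} \<and> \<gamma> = ?\<beta> then dh (omegaI m n) k (zeroA, v) else (0 :: 'a))" .
    have le: "p ^ q \<le> \<alpha> j" using True by simp
    show ?thesis unfolding eq X by (simp only: le simp_thms if_True)
  qed
qed

text \<open>The field \<open>dW j\<close> is even with constant coefficient, so bracketing with it
  differentiates each component.\<close>

lemma wb_dW:
  assumes j: "j \<in> I0 m" and E: "E \<in> Wset m n p t"
  shows "wb (dW j) E k = del j (E k :: 'a Oel)"
proof
  fix d
  have one: "(zeroA, {}) \<in> BB" by simp
  have W: "(dW j :: 'a Wel) \<in> Wset m n p t"
    using j one by (auto simp: Wset_def dW_def wsingle_def bas_def II_iff split: if_splits)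
  have ev: "\<forall>i b. (dW j :: 'a Wel) i b \<noteq> 0 \<longrightarrow> even (parO b + mu i)"
    using j by (auto simp: dW_def wsingle_def bas_def parO_def muI_def split: if_splits)
  have "del i (bas (zeroA, {})) = (\<lambda>_. 0 :: 'a)" for i
    using del_bas[OF one, of i, where ?'a = 'a] by (simp add: pdcoef_def osmul_def)
  then have z: "del i ((dW j :: 'a Wel) k) = (\<lambda>_. 0)" for i by (simp add: dW_def wsingle_def)
  have jI: "j \<in> II" using j by (simp add: II_iff)
  have "(\<Sum>i\<in>II. mul (dW j i) (del i (E k)) d) = mul (dW j j) (del j (E k)) d"
    by (rule sum_single) (use jI in \<open>auto simp: dW_def wsingle_def\<close>)
  also have "\<dots> = del j (E k) d"
  proof (cases "d \<in> BB")
    case True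
    then show ?thesis by (simp add: dW_def wsingle_def mul_one)
  next
    case False
    then show ?thesis using del_nonzero_BB[of j "E k" d] by (auto simp: mul_outside)
  qed
  finally show "wb (dW j) E k d = del j (E k) d"
    using wb_expand[OF W E disjI1[OF ev], of k d] z by simp
qed

lemma wb_dW_funpow:
  assumes j: "j \<in> I0 m" and E: "E \<in> Wset m n p t"
  shows "(wb (dW j) ^^ N) E = (\<lambda>k. (del j ^^ N) (E k :: 'a Oel)) \<and> (wb (dW j) ^^ N) E \<in> Wset m n p t"
proof (induction N)
  case (Suc N)
  let ?F = "(wb (dW j) ^^ N) E"
  have F: "?F \<in> Wset m n p t" and eq: "?F = (\<lambda>k. (del j ^^ N) (E k))" using Suc by auto
  have step: "wb (dW j) ?F = (\<lambda>k. del j (?F k))" using wb_dW[OF j F] by (simp add: fun_eq_iff)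
  have "i \<in> II \<and> b \<in> BB" if "del j (?F i) b \<noteq> 0" for i b
  proof
    show "b \<in> BB" using that by (rule del_nonzero_BB)
    have "?F i \<noteq> (\<lambda>_. 0)" using that by auto
    then obtain c where "?F i c \<noteq> 0" by (meson ext)
    then show "i \<in> II" using Wset_D[OF F] by blast
  qed
  then have "wb (dW j) ?F \<in> Wset m n p t" unfolding step Wset_def by blast
  moreover have "wb (dW j) ?F = (\<lambda>k. (del j ^^ Suc N) (E k))" unfolding step using fun_cong[OF eq] by simp
  ultimately show ?case by simp
qed (use E in simp)

text \<open>Multiplication by \<open>x^omega\<close> kills every monomial containing an odd
  variable, and one derivative cannot remove all odd variables of a nonempty even \<open>u\<close>.
  Even monomials have no odd components, so only even components of theirs survive.\<close>

lemma Theta_eval: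
  assumes b: "(\<alpha>, u) \<in> HI" and j: "j \<in> I0 m" and d: "(\<gamma>, v) \<in> BB"
  shows "ThetaM m n p t j q (dh (\<alpha>, u)) k (\<gamma>, v) =
    (if u = {} \<and> k \<in> I0 m \<and> v = I1 m n \<and> 0 < \<alpha> (pr k) \<and> p ^ q \<le> (\<alpha>(pr k := \<alpha> (pr k) - 1)) j
       \<and> \<gamma> = (\<alpha>(pr k := \<alpha> (pr k) - 1))(j := (\<alpha>(pr k := \<alpha> (pr k) - 1)) j - p ^ q)
     then tau (pr k) else (0 :: 'a))"
proof -
  have bB: "(\<alpha>, u) \<in> BB" and u: "u \<subseteq> I1 m n" "even (card u)" using b by (auto simp: HI_iff in_BB_iff)
  have om: "(zeroA, I1 m n) \<in> BB" by simp
  obtain \<beta> w where e: "pdmon m (pr k) (\<alpha>, u) = (\<beta>, w)" by fastforce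
  have BB1: "(\<beta>, w) \<in> BB" using pdmon_in_BB[OF bB, of "pr k"] unfolding e .
  let ?s = "tau (pr k) * pdcoef m n (pr k) (\<alpha>, u) :: 'a"
  let ?\<gamma> = "\<beta>(j := \<beta> j - p ^ q)"
  have "\<beta> j - p ^ q < p ^ t j" using BB1 j by (auto simp: in_BB_iff intro: le_less_trans[OF diff_le_self])
  then have BB2: "(?\<gamma>, w) \<in> BB" using BB1 j by (simp add: in_BB_iff)
  show ?thesis
  proof (cases "k \<in> II")
    case False
    have "(wb (dW j) ^^ p ^ q) (dh (\<alpha>, u)) k = (\<lambda>_. 0 :: 'a)"
    proof -
      have "(del j ^^ N) (\<lambda>_. 0) = (\<lambda>_. 0 :: 'a)" for N by (induction N) simp_all
      then show ?thesis using wb_dW_funpow[OF j dh_Wset, of "p ^ q" "(\<alpha>, u)"] False by (simp add: dh_outside)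
    qed
    then show ?thesis using False by (auto simp: ThetaM_def omw_def II_iff)
  next
    case k: True
    have "dh (\<alpha>, u) k = osmul ?s (bas (\<beta>, w))"
      using k b del_bas[OF bB, of "pr k", where ?'a = 'a]
      by (simp add: dh_apply HI_iff parO_even e) (simp add: osmul_def mult.assoc)
    then have "(wb (dW j) ^^ p ^ q) (dh (\<alpha>, u)) k = osmul ?s (if p ^ q \<le> \<beta> j then bas (?\<gamma>, w) else (\<lambda>_. 0))"
      using wb_dW_funpow[OF j dh_Wset, of "p ^ q" "(\<alpha>, u)"]
      by (simp add: del_funpow_osmul del_funpow_bas[OF BB1 j])
    then have T: "ThetaM m n p t j q (dh (\<alpha>, u)) k (\<gamma>, v)
        = (if p ^ q \<le> \<beta> j then mul (bas (zeroA, I1 m n)) (osmul ?s (bas (?\<gamma>, w))) (\<gamma>, v) else 0)"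
      by (simp add: ThetaM_def omw_def omegaI_def) (simp add: osmul_def)
    have M: "mul (bas (zeroA, I1 m n)) (osmul ?s (bas (?\<gamma>, w))) (\<gamma>, v)
        = (if (\<gamma>, v) = (?\<gamma>, I1 m n \<union> w) then ?s * moncoef m (zeroA, I1 m n) (?\<gamma>, w) else 0)"
    proof -
      have "osmul 1 (bas (zeroA, I1 m n)) = (bas (zeroA, I1 m n) :: 'a Oel)" by (simp add: osmul_def)
      moreover have "badd (zeroA, I1 m n) (?\<gamma>, w) = (?\<gamma>, I1 m n \<union> w)" by (simp add: badd_def fun_eq_iff)
      ultimately show ?thesis
        using d mul_osmul_bas[OF om BB2, of 1 ?s "(\<gamma>, v)"] by simp
    qed
    show ?thesis
    proof (cases "u = {} \<and> k \<in> I0 m")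
      case True
      then have "\<beta> = \<alpha>(pr k := \<alpha> (pr k) - 1)" "w = {}" using e by (auto simp: pdmon_def)
      moreover have "pdcoef m n (pr k) (\<alpha>, u) = (if \<alpha> (pr k) > 0 then 1 else (0 :: 'a))"
        using True by (simp add: pdcoef_def)
      moreover have "moncoef m (zeroA, I1 m n) (?\<gamma>, {}) = (1 :: 'a)"
        by (simp add: moncoef_def binomA_zeroA)
      ultimately show ?thesis unfolding T M using True by auto
    next
      case False
      have z: "?s * moncoef m (zeroA, I1 m n) (?\<gamma>, w) = 0"
      proof (cases "w = {}")
        case True
        then have "k \<in> I1 m n" using False k e by (auto simp: pdmon_def II_iff split: if_splits)
        then have nI: "pr k \<notin> I0 m" using I1_facts by blast
        then have "u - {pr k} = {}" using e True by (simp add: pdmon_def)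
        then have "u = {}" using I1_meets[OF u, of "pr k"] u by blast
        then show ?thesis using nI by (simp add: pdcoef_def)
      next
        case False
        then have "I1 m n \<inter> w \<noteq> {}" using BB1 by (auto simp: in_BB_iff)
        then show ?thesis by (simp add: moncoef_def)
      qed
      show ?thesis unfolding T M z if_cancel
        by (rule if_not_P[symmetric]) (use False in blast)
    qed
  qed
qed

text \<open>Component \<open>kap\<close> of \<open>D_H(x^omega)\<close> has coefficient -1 at the
  complement of \<open>kap\<close>. With this sign, \<open>cen \<beta>\<close> is the multiple of
  \<open>D_H(x^omega)\<close> formed by the odd components.\<close>

definition cen :: "(nat \<Rightarrow> nat) \<Rightarrow> 'a" where
  "cen \<beta> = - C (\<beta>, {}) kap (I1 m n - {kap})"

lemma C_I1_eval:
  assumes "(\<beta>, {}) \<in> BB" "k \<in> I1 m n"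
  shows "C (\<beta>, {}) k v = cen \<beta> * dh (omegaI m n) k (zeroA, v)"
proof -
  have HI: "(\<beta>, {}) \<in> HI" using assms by (simp add: HI_empty)
  have "k \<notin> I0 m" using assms(2) by (rule I1_not_I0)
  then have "C (\<beta>, {}) k v = 0" if "v \<noteq> I1 m n - {pr k}"
    using C_empty_support[OF HI, of k v] that by blast
  then show ?thesis
    using C_empty_omega[OF HI assms(2)] assms(2)
    by (cases "v = I1 m n - {pr k}") (simp_all add: dh_omega osmul_def bas_def cen_def)
qed

section \<open>The scalars and the comparison of coefficients\<close>

definition SI :: "(nat \<times> nat) set" where
  "SI = {(j, q). j \<in> I0 m \<and> 1 \<le> q \<and> q \<le> t j - 1}"

lemma finite_SI [simp]: "finite SI"
  by (rule finite_subset[of _ "SIGMA j:I0 m. {..t j}"]) (auto simp: SI_def)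

lemma SI_iff: "(j, q) \<in> SI \<longleftrightarrow> j \<in> I0 m \<and> 1 \<le> q \<and> q < t j"
  using t_pos[of j] by (auto simp: SI_def)

text \<open>Distinct parameters give distinct exponents, so each sum over \<open>SI\<close> below
  has at most one nonzero term.\<close>

lemma power_eps_inj:
  assumes "(\<lambda>i. p ^ q * epsA j i) = (\<lambda>i. p ^ q' * epsA j' i)"
  shows "(j, q) = (j', q')"
proof -
  have *: "p ^ q * epsA j j = p ^ q' * epsA j' j" using fun_cong[OF assms, of j] .
  then have "j = j'" using p_gt by (auto simp: epsA_def split: if_splits)
  then have "p ^ q = p ^ q'" using * by (simp add: epsA_def)
  then show ?thesis using \<open>j = j'\<close> p_gt by (simp add: power_inject_exp)
qed

lemma cen_sum:
  assumes \<delta>: "(\<delta>, {}) \<in> BB"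
  shows "cen \<delta> = (if \<delta> = piA m p t then cen (piA m p t) else 0)
    + (\<Sum>(j, q)\<in>SI. if \<delta> = (\<lambda>i. p ^ q * epsA j i) then cen (\<lambda>i. p ^ q * epsA j i) else 0)"
proof -
  \<comment> \<open>The entry at \<open>pr j\<close> separates the two: it is positive for
    \<open>piA\<close> and zero for a pure power of \<open>x_j\<close>.\<close>
  have pi_ne: "piA m p t \<noteq> (\<lambda>i. p ^ q * epsA j i)" if "j \<in> I0 m" for j q
  proof
    assume *: "piA m p t = (\<lambda>i. p ^ q * epsA j i)"
    show False
      using fun_cong[OF *, of "pr j"] pr_neq[OF that] pr_in_I0[OF that] p_le_power[OF pr_in_I0[OF that]] p_gt
      by (simp add: piA_def epsA_def)
  qed
  consider (top) "\<delta> = piA m p t" | (pow) j q where "(j, q) \<in> SI" "\<delta> = (\<lambda>i. p ^ q * epsA j i)"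
    | (none) "\<delta> \<noteq> piA m p t" "\<And>j q. (j, q) \<in> SI \<Longrightarrow> \<delta> \<noteq> (\<lambda>i. p ^ q * epsA j i)"
    by blast
  then show ?thesis
  proof cases
    case top
    have "(\<Sum>(j, q)\<in>SI. if \<delta> = (\<lambda>i. p ^ q * epsA j i) then cen (\<lambda>i. p ^ q * epsA j i) else 0) = 0"
      by (rule sum.neutral) (use pi_ne top in \<open>auto simp: SI_def\<close>)
    then show ?thesis using top by simp
  next
    case (pow j q)
    have "(\<Sum>x\<in>SI. (\<lambda>(j, q). if \<delta> = (\<lambda>i. p ^ q * epsA j i) then cen (\<lambda>i. p ^ q * epsA j i) else 0) x)
      = (\<lambda>(j, q). if \<delta> = (\<lambda>i. p ^ q * epsA j i) then cen (\<lambda>i. p ^ q * epsA j i) else 0) (j, q)"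
    proof (rule sum_single)
      fix x assume x: "x \<in> SI" "x \<noteq> (j, q)"
      obtain j' q' where "x = (j', q')" by fastforce
      then show "(\<lambda>(j, q). if \<delta> = (\<lambda>i. p ^ q * epsA j i) then cen (\<lambda>i. p ^ q * epsA j i) else 0) x = 0"
        using x(2) pow(2) power_eps_inj[of q j q' j'] by auto
    qed (use pow in auto)
    moreover have "\<delta> \<noteq> piA m p t" using pow pi_ne SI_iff by metis
    ultimately show ?thesis using pow(2) by simp
  next
    case none
    have "cen \<delta> = 0"
    proof (rule ccontr)
      assume "cen \<delta> \<noteq> 0"
      then have "C (\<delta>, {}) kap (I1 m n - {kap}) \<noteq> 0" by (simp add: cen_def)
      from C_kap_support[OF \<delta> this] show False using none SI_iff by metis
    qed
    moreover have "(\<Sum>(j, q)\<in>SI. if \<delta> = (\<lambda>i. p ^ q * epsA j i) then cen (\<lambda>i. p ^ q * epsA j i) else 0) = 0"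
      by (rule sum.neutral) (use none(2) in auto)
    ultimately show ?thesis using none(1) by simp
  qed
qed

text \<open>Component 1 is a mere choice; \<open>C_I0_consistent\<close> makes all components agree.
  The minus sign is that of \<open>tau (pr 1) = - tau 1\<close>, so that the value at component
  \<open>k\<close> becomes \<open>hcoef j q * tau (pr k)\<close>, as in
  \<open>Theta_eval\<close>.\<close>

definition hcoef :: "nat \<Rightarrow> nat \<Rightarrow> 'a" where
  "hcoef j q = - tau 1 * C (\<lambda>i. p ^ q * epsA j i + epsA (pr 1) i, {}) 1 (I1 m n)"

lemma C_I0_eval:
  assumes \<delta>: "(\<delta>, {}) \<in> BB" and k: "k \<in> I0 m"
  shows "C (\<delta>, {}) k v = (\<Sum>(j, q)\<in>SI.
    if v = I1 m n \<and> \<delta> = (\<lambda>i. p ^ q * epsA j i + epsA (pr k) i) then hcoef j q * tau (pr k) else 0)"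
proof (cases "v = I1 m n \<and> (\<exists>(j, q)\<in>SI. \<delta> = (\<lambda>i. p ^ q * epsA j i + epsA (pr k) i))")
  case True
  then obtain j q where jq: "(j, q) \<in> SI" and \<delta>_eq: "\<delta> = (\<lambda>i. p ^ q * epsA j i + epsA (pr k) i)" by auto
  have v: "v = I1 m n" using True by blast
  have "(\<Sum>x\<in>SI. (\<lambda>(j, q). if v = I1 m n \<and> \<delta> = (\<lambda>i. p ^ q * epsA j i + epsA (pr k) i) then hcoef j q * tau (pr k) else 0) x)
    = (\<lambda>(j, q). if v = I1 m n \<and> \<delta> = (\<lambda>i. p ^ q * epsA j i + epsA (pr k) i) then hcoef j q * tau (pr k) else 0) (j, q)"
  proof (rule sum_single)
    fix x assume x: "x \<in> SI" "x \<noteq> (j, q)"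
    obtain j' q' where x': "x = (j', q')" by fastforce
    have "\<delta> \<noteq> (\<lambda>i. p ^ q' * epsA j' i + epsA (pr k) i)"
    proof
      assume "\<delta> = (\<lambda>i. p ^ q' * epsA j' i + epsA (pr k) i)"
      then have "(\<lambda>i. p ^ q * epsA j i) = (\<lambda>i. p ^ q' * epsA j' i)"
        unfolding \<delta>_eq by (simp add: fun_eq_iff)
      from power_eps_inj[OF this] show False using x(2) x' by simp
    qed
    then show "(\<lambda>(j, q). if v = I1 m n \<and> \<delta> = (\<lambda>i. p ^ q * epsA j i + epsA (pr k) i) then hcoef j q * tau (pr k) else 0) x = 0"
      using x' by simp
  qed (use jq in auto)
  also have "\<dots> = hcoef j q * tau (pr k)" using v \<delta>_eq by simp
  also have "\<dots> = C (\<delta>, {}) k v"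
  proof -
    have "1 \<in> I0 m" using m_pos by (simp add: I0_def)
    then have "tau 1 * C (\<lambda>i. p ^ q * epsA j i + epsA (pr 1) i, {}) 1 (I1 m n)
      = tau k * C (\<delta>, {}) k (I1 m n)"
      unfolding \<delta>_eq using jq SI_iff k by (intro C_I0_consistent) auto
    then have "hcoef j q * tau (pr k) = tau k * C (\<delta>, {}) k (I1 m n) * tau k"
      unfolding hcoef_def tau_pr_I0[OF k] by simp
    also have "\<dots> = of_int (tauI m k * tauI m k) * C (\<delta>, {}) k (I1 m n)" by (simp only: of_int_mult mult_ac)
    finally show ?thesis using v by simp
  qed
  finally show ?thesis by simp
next
  case False
  have "C (\<delta>, {}) k v = 0"
  proof (rule ccontr)
    assume nz: "C (\<delta>, {}) k v \<noteq> 0"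
    have "(\<delta>, {}) \<in> HI" using \<delta> by (simp add: HI_empty)
    from C_empty_support[OF this nz] have "v = I1 m n" using I0_I1_disjoint[OF k] by blast
    moreover obtain i e where "i \<in> I0 m" "1 \<le> e" "e < t i" "\<delta> = (\<lambda>j. p ^ e * epsA i j + epsA (pr k) j)"
      using C_I0_support[OF k \<delta> nz] by blast
    ultimately show False using False SI_iff[of i e] by blast
  qed
  moreover have "(\<Sum>(j, q)\<in>SI.
    if v = I1 m n \<and> \<delta> = (\<lambda>i. p ^ q * epsA j i + epsA (pr k) i) then hcoef j q * tau (pr k) else 0) = 0"
  proof (intro sum.neutral ballI)
    fix x assume x: "x \<in> SI"
    obtain j q where "x = (j, q)" by fastforce
    moreover from this have "\<not> (v = I1 m n \<and> \<delta> = (\<lambda>i. p ^ q * epsA j i + epsA (pr k) i))"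
      using False x by blast
    ultimately show "(case x of (j, q) \<Rightarrow>
      if v = I1 m n \<and> \<delta> = (\<lambda>i. p ^ q * epsA j i + epsA (pr k) i) then hcoef j q * tau (pr k) else 0) = 0"
      by auto
  qed
  ultimately show ?thesis by simp
qed

text \<open>\<open>psi_C\<close> speaks of the difference of exponents, \<open>Phi_eval\<close> of a
  lowered exponent; this translates between the two.\<close>

lemma shift_iff:
  fixes \<alpha> \<gamma> :: "nat \<Rightarrow> nat"
  shows "N \<le> \<alpha> j \<and> \<gamma> = \<alpha>(j := \<alpha> j - N) \<longleftrightarrow> (\<forall>i. \<gamma> i \<le> \<alpha> i) \<and> (\<lambda>i. \<alpha> i - \<gamma> i) = (\<lambda>i. N * epsA j i)"
proof
  assume "N \<le> \<alpha> j \<and> \<gamma> = \<alpha>(j := \<alpha> j - N)"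
  then show "(\<forall>i. \<gamma> i \<le> \<alpha> i) \<and> (\<lambda>i. \<alpha> i - \<gamma> i) = (\<lambda>i. N * epsA j i)"
    by (auto simp: epsA_def fun_eq_iff)
next
  assume *: "(\<forall>i. \<gamma> i \<le> \<alpha> i) \<and> (\<lambda>i. \<alpha> i - \<gamma> i) = (\<lambda>i. N * epsA j i)"
  then have "\<gamma> i \<le> \<alpha> i" "\<alpha> i - \<gamma> i = N * epsA j i" for i by (auto simp: fun_eq_iff)
  then have "\<alpha> i = \<gamma> i + N * epsA j i" for i by (metis le_add_diff_inverse)
  then have "\<alpha> = (\<lambda>i. \<gamma> i + N * epsA j i)" by blast
  then show "N \<le> \<alpha> j \<and> \<gamma> = \<alpha>(j := \<alpha> j - N)" by (auto simp: epsA_def fun_eq_iff)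
qed

lemma shift2_iff:
  fixes \<alpha> \<gamma> :: "nat \<Rightarrow> nat"
  shows "0 < \<alpha> l \<and> N \<le> (\<alpha>(l := \<alpha> l - 1)) j \<and> \<gamma> = (\<alpha>(l := \<alpha> l - 1))(j := (\<alpha>(l := \<alpha> l - 1)) j - N)
    \<longleftrightarrow> (\<forall>i. \<gamma> i \<le> \<alpha> i) \<and> (\<lambda>i. \<alpha> i - \<gamma> i) = (\<lambda>i. N * epsA j i + epsA l i)"
proof
  assume "0 < \<alpha> l \<and> N \<le> (\<alpha>(l := \<alpha> l - 1)) j \<and> \<gamma> = (\<alpha>(l := \<alpha> l - 1))(j := (\<alpha>(l := \<alpha> l - 1)) j - N)"
  then show "(\<forall>i. \<gamma> i \<le> \<alpha> i) \<and> (\<lambda>i. \<alpha> i - \<gamma> i) = (\<lambda>i. N * epsA j i + epsA l i)"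
    by (cases "j = l") (auto simp: epsA_def fun_eq_iff)
next
  assume *: "(\<forall>i. \<gamma> i \<le> \<alpha> i) \<and> (\<lambda>i. \<alpha> i - \<gamma> i) = (\<lambda>i. N * epsA j i + epsA l i)"
  then have "\<gamma> i \<le> \<alpha> i" "\<alpha> i - \<gamma> i = N * epsA j i + epsA l i" for i by (auto simp: fun_eq_iff)
  then have "\<alpha> i = \<gamma> i + (N * epsA j i + epsA l i)" for i by (metis le_add_diff_inverse)
  then have "\<alpha> = (\<lambda>i. \<gamma> i + (N * epsA j i + epsA l i))" by blast
  then show "0 < \<alpha> l \<and> N \<le> (\<alpha>(l := \<alpha> l - 1)) j \<and> \<gamma> = (\<alpha>(l := \<alpha> l - 1))(j := (\<alpha>(l := \<alpha> l - 1)) j - N)"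
    by (cases "j = l") (auto simp: epsA_def fun_eq_iff)
qed

text \<open>All maps are compared at each coefficient, where \<open>psi_C\<close> turns the left
  side into \<open>C\<close> at the difference of exponents. Odd components are then matched by
  \<open>cen_sum\<close>, even ones by \<open>C_I0_eval\<close>.\<close>

lemma derivation_formula:
  assumes b: "b \<in> HI"
  shows "psi b = wadd (wadd (Gam m n p t (cen (piA m p t)) b)
                          (wsmul 0 (wbr m n p t (frakD m n p t) (DHb m n p t b))))
                    (wsum (\<lambda>(j, q). wadd (wsmul (cen (\<lambda>i. p ^ q * epsA j i)) (PhiM m n p t j q b))
                                         (wsmul (hcoef j q) (ThetaM m n p t j q (DHb m n p t b))))
                          {(j, q). j \<in> I0 m \<and> 1 \<le> q \<and> q \<le> t j - 1})" (is "_ = ?R")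
proof (intro ext)
  fix k and d :: idx
  obtain \<alpha> u where b_eq: "b = (\<alpha>, u)" by fastforce
  obtain \<gamma> v where d_eq: "d = (\<gamma>, v)" by fastforce
  let ?lam = "\<lambda>j q. cen (\<lambda>i. p ^ q * epsA j i)"
  have R: "?R k d = Gam m n p t (cen (piA m p t)) b k d
     + (\<Sum>(j, q)\<in>SI. ?lam j q * PhiM m n p t j q b k d + hcoef j q * ThetaM m n p t j q (dh b) k d)"
    by (simp add: wadd_def wsmul_def wsum_def SI_def case_prod_unfold)
  show "psi b k d = ?R k d"
  proof (cases "d \<in> BB")
    case False
    have "psi b k d = 0" using psi_nonzero[OF b] False by blast
    moreover have "dh (omegaI m n) k d = (0 :: 'a)"
      using Wset_D[OF dh_Wset, of "omegaI m n" k d] False by blast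
    then have "Gam m n p t (cen (piA m p t)) b k d = 0" by (simp add: Gam_def wsmul_def wzero_def)
    moreover have "PhiM m n p t j q b k d = (0 :: 'a)" "ThetaM m n p t j q (dh b) k d = (0 :: 'a)" for j q
      using False by (simp_all add: PhiM_def ThetaM_def omw_def mul_outside)
    ultimately show ?thesis unfolding R by (simp add: case_prod_unfold)
  next
    case True
    have bHI: "(\<alpha>, u) \<in> HI" and d: "(\<gamma>, v) \<in> BB" using b True by (simp_all add: b_eq d_eq)
    let ?\<delta> = "\<lambda>i. \<alpha> i - \<gamma> i"
    have P: "psi b k d = (if \<forall>i. \<gamma> i \<le> \<alpha> i then C (?\<delta>, u) k v else 0)"
      unfolding b_eq d_eq by (rule psi_C[OF bHI d])
    let ?om = "dh (omegaI m n) k (zeroA, v) :: 'a"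
    have Phi: "PhiM m n p t j q b k d = (if u = {} \<and> (\<forall>i. \<gamma> i \<le> \<alpha> i) \<and> ?\<delta> = (\<lambda>i. p ^ q * epsA j i) then ?om else 0)"
      if "j \<in> I0 m" for j q
      unfolding b_eq d_eq Phi_eval[OF bHI that d] shift_iff[of "p ^ q" \<alpha> j \<gamma>] by simp
    have Theta: "ThetaM m n p t j q (dh b) k d = (if u = {} \<and> k \<in> I0 m \<and> v = I1 m n \<and> (\<forall>i. \<gamma> i \<le> \<alpha> i)
        \<and> ?\<delta> = (\<lambda>i. p ^ q * epsA j i + epsA (pr k) i) then tau (pr k) else 0 :: 'a)"
      if "j \<in> I0 m" for j q
      unfolding b_eq d_eq Theta_eval[OF bHI that d] shift2_iff[of \<alpha> "pr k" "p ^ q" j \<gamma>] by simp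
    have Gm: "Gam m n p t (cen (piA m p t)) b k d
        = (if u = {} \<and> (\<forall>i. \<gamma> i \<le> \<alpha> i) \<and> ?\<delta> = piA m p t then cen (piA m p t) * ?om else 0)"
    proof -
      \<comment> \<open>\<open>piA\<close> is the maximal exponent, so a difference can equal it
        only when nothing is subtracted.\<close>
      have "\<alpha> = piA m p t \<and> \<gamma> = zeroA \<longleftrightarrow> (\<forall>i. \<gamma> i \<le> \<alpha> i) \<and> ?\<delta> = piA m p t"
      proof
        assume *: "(\<forall>i. \<gamma> i \<le> \<alpha> i) \<and> ?\<delta> = piA m p t"
        have "\<alpha> i = piA m p t i \<and> \<gamma> i = 0" for i
        proof (cases "i \<in> I0 m")
          case True
          then have "\<alpha> i < p ^ t i" using bHI by (simp add: HI_iff in_BB_iff)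
          moreover have "\<alpha> i - \<gamma> i = p ^ t i - 1" "\<gamma> i \<le> \<alpha> i"
            using * True fun_cong[of ?\<delta> "piA m p t" i] by (auto simp: piA_def)
          ultimately have "\<alpha> i = p ^ t i - 1 \<and> \<gamma> i = 0" by arith
          then show ?thesis using True by (simp add: piA_def)
        qed (use bHI d in \<open>auto simp: HI_iff in_BB_iff piA_def\<close>)
        then show "\<alpha> = piA m p t \<and> \<gamma> = zeroA" by (auto simp: fun_eq_iff)
      qed (simp add: fun_eq_iff)
      then show ?thesis
        unfolding Gam_def b_eq d_eq using dh_omega_eval[of k \<gamma> v]
        by (auto simp: wsmul_def wzero_def)
    qed
    show ?thesis
    proof (cases "u = {} \<and> (\<forall>i. \<gamma> i \<le> \<alpha> i)")
      case False
      have "C (?\<delta>, u) k v = 0" if "u \<noteq> {}"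
        using C_nonempty_zero[OF _ _ that] bHI by (simp add: HI_iff in_BB_iff)
      then have "psi b k d = 0" unfolding P using False by auto
      moreover have "(\<Sum>(j, q)\<in>SI. ?lam j q * PhiM m n p t j q b k d + hcoef j q * ThetaM m n p t j q (dh b) k d) = 0"
      proof (intro sum.neutral ballI)
        fix x assume x: "x \<in> SI"
        obtain j q where jq: "x = (j, q)" by fastforce
        have j: "j \<in> I0 m" using x by (simp add: jq SI_def)
        have "PhiM m n p t j q b k d = (0 :: 'a)" unfolding Phi[OF j] using False by (intro if_not_P) blast
        moreover have "ThetaM m n p t j q (dh b) k d = (0 :: 'a)"
          unfolding Theta[OF j] using False by (intro if_not_P) blast
        ultimately show "(case x of (j, q) \<Rightarrow>
          ?lam j q * PhiM m n p t j q b k d + hcoef j q * ThetaM m n p t j q (dh b) k d) = 0"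
          by (simp add: jq)
      qed
      moreover have "Gam m n p t (cen (piA m p t)) b k d = 0"
        unfolding Gm using False by (intro if_not_P) blast
      ultimately show ?thesis unfolding R by (simp only: add_0_right)
    next
      case True
      have "(\<alpha>, {}) \<in> BB" using bHI unfolding conjunct1[OF True] HI_iff by blast
      then have \<delta>: "(?\<delta>, {}) \<in> BB" by (rule BB_down) (rule diff_le_self)
      have S: "(\<Sum>(j, q)\<in>SI. ?lam j q * PhiM m n p t j q b k d + hcoef j q * ThetaM m n p t j q (dh b) k d)
        = (\<Sum>(j, q)\<in>SI. (if ?\<delta> = (\<lambda>i. p ^ q * epsA j i) then ?lam j q else 0) * ?om)
        + (if k \<in> I0 m then \<Sum>(j, q)\<in>SI. if v = I1 m n \<and> ?\<delta> = (\<lambda>i. p ^ q * epsA j i + epsA (pr k) i)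
             then hcoef j q * tau (pr k) else 0 else 0)"
      proof -
        have gen: "x * (if P then y else 0) + z * (if Q \<and> R then w else 0)
          = (if P then x else 0) * y + (if Q then (if R then z * w else 0) else 0)" for x y z w :: 'a and P Q R
          by simp
        let ?G = "\<lambda>j q. if v = I1 m n \<and> ?\<delta> = (\<lambda>i. p ^ q * epsA j i + epsA (pr k) i)
          then hcoef j q * tau (pr k) else 0"
        have "(\<Sum>(j, q)\<in>SI. ?lam j q * PhiM m n p t j q b k d + hcoef j q * ThetaM m n p t j q (dh b) k d)
          = (\<Sum>(j, q)\<in>SI. (if ?\<delta> = (\<lambda>i. p ^ q * epsA j i) then ?lam j q else 0) * ?om
             + (if k \<in> I0 m then ?G j q else 0))"
        proof (intro sum.cong refl)
          fix x assume x: "x \<in> SI"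
          obtain j q where jq: "x = (j, q)" by fastforce
          have j: "j \<in> I0 m" using x by (simp add: jq SI_def)
          have ph: "PhiM m n p t j q b k d = (if ?\<delta> = (\<lambda>i. p ^ q * epsA j i) then ?om else 0)"
            unfolding Phi[OF j] by (simp only: True simp_thms)
          have th: "ThetaM m n p t j q (dh b) k d = (if k \<in> I0 m \<and> v = I1 m n
              \<and> ?\<delta> = (\<lambda>i. p ^ q * epsA j i + epsA (pr k) i) then tau (pr k) else 0 :: 'a)"
            unfolding Theta[OF j] by (simp only: True simp_thms)
          show "(case x of (j, q) \<Rightarrow> ?lam j q * PhiM m n p t j q b k d + hcoef j q * ThetaM m n p t j q (dh b) k d)
            = (case x of (j, q) \<Rightarrow> (if ?\<delta> = (\<lambda>i. p ^ q * epsA j i) then ?lam j q else 0) * ?om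
             + (if k \<in> I0 m then ?G j q else 0))"
            unfolding jq case_prod_conv ph th by (rule gen)
        qed
        also have "\<dots> = (\<Sum>(j, q)\<in>SI. (if ?\<delta> = (\<lambda>i. p ^ q * epsA j i) then ?lam j q else 0) * ?om)
          + (if k \<in> I0 m then \<Sum>(j, q)\<in>SI. ?G j q else 0)"
          unfolding case_prod_unfold sum.distrib by (cases "k \<in> I0 m") (simp_all only: if_True if_False sum.neutral_const)
        finally show ?thesis .
      qed
      consider "k \<in> I0 m" | "k \<in> I1 m n" | "k \<notin> II" by (auto simp: II_iff)
      then show ?thesis
      proof cases
        case 1
        then have "?om = 0" using I0_I1_disjoint[OF 1] by (simp add: dh_omega)
        then show ?thesis unfolding R S Gm P using True 1 C_I0_eval[OF \<delta> 1, of v] by simp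
      next
        case 2
        have "C (?\<delta>, {}) k v = (if ?\<delta> = piA m p t then cen (piA m p t) else 0) * ?om
          + (\<Sum>(j, q)\<in>SI. (if ?\<delta> = (\<lambda>i. p ^ q * epsA j i) then ?lam j q else 0) * ?om)"
          unfolding C_I1_eval[OF \<delta> 2] by (subst cen_sum[OF \<delta>])
            (simp add: distrib_right sum_distrib_right case_prod_unfold)
        then show ?thesis unfolding R S Gm P using True I1_not_I0[OF 2] by simp
      next
        case 3
        have "?om = 0" using 3 by (simp add: dh_outside)
        moreover have "psi b k d = 0" using psi_nonzero[OF b] 3 by blast
        ultimately show ?thesis unfolding R S Gm using 3 by (auto simp: II_iff)
      qed
    qed
  qed
qed

end

theorem theorem4p8:
  fixes m n p :: nat and t :: "nat \<Rightarrow> nat"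
    and \<phi> :: "'a::field Wel \<Rightarrow> 'a Wel"
  assumes p_prime: "prime p" and p_gt: "p > 3"
    and char: "CHAR('a) = p"
    and closed: "alg_closed TYPE('a)"
    and m_pos: "m > 0" and m_even: "even m"
    and n_odd: "odd n"
    and t_pos: "\<forall>i\<in>I0 m. t i > 0"
    and into_W1: "\<forall>x\<in>H0 m n p t. \<phi> x \<in> W1 m n p t"
    and additive: "\<forall>x\<in>H0 m n p t. \<forall>y\<in>H0 m n p t. \<phi> (wadd x y) = wadd (\<phi> x) (\<phi> y)"
    and homog_scal: "\<forall>c. \<forall>x\<in>H0 m n p t. \<phi> (wsmul c x) = wsmul c (\<phi> x)"
    and derivation: "\<forall>x\<in>H0 m n p t. \<forall>y\<in>H0 m n p t.
         \<phi> (wbr m n p t x y) = wadd (wbr m n p t (\<phi> x) y) (wbr m n p t x (\<phi> y))"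
    and Z_homogeneous: "\<exists>d::int. \<forall>k. \<forall>x\<in>H0deg m n p t k. \<phi> x \<in> Wdeg m n p t (k + d)"
    and vanish: "\<forall>x\<in>H0deg m n p t (-1). \<forall>y\<in>H0deg m n p t 0. \<phi> (wadd x y) = wzero"
  shows "\<exists>(\<mu>::'a) (lda::'a) (lam::nat \<Rightarrow> nat \<Rightarrow> 'a) (mu::nat \<Rightarrow> nat \<Rightarrow> 'a).
           \<forall>b\<in>Hidx m n p t.
             \<phi> (DHb m n p t b) =
               wadd (wadd (Gam m n p t \<mu> b)
                          (wsmul lda (wbr m n p t (frakD m n p t) (DHb m n p t b))))
                    (wsum (\<lambda>(j, q). wadd (wsmul (lam j q) (PhiM m n p t j q b))
                                         (wsmul (mu j q) (ThetaM m n p t j q (DHb m n p t b))))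
                          {(j, q). j \<in> I0 m \<and> 1 \<le> q \<and> q \<le> t j - 1})"
proof -
  interpret hderiv m n p t \<phi>
    by unfold_locales (use assms in blast)+
  show ?thesis
    by (intro exI ballI) (rule derivation_formula[unfolded psi_def])
qed

end
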